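(* Suppose $C$ is a closed subset of a Riemannian manifold $N$. Let $$\mathcal{C}:=\{(x,t): t\ge 0,\ x\in F_t(C)\}$$ be the biggest flow generated by $C$, and let $M=\partial\mathcal{C}$, where the boundary is taken relative to $N\times[0,\infty)$, i.e. $\partial\mathcal{C}=\mathcal{C}\setminus\mathrm{interior}(\mathcal{C})$ with $\mathrm{interior}(\mathcal{C})$ the largest subset of $\mathcal{C}$ that is relatively open in $N\times[0,\infty)$. Then $M$ is a weak set flow and $M(0)=\partial C$.
   Context: Smooth barriers. Let $a<b$. A family $t\in[a,b]\mapsto K(t)$ of closed subsets of $N$ is a smooth barrier if it is a smooth one-parameter family of closed regions with smooth boundary; that is, there is a smooth $f:N\times[a,b]\to\mathbf{R}$ with $K(t)=\{x: f(x,t)\le 0\}$ and spatial gradient $\nabla f(x,t)\ne 0$ whenever $f(x,t)=0$. It is compact if $\bigcup_{t\in[a,b]}K(t)$ is a compact subset of $N$. For $x\in\partial K(t)$: $\nu_K=\nabla f/|\nabla f|$ is the unit normal to $\partial K(t)$ pointing out of $K(t)$; $\mathrm{H}_K=-\mathrm{Div}(\nabla f/|\nabla f|)$ is the dot product of $\nu_K$ with the mean curvature vector of $\partial K(t)$; $\mathbf{v}_K=-\frac{1}{|\nabla f|}\frac{\partial f}{\partial t}$ is the normal velocity of $\tau\mapsto\partial K(\tau)$ in the direction $\nu_K$; and $\Phi_K=\mathbf{v}_K-\mathrm{H}_K$. Weak set flows. Let $Z$ be a closed subset of $N\times[0,\infty)$ and $Z(t)=\{x\in N:(x,t)\in Z\}$.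 $Z$ is a weak set flow (with starting time $0$) if: whenever $t\in[a,b]\mapsto K(t)$ is a smooth compact barrier with $a\ge 0$ such that $K(t)\cap Z(t)=\emptyset$ for all $t\in[a,b)$, and $p\in K(b)\cap Z(b)$, then $p\in\partial K(b)$ and $\Phi_K(p,b)\ge 0$. Biggest flow. For each closed $C\subset N$ there is a (unique) weak set flow $Y\subset N\times[0,\infty)$, the biggest flow generated by $C$, with $Y(0)=C$ and such that every weak set flow $Z\subset N\times[0,\infty)$ with $Z(0)\subset C$ satisfies $Z(t)\subset Y(t)$ for all $t\ge0$. One writes $F_t(C)=Y(t)$. *)

theory Defs
  imports "HOL-Analysis.Analysis"
begin

section \<open>Smooth functions on subsets of Euclidean space\<close>

text \<open>\<open>Ck_on k S f\<close> is meant for open \<open>S\<close>.\<close>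

fun Ck_on :: "nat \<Rightarrow> 'b::euclidean_space set \<Rightarrow> ('b \<Rightarrow> 'c::real_normed_vector) \<Rightarrow> bool" where
  "Ck_on 0 S f \<longleftrightarrow> continuous_on S f"
| "Ck_on (Suc k) S f \<longleftrightarrow>
     (\<forall>x\<in>S. f differentiable (at x)) \<and>
     (\<forall>v. Ck_on k S (\<lambda>x. frechet_derivative f (at x) v))"

text \<open>Smoothness on an arbitrary set means existence of local smooth extensions. It is used
  for open sets, where it is the usual notion, and for products of an open set with a compact
  time interval, where it is smoothness up to the initial and final times.\<close>

definition smooth_on :: "'b::euclidean_space set \<Rightarrow> ('b \<Rightarrow> 'c::real_normed_vector) \<Rightarrow> bool" where
  "smooth_on S f \<longleftrightarrow>
     (\<forall>p\<in>S. \<exists>V h. open V \<and> p \<in> V \<and> (\<forall>k. Ck_on k V h) \<and> (\<forall>q\<in>V \<inter> S. h q = f q))"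


section \<open>Riemannian manifolds\<close>

text \<open>The manifold is the whole of the Hausdorff, second countable type \<open>'a\<close>; its smooth
  structure is given by an atlas. A chart is a pair \<open>(U, \<phi>)\<close>, where the values of \<open>\<phi>\<close> outside
  the open set \<open>U\<close> are irrelevant.\<close>

type_synonym ('a, 'n) chart = "'a set \<times> ('a \<Rightarrow> real ^ 'n)"

definition chart_inv :: "('a, 'n::finite) chart \<Rightarrow> real ^ 'n \<Rightarrow> 'a" where
  "chart_inv c = inv_into (fst c) (snd c)"

definition is_chart :: "('a::topological_space, 'n::finite) chart \<Rightarrow> bool" where
  "is_chart c \<longleftrightarrow> open (fst c) \<and> open (snd c ` fst c) \<and>
     homeomorphism (fst c) (snd c ` fst c) (snd c) (chart_inv c)"

definition transition :: "('a, 'n::finite) chart \<Rightarrow> ('a, 'n) chart \<Rightarrow> real ^ 'n \<Rightarrow> real ^ 'n" where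
  "transition c d = snd d \<circ> chart_inv c"

definition smooth_atlas :: "('a::topological_space, 'n::finite) chart set \<Rightarrow> bool" where
  "smooth_atlas A \<longleftrightarrow>
     (\<forall>c\<in>A. is_chart c) \<and> \<Union> (fst ` A) = UNIV \<and>
     (\<forall>c\<in>A. \<forall>d\<in>A. smooth_on (snd c ` (fst c \<inter> fst d)) (transition c d))"

text \<open>A Riemannian metric is given by its coordinate matrices: \<open>g c y\<close> is the matrix
  \<open>(g\<^sub>i\<^sub>j)\<close> in the chart \<open>c\<close> at the point with coordinates \<open>y\<close>. The last condition is the
  transformation law of a covariant 2-tensor.\<close>

definition riemannian_metric ::
  "('a::topological_space, 'n::finite) chart set \<Rightarrow>
   (('a, 'n) chart \<Rightarrow> real ^ 'n \<Rightarrow> real ^ 'n ^ 'n) \<Rightarrow> bool" where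
  "riemannian_metric A g \<longleftrightarrow>
     (\<forall>c\<in>A. smooth_on (snd c ` fst c) (g c)) \<and>
     (\<forall>c\<in>A. \<forall>y\<in>snd c ` fst c.
        transpose (g c y) = g c y \<and> (\<forall>v. v \<noteq> 0 \<longrightarrow> v \<bullet> (g c y *v v) > 0)) \<and>
     (\<forall>c\<in>A. \<forall>d\<in>A. \<forall>y\<in>snd c ` (fst c \<inter> fst d).
        let J = matrix (frechet_derivative (transition c d) (at y))
        in g c y = transpose J ** g d (transition c d y) ** J)"

definition riemannian_manifold ::
  "('a::{t2_space,second_countable_topology}, 'n::finite) chart set \<Rightarrow>
   (('a, 'n) chart \<Rightarrow> real ^ 'n \<Rightarrow> real ^ 'n ^ 'n) \<Rightarrow> bool" where
  "riemannian_manifold A g \<longleftrightarrow> smooth_atlas A \<and> riemannian_metric A g"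


section \<open>Gradient and divergence in coordinates\<close>

text \<open>Here \<open>G\<close> is the coordinate matrix of the metric on an open subset of Euclidean space:
  \<open>grad\<close> has components \<open>g\<^sup>i\<^sup>j \<partial>\<^sub>j u\<close>, and the divergence of \<open>X\<close> is
  \<open>(1 / sqrt (det g)) \<partial>\<^sub>i (sqrt (det g) X\<^sup>i)\<close>, both with summation over repeated indices.\<close>

definition partial_deriv :: "(real ^ 'n::finite \<Rightarrow> real) \<Rightarrow> 'n \<Rightarrow> real ^ 'n \<Rightarrow> real" where
  "partial_deriv u i y = frechet_derivative u (at y) (axis i 1)"

definition grad ::
  "(real ^ 'n::finite \<Rightarrow> real ^ 'n ^ 'n) \<Rightarrow> (real ^ 'n \<Rightarrow> real) \<Rightarrow> real ^ 'n \<Rightarrow> real ^ 'n" where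
  "grad G u y = matrix_inv (G y) *v (\<chi> i. partial_deriv u i y)"

definition metric_norm ::
  "(real ^ 'n::finite \<Rightarrow> real ^ 'n ^ 'n) \<Rightarrow> real ^ 'n \<Rightarrow> real ^ 'n \<Rightarrow> real" where
  "metric_norm G y v = sqrt (v \<bullet> (G y *v v))"

definition unit_normal ::
  "(real ^ 'n::finite \<Rightarrow> real ^ 'n ^ 'n) \<Rightarrow> (real ^ 'n \<Rightarrow> real) \<Rightarrow> real ^ 'n \<Rightarrow> real ^ 'n" where
  "unit_normal G u y = grad G u y /\<^sub>R metric_norm G y (grad G u y)"

definition divergence ::
  "(real ^ 'n::finite \<Rightarrow> real ^ 'n ^ 'n) \<Rightarrow> (real ^ 'n \<Rightarrow> real ^ 'n) \<Rightarrow> real ^ 'n \<Rightarrow> real" where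
  "divergence G X y =
     (\<Sum>i\<in>UNIV. partial_deriv (\<lambda>z. sqrt (det (G z)) * X z $ i) i y) / sqrt (det (G y))"


section \<open>Smooth barriers\<close>

definition coord_rep :: "('a, 'n::finite) chart \<Rightarrow> ('a \<Rightarrow> 'b) \<Rightarrow> real ^ 'n \<Rightarrow> 'b" where
  "coord_rep c u = u \<circ> chart_inv c"

text \<open>In the next four definitions, \<open>c\<close> is a chart around the point \<open>x\<close> and \<open>f\<close> is the defining
  function of a barrier with time interval \<open>[a, b]\<close>. The three scalar quantities do not depend
  on the choice of \<open>c\<close>, and neither does the vanishing of the gradient. The time derivative
  is one-sided at the end points of \<open>[a, b]\<close>.\<close>

definition spatial_grad ::
  "(('a, 'n::finite) chart \<Rightarrow> real ^ 'n \<Rightarrow> real ^ 'n ^ 'n) \<Rightarrow> ('a, 'n) chart \<Rightarrow>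
   ('a \<Rightarrow> real \<Rightarrow> real) \<Rightarrow> 'a \<Rightarrow> real \<Rightarrow> real ^ 'n" where
  "spatial_grad g c f x t = grad (g c) (coord_rep c (\<lambda>z. f z t)) (snd c x)"

definition mean_curv ::
  "(('a, 'n::finite) chart \<Rightarrow> real ^ 'n \<Rightarrow> real ^ 'n ^ 'n) \<Rightarrow> ('a, 'n) chart \<Rightarrow>
   ('a \<Rightarrow> real \<Rightarrow> real) \<Rightarrow> 'a \<Rightarrow> real \<Rightarrow> real" where
  "mean_curv g c f x t =
     - divergence (g c) (unit_normal (g c) (coord_rep c (\<lambda>z. f z t))) (snd c x)"

definition normal_velocity ::
  "(('a, 'n::finite) chart \<Rightarrow> real ^ 'n \<Rightarrow> real ^ 'n ^ 'n) \<Rightarrow> ('a, 'n) chart \<Rightarrow>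
   real \<Rightarrow> real \<Rightarrow> ('a \<Rightarrow> real \<Rightarrow> real) \<Rightarrow> 'a \<Rightarrow> real \<Rightarrow> real" where
  "normal_velocity g c a b f x t =
     - (1 / metric_norm (g c) (snd c x) (spatial_grad g c f x t)) *
       vector_derivative (f x) (at t within {a..b})"

definition barrier_Phi ::
  "(('a, 'n::finite) chart \<Rightarrow> real ^ 'n \<Rightarrow> real ^ 'n ^ 'n) \<Rightarrow> ('a, 'n) chart \<Rightarrow>
   real \<Rightarrow> real \<Rightarrow> ('a \<Rightarrow> real \<Rightarrow> real) \<Rightarrow> 'a \<Rightarrow> real \<Rightarrow> real" where
  "barrier_Phi g c a b f x t = normal_velocity g c a b f x t - mean_curv g c f x t"

definition smooth_in_spacetime ::
  "('a, 'n::finite) chart set \<Rightarrow> real \<Rightarrow> real \<Rightarrow> ('a \<Rightarrow> real \<Rightarrow> real) \<Rightarrow> bool" where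
  "smooth_in_spacetime A a b f \<longleftrightarrow>
     (\<forall>c\<in>A. smooth_on ((snd c ` fst c) \<times> {a..b}) (\<lambda>(y, t). f (chart_inv c y) t))"

text \<open>\<open>smooth_barrier A g a b K f\<close>: the family \<open>K\<close> is a smooth barrier on \<open>[a, b]\<close>, as witnessed
  by the defining function \<open>f\<close>.\<close>

definition smooth_barrier ::
  "('a::{t2_space,second_countable_topology}, 'n::finite) chart set \<Rightarrow>
   (('a, 'n) chart \<Rightarrow> real ^ 'n \<Rightarrow> real ^ 'n ^ 'n) \<Rightarrow>
   real \<Rightarrow> real \<Rightarrow> (real \<Rightarrow> 'a set) \<Rightarrow> ('a \<Rightarrow> real \<Rightarrow> real) \<Rightarrow> bool" where
  "smooth_barrier A g a b K f \<longleftrightarrow>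
     a < b \<and> smooth_in_spacetime A a b f \<and>
     (\<forall>t\<in>{a..b}. K t = {x. f x t \<le> 0}) \<and>
     (\<forall>t\<in>{a..b}. \<forall>x. f x t = 0 \<longrightarrow> (\<forall>c\<in>A. x \<in> fst c \<longrightarrow> spatial_grad g c f x t \<noteq> 0))"

definition compact_barrier ::
  "('a::{t2_space,second_countable_topology}, 'n::finite) chart set \<Rightarrow>
   (('a, 'n) chart \<Rightarrow> real ^ 'n \<Rightarrow> real ^ 'n ^ 'n) \<Rightarrow>
   real \<Rightarrow> real \<Rightarrow> (real \<Rightarrow> 'a set) \<Rightarrow> ('a \<Rightarrow> real \<Rightarrow> real) \<Rightarrow> bool" where
  "compact_barrier A g a b K f \<longleftrightarrow>
     smooth_barrier A g a b K f \<and> compact (\<Union>t\<in>{a..b}. K t)"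


section \<open>Weak set flows\<close>

definition time_slice :: "('a \<times> real) set \<Rightarrow> real \<Rightarrow> 'a set" where
  "time_slice Z t = {x. (x, t) \<in> Z}"

text \<open>The quantity \<open>\<Phi>\<^sub>K(p, b)\<close> depends only on the family \<open>K\<close>, so it does not matter which
  defining function and which chart are used to compute it; we ask for all of them.\<close>

definition weak_set_flow ::
  "('a::{t2_space,second_countable_topology}, 'n::finite) chart set \<Rightarrow>
   (('a, 'n) chart \<Rightarrow> real ^ 'n \<Rightarrow> real ^ 'n ^ 'n) \<Rightarrow> ('a \<times> real) set \<Rightarrow> bool" where
  "weak_set_flow A g Z \<longleftrightarrow>
     Z \<subseteq> UNIV \<times> {0..} \<and> closed Z \<and>
     (\<forall>a b K f p.
        0 \<le> a \<and> compact_barrier A g a b K f \<and>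
        (\<forall>t\<in>{a..<b}. K t \<inter> time_slice Z t = {}) \<and>
        p \<in> K b \<inter> time_slice Z b \<longrightarrow>
        p \<in> frontier (K b) \<and> (\<forall>c\<in>A. p \<in> fst c \<longrightarrow> barrier_Phi g c a b f p b \<ge> 0))"

text \<open>\<open>biggest_flow A g C Y\<close>: \<open>Y\<close> is the biggest flow generated by \<open>C\<close>, so that
  \<open>time_slice Y t\<close> is \<open>F\<^sub>t(C)\<close> for \<open>t \<ge> 0\<close>.\<close>

definition biggest_flow ::
  "('a::{t2_space,second_countable_topology}, 'n::finite) chart set \<Rightarrow>
   (('a, 'n) chart \<Rightarrow> real ^ 'n \<Rightarrow> real ^ 'n ^ 'n) \<Rightarrow> 'a set \<Rightarrow> ('a \<times> real) set \<Rightarrow> bool" where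
  "biggest_flow A g C Y \<longleftrightarrow>
     weak_set_flow A g Y \<and> time_slice Y 0 = C \<and>
     (\<forall>Z. weak_set_flow A g Z \<and> time_slice Z 0 \<subseteq> C \<longrightarrow>
        (\<forall>t\<ge>0. time_slice Z t \<subseteq> time_slice Y t))"

lemma biggest_flow_unique:
  assumes "biggest_flow A g C Y" "biggest_flow A g C Y'"
  shows "Y = Y'"
proof -
  have *: "P \<subseteq> Q" if P: "biggest_flow A g C P" and Q: "biggest_flow A g C Q" for P Q
  proof (rule subrelI)
    fix x t assume xt: "(x, t) \<in> P"
    have flow: "weak_set_flow A g P" and start: "time_slice P 0 \<subseteq> C"
      using P by (simp_all add: biggest_flow_def)
    have "P \<subseteq> UNIV \<times> {0..}"
      using flow unfolding weak_set_flow_def by (rule conjunct1)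
    from subsetD[OF this xt] have "t \<ge> 0"
      by simp
    moreover have "\<forall>Z. weak_set_flow A g Z \<and> time_slice Z 0 \<subseteq> C \<longrightarrow>
        (\<forall>t\<ge>0. time_slice Z t \<subseteq> time_slice Q t)"
      using Q by (simp add: biggest_flow_def)
    ultimately have "time_slice P t \<subseteq> time_slice Q t"
      using flow start by blast
    then show "(x, t) \<in> Q"
      using xt by (auto simp: time_slice_def)
  qed
  show ?thesis
    using *[OF assms] *[OF assms(2,1)] by (rule equalityI)
qed

definition spacetime_boundary :: "('a::topological_space \<times> real) set \<Rightarrow> ('a \<times> real) set" where
  "spacetime_boundary Z = Z - (top_of_set (UNIV \<times> {0..}) interior_of Z)"

end

theory Submission
  imports Defs "HOL-Real_Asymp.Real_Asymp"
begin

text \<open>Let \<open>K\<close> be a compact barrier that is disjoint from the boundary of \<open>\<C>\<close> before the final time \<open>b\<close>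
  and touches it at \<open>p\<close> at time \<open>b\<close>. Before time \<open>b\<close>, each point of \<open>K\<close> is either outside \<open>\<C>\<close> or in its
  interior, and \<open>K\<close> splits accordingly into two barriers. If \<open>p\<close> belongs to the outer one, the claim
  holds because \<open>\<C>\<close> is a weak set flow. If \<open>p\<close> belongs to the inner one and is an interior point of
  \<open>K b\<close> or satisfies \<open>\<Phi>\<^sub>K < 0\<close>, then a slightly enlarged \<open>K\<close>, continued a little beyond time \<open>b\<close>, is a
  subsolution whose union with \<open>\<C>\<close> is again a weak set flow. By maximality it is contained in \<open>\<C>\<close>,
  so that \<open>(p, b)\<close> is an interior point of \<open>\<C>\<close>, a contradiction. The identification of the initial
  set uses the same principle for shrinking coordinate balls.\<close>

section \<open>Calculus of smooth functions\<close>

text \<open>A subsolution that outlives time \<open>b\<close> must be controlled on its lateral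
  boundary after \<open>b\<close>, whereas the information on the inner part of \<open>K\<close>
  reaches only up to \<open>b\<close>. The way around is that a coordinate ball contained in
  \<open>\<C>\<close> at some time persists for a time that does not depend on this starting time.
  Hence points where the defining function is negative at time \<open>b\<close> are interior to
  \<open>\<C>\<close>, and by compactness the relevant part of the lateral boundary stays in
  \<open>\<C>\<close> a little longer. The strict inequality \<open>\<Phi>\<^sub>K < 0\<close> pays
  for the enlargement, since it survives a small \<open>C\<^sup>2\<close> perturbation. Adding such
  a region to \<open>\<C>\<close> is compatible with every barrier because touching level sets with
  opposite normals have ordered velocities and Hessians, and the matrix that contracts the Hessian
  in the mean curvature is positive semidefinite. A weak set flow is tested in every chart, but
  touching is analysed in one, so \<open>\<Phi>\<close> has to be shown invariant under coordinate
  changes; the second derivatives of the transition maps cancel there only through the volume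
  density.\<close>

lemma Ck_on_cong:
  assumes "open S" "\<And>x. x \<in> S \<Longrightarrow> f x = g x" "Ck_on k S f"
  shows "Ck_on k S g"
  using assms
proof (induction k arbitrary: f g)
  case 0
  then show ?case by (auto cong: continuous_on_cong)
next
  case (Suc k)
  have D: "g differentiable (at x)" "frechet_derivative f (at x) = frechet_derivative g (at x)"
    if "x \<in> S" for x
  proof -
    have "f differentiable (at x)"
      using Suc.prems(3) that by simp
    then have "(f has_derivative frechet_derivative f (at x)) (at x)"
      by (simp add: frechet_derivative_works)
    then have "(g has_derivative frechet_derivative f (at x)) (at x)"
      by (rule has_derivative_transform_within_open[OF _ Suc.prems(1) that]) (simp add: Suc.prems(2))
    then show "g differentiable (at x)" "frechet_derivative f (at x) = frechet_derivative g (at x)"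
      by (auto simp: differentiable_def frechet_derivative_at)
  qed
  show ?case
    unfolding Ck_on.simps
  proof (intro conjI allI ballI)
    show "g differentiable (at x)" if "x \<in> S" for x
      using D that by blast
    show "Ck_on k S (\<lambda>x. frechet_derivative g (at x) v)" for v
      by (rule Suc.IH[OF Suc.prems(1), where f = "\<lambda>x. frechet_derivative f (at x) v"])
        (use D Suc.prems in auto)
  qed
qed

lemma Ck_on_subset:
  "T \<subseteq> S \<Longrightarrow> Ck_on k S f \<Longrightarrow> Ck_on k T f"
  by (induction k arbitrary: f) (auto intro: continuous_on_subset)

lemma Ck_on_Suc_lower:
  "Ck_on (Suc k) S f \<Longrightarrow> Ck_on k S f"
proof (induction k arbitrary: f)
  case 0
  then show ?case
    by (auto intro!: continuous_at_imp_continuous_on differentiable_imp_continuous_within)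
next
  case (Suc k)
  then show ?case by (metis Ck_on.simps(2))
qed

lemma Ck_on_lower:
  "k \<le> m \<Longrightarrow> Ck_on m S f \<Longrightarrow> Ck_on k S f"
  by (induction m rule: dec_induct) (auto intro: Ck_on_Suc_lower simp del: Ck_on.simps)

lemma Ck_on_continuous_on: "Ck_on k S f \<Longrightarrow> continuous_on S f"
  using Ck_on_lower[of 0 k S f] by simp

text \<open>\<open>Ck_on\<close> is phrased with the choice operator
  \<open>frechet_derivative\<close>; this rule lets the closure properties below be proved from
  explicit derivative formulas.\<close>

lemma Ck_on_SucI:
  assumes "open S" "\<And>x. x \<in> S \<Longrightarrow> (f has_derivative f' x) (at x)"
    "\<And>v. Ck_on k S (\<lambda>x. f' x v)"
  shows "Ck_on (Suc k) S f"
  unfolding Ck_on.simps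
proof (intro conjI allI ballI)
  show "f differentiable (at x)" if "x \<in> S" for x
    using assms(2) that by (auto simp: differentiable_def)
  show "Ck_on k S (\<lambda>x. frechet_derivative f (at x) v)" for v
    by (rule Ck_on_cong[OF assms(1) _ assms(3)]) (use frechet_derivative_at[OF assms(2)] in simp)
qed

lemma Ck_on_has_derivative:
  assumes "Ck_on (Suc k) S f" "x \<in> S"
  shows "(f has_derivative frechet_derivative f (at x)) (at x)"
  using assms by (simp add: frechet_derivative_works[symmetric])

lemma Ck_on_const: "open S \<Longrightarrow> Ck_on k S (\<lambda>x. c)"
proof (induction k arbitrary: c)
  case (Suc k)
  then show ?case
    by (intro Ck_on_SucI[where f' = "\<lambda>x v. 0"]) auto
qed auto

lemma Ck_on_bounded_linear: 
  assumes "open S" "bounded_linear f"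
  shows "Ck_on k S f"
proof (cases k)
  case 0
  then show ?thesis using assms by (simp add: linear_continuous_on)
next
  case (Suc m)
  then show ?thesis
    using assms
    by (auto intro!: Ck_on_SucI[where f' = "\<lambda>x. f"] Ck_on_const bounded_linear_imp_has_derivative simp del: Ck_on.simps)
qed

lemma Ck_on_add:
  assumes "open S" "Ck_on k S f" "Ck_on k S g"
  shows "Ck_on k S (\<lambda>x. f x + g x)"
  using assms
proof (induction k arbitrary: f g)
  case (Suc k)
  show ?case
    by (rule Ck_on_SucI[where f' = "\<lambda>x v. frechet_derivative f (at x) v + frechet_derivative g (at x) v"])
      (use Suc Ck_on_has_derivative in \<open>auto intro!: has_derivative_add simp: Ck_on_has_derivative\<close>)
qed (auto intro: continuous_on_add)

lemma Ck_on_sum: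
  assumes "open S" "\<And>i. i \<in> I \<Longrightarrow> Ck_on k S (f i)"
  shows "Ck_on k S (\<lambda>x. \<Sum>i\<in>I. f i x)"
  using assms(2)
  by (induction I rule: infinite_finite_induct) (auto intro: Ck_on_add Ck_on_const assms(1))

text \<open>Leibniz rule; the undifferentiated factor drops from class \<open>Suc k\<close> to
  \<open>k\<close>, which is what the fact \<open>lower\<close> supplies.\<close>

lemma Ck_on_bilinear:
  fixes f :: "'b::euclidean_space \<Rightarrow> 'c::real_normed_vector"
  assumes "open S" "bounded_bilinear prd" "Ck_on k S f" "Ck_on k S g"
  shows "Ck_on k S (\<lambda>x. prd (f x) (g x))"
  using assms
proof (induction k arbitrary: f g)
  case 0
  then show ?case by (auto intro: bounded_bilinear.continuous_on)
next
  case (Suc k)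
  note lower = Suc.prems(3,4)[THEN Ck_on_Suc_lower]
  show ?case
    by (rule Ck_on_SucI[where f' = "\<lambda>x v. prd (f x) (frechet_derivative g (at x) v) + prd (frechet_derivative f (at x) v) (g x)"])
      (use Suc lower in \<open>auto intro!: bounded_bilinear.FDERIV Ck_on_add Ck_on_has_derivative simp del: Ck_on.simps simp: Ck_on.simps(2)\<close>)
qed

lemmas Ck_on_mult = Ck_on_bilinear[OF _ bounded_bilinear_mult]
lemmas Ck_on_scaleR = Ck_on_bilinear[OF _ bounded_bilinear_scaleR]

lemma Ck_on_prod:
  fixes f :: "'i \<Rightarrow> 'b::euclidean_space \<Rightarrow> real"
  assumes "open S" "\<And>i. i \<in> I \<Longrightarrow> Ck_on k S (f i)"
  shows "Ck_on k S (\<lambda>x. \<Prod>i\<in>I. f i x)"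
  using assms(2)
  by (induction I rule: infinite_finite_induct) (auto intro: Ck_on_mult Ck_on_const assms(1))

lemma Ck_on_linear_comp:
  assumes "open S" "bounded_linear l" "Ck_on k S f"
  shows "Ck_on k S (\<lambda>x. l (f x))"
  using assms(3)
proof (induction k arbitrary: f)
  case 0
  then show ?case using assms(2) by (auto intro: bounded_linear.continuous_on)
next
  case (Suc k)
  show ?case
    by (rule Ck_on_SucI[where f' = "\<lambda>x v. l (frechet_derivative f (at x) v)", OF assms(1)])
      (use Suc Ck_on_has_derivative[OF Suc.prems] in \<open>auto intro!: bounded_linear.has_derivative[OF assms(2)]\<close>)
qed

text \<open>\<open>Ck_on\<close> controls the derivative of \<open>f\<close> in fixed directions
  only, but the chain rule evaluates it in the varying direction \<open>?Dg x v\<close>. Expanding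
  this direction in the standard basis leaves fixed directions with varying coefficients, to which
  the induction hypothesis applies.\<close>

lemma Ck_on_compose:
  fixes f :: "'b::euclidean_space \<Rightarrow> 'c::real_normed_vector" and g :: "'d::euclidean_space \<Rightarrow> 'b"
  assumes "open S" "open T" "g ` S \<subseteq> T" "Ck_on k T f" "Ck_on k S g"
  shows "Ck_on k S (\<lambda>x. f (g x))"
  using assms(4,5)
proof (induction k arbitrary: f)
  case 0
  then show ?case
    using assms(3) by (auto intro: continuous_on_compose2)
next
  case (Suc k)
  let ?Df = "\<lambda>x v. frechet_derivative f (at x) v"
  let ?Dg = "\<lambda>x v. frechet_derivative g (at x) v"
  have exp: "?Df y v = (\<Sum>i\<in>Basis. (v \<bullet> i) *\<^sub>R ?Df y i)" if "y \<in> T" for y v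
  proof -
    have lin: "linear (?Df y)"
      using Ck_on_has_derivative[OF Suc.prems(1) that] has_derivative_linear by blast
    have "?Df y v = ?Df y (\<Sum>i\<in>Basis. (v \<bullet> i) *\<^sub>R i)"
      by (simp add: euclidean_representation)
    also have "\<dots> = (\<Sum>i\<in>Basis. (v \<bullet> i) *\<^sub>R ?Df y i)"
      by (simp add: linear_sum[OF lin] linear_cmul[OF lin])
    finally show ?thesis .
  qed
  show ?case
  proof (rule Ck_on_SucI[where f' = "\<lambda>x v. (\<Sum>i\<in>Basis. (?Dg x v \<bullet> i) *\<^sub>R ?Df (g x) i)", OF assms(1)])
    fix x assume x: "x \<in> S"
    then have "g x \<in> T" using assms(3) by auto
    have "((\<lambda>x. f (g x)) has_derivative (\<lambda>v. ?Df (g x) (?Dg x v))) (at x)"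
      using has_derivative_compose[OF Ck_on_has_derivative[OF Suc.prems(2) x]
          Ck_on_has_derivative[OF Suc.prems(1) \<open>g x \<in> T\<close>]] .
    then show "((\<lambda>x. f (g x)) has_derivative (\<lambda>v. \<Sum>i\<in>Basis. (?Dg x v \<bullet> i) *\<^sub>R ?Df (g x) i)) (at x)"
      unfolding exp[OF \<open>g x \<in> T\<close>, of "?Dg x _"] .
  next
    fix v
    have "Ck_on k S (\<lambda>x. ?Dg x v)" "\<And>i. Ck_on k T (\<lambda>y. ?Df y i)"
      using Suc.prems by simp_all
    moreover from this have "Ck_on k S (\<lambda>x. ?Df (g x) i)" for i
      using Suc.IH[of "\<lambda>y. ?Df y i"] Ck_on_Suc_lower[OF Suc.prems(2)] by blast
    ultimately show "Ck_on k S (\<lambda>x. \<Sum>i\<in>Basis. (?Dg x v \<bullet> i) *\<^sub>R ?Df (g x) i)"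
      by (intro Ck_on_sum Ck_on_scaleR assms(1)
          Ck_on_linear_comp[OF assms(1), where l = "\<lambda>w. w \<bullet> _"] bounded_linear_inner_left)
  qed
qed

text \<open>The derivative is a polynomial in \<open>inverse\<close> itself, so the induction
  hypothesis covers it.\<close>

lemma Ck_on_inverse: "Ck_on k (- {0}) (inverse :: real \<Rightarrow> real)"
proof (induction k)
  case 0
  then show ?case by (auto intro!: continuous_intros)
next
  case (Suc k)
  show ?case
  proof (rule Ck_on_SucI[where f' = "\<lambda>x v. inverse x * inverse x * (- v)"])
    show "(inverse has_derivative (\<lambda>v. inverse x * inverse x * - v)) (at x)" if "x \<in> - {0}" for x :: real
      using that by (auto intro!: derivative_eq_intros)
    show "Ck_on k (- {0}) (\<lambda>x. inverse x * inverse x * - v)" for v :: real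
      by (intro Ck_on_mult Ck_on_const Suc) (auto simp: open_Compl)
  qed (auto simp: open_Compl)
qed

section \<open>Symmetry of second derivatives\<close>

lemma second_difference:
  fixes u :: "'b::euclidean_space \<Rightarrow> real"
  assumes "ball x d \<subseteq> S" "Ck_on 2 S u" "s > 0" "s * (norm v + norm w) < d"
  shows "\<exists>r\<in>ball x d. u (x + s *\<^sub>R v + s *\<^sub>R w) - u (x + s *\<^sub>R v) - u (x + s *\<^sub>R w) + u x
    = s\<^sup>2 * frechet_derivative (\<lambda>y. frechet_derivative u (at y) v) (at r) w"
proof -
  have C2: "Ck_on (Suc (Suc 0)) S u"
    using assms(2) by (simp only: numeral_2_eq_2)
  have near: "x + a *\<^sub>R v + b *\<^sub>R w \<in> ball x d" if "0 \<le> a" "a \<le> s" "0 \<le> b" "b \<le> s" for a b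
  proof -
    have "norm (a *\<^sub>R v + b *\<^sub>R w) \<le> a * norm v + b * norm w"
      using that by (intro norm_triangle_le) auto
    also have "\<dots> \<le> s * norm v + s * norm w"
      using that by (intro add_mono mult_right_mono) auto
    also have "\<dots> < d"
      using assms(4) by (simp add: algebra_simps)
    finally have "norm ((x + a *\<^sub>R v + b *\<^sub>R w) - x) < d"
      by (simp add: algebra_simps)
    then show ?thesis
      by (metis mem_ball dist_commute dist_norm)
  qed
  have Du: "(u has_derivative frechet_derivative u (at y)) (at y)" if "y \<in> ball x d" for y
    using Ck_on_has_derivative[OF C2] that assms(1) by blast
  have DDu: "((\<lambda>y. frechet_derivative u (at y) v) has_derivative
      frechet_derivative (\<lambda>y. frechet_derivative u (at y) v) (at y)) (at y)" if "y \<in> ball x d" for y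
    by (rule Ck_on_has_derivative[of 0 S]) (use C2 that assms(1) in auto)
  \<comment> \<open>The second difference is \<open>\<phi> s - \<phi> 0\<close>; the mean value
    theorem in the direction \<open>v\<close>, followed by one in the direction \<open>w\<close>,
    turns it into a mixed derivative at an intermediate point.\<close>
  define \<phi> where "\<phi> r = u (x + r *\<^sub>R v + s *\<^sub>R w) - u (x + r *\<^sub>R v)" for r
  have d1: "(\<phi> has_real_derivative (frechet_derivative u (at (x + r *\<^sub>R v + s *\<^sub>R w)) v - frechet_derivative u (at (x + r *\<^sub>R v)) v)) (at r)"
    if "0 \<le> r" "r \<le> s" for r
  proof -
    have p1: "x + r *\<^sub>R v + s *\<^sub>R w \<in> ball x d" and p2: "x + r *\<^sub>R v \<in> ball x d"
      using near[of r s] near[of r 0] that assms(3) by auto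
    have "((\<lambda>r. x + r *\<^sub>R v + s *\<^sub>R w) has_derivative (\<lambda>h. h *\<^sub>R v)) (at r)"
      "((\<lambda>r. x + r *\<^sub>R v) has_derivative (\<lambda>h. h *\<^sub>R v)) (at r)"
      by (auto intro!: derivative_eq_intros)
    from has_derivative_diff[OF has_derivative_compose[OF this(1) Du[OF p1]] has_derivative_compose[OF this(2) Du[OF p2]]]
    have "(\<phi> has_derivative (\<lambda>h. frechet_derivative u (at (x + r *\<^sub>R v + s *\<^sub>R w)) (h *\<^sub>R v) - frechet_derivative u (at (x + r *\<^sub>R v)) (h *\<^sub>R v))) (at r)"
      by (simp add: \<phi>_def[abs_def])
    moreover have "linear (frechet_derivative u (at (x + r *\<^sub>R v + s *\<^sub>R w)))" "linear (frechet_derivative u (at (x + r *\<^sub>R v)))"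
      using Du p1 p2 has_derivative_linear by blast+
    ultimately show ?thesis
      unfolding has_field_derivative_def
      by (elim has_derivative_eq_rhs) (auto simp: linear_cmul algebra_simps fun_eq_iff)
  qed
  from MVT2[of 0 s \<phi> "\<lambda>r. frechet_derivative u (at (x + r *\<^sub>R v + s *\<^sub>R w)) v - frechet_derivative u (at (x + r *\<^sub>R v)) v"]
  obtain a where a: "0 < a" "a < s" and A: "\<phi> s - \<phi> 0 = s * (frechet_derivative u (at (x + a *\<^sub>R v + s *\<^sub>R w)) v - frechet_derivative u (at (x + a *\<^sub>R v)) v)"
    using d1 assms(3) by auto
  define \<psi> where "\<psi> r = frechet_derivative u (at (x + a *\<^sub>R v + r *\<^sub>R w)) v" for r
  have d2: "(\<psi> has_real_derivative frechet_derivative (\<lambda>y. frechet_derivative u (at y) v) (at (x + a *\<^sub>R v + r *\<^sub>R w)) w) (at r)"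
    if "0 \<le> r" "r \<le> s" for r
  proof -
    have p1: "x + a *\<^sub>R v + r *\<^sub>R w \<in> ball x d"
      using near[of a r] that a by auto
    have "((\<lambda>r. x + a *\<^sub>R v + r *\<^sub>R w) has_derivative (\<lambda>h. h *\<^sub>R w)) (at r)"
      by (auto intro!: derivative_eq_intros)
    from has_derivative_compose[OF this DDu[OF p1]]
    have "(\<psi> has_derivative (\<lambda>h. frechet_derivative (\<lambda>y. frechet_derivative u (at y) v) (at (x + a *\<^sub>R v + r *\<^sub>R w)) (h *\<^sub>R w))) (at r)"
      by (simp add: \<psi>_def[abs_def])
    moreover have "linear (frechet_derivative (\<lambda>y. frechet_derivative u (at y) v) (at (x + a *\<^sub>R v + r *\<^sub>R w)))"
      using DDu p1 has_derivative_linear by blast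
    ultimately show ?thesis
      by (simp add: linear_cmul has_field_derivative_def mult_commute_abs)
  qed
  from MVT2[of 0 s \<psi> "\<lambda>r. frechet_derivative (\<lambda>y. frechet_derivative u (at y) v) (at (x + a *\<^sub>R v + r *\<^sub>R w)) w"]
  obtain b where b: "0 < b" "b < s" and B: "\<psi> s - \<psi> 0 = s * frechet_derivative (\<lambda>y. frechet_derivative u (at y) v) (at (x + a *\<^sub>R v + b *\<^sub>R w)) w"
    using d2 assms(3) by auto
  show ?thesis
    by (rule bexI[of _ "x + a *\<^sub>R v + b *\<^sub>R w"])
      (use A B near[of a b] a b in \<open>auto simp: \<phi>_def \<psi>_def power2_eq_square algebra_simps\<close>)
qed

text \<open>The second difference is symmetric in \<open>v\<close> and \<open>w\<close>, so the two
  mixed derivatives share a value, at possibly different points arbitrarily near \<open>x\<close>;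
  continuity transfers the equality to \<open>x\<close>.\<close>

lemma symmetric_second_derivative:
  fixes u :: "'b::euclidean_space \<Rightarrow> real"
  assumes "open S" "Ck_on 2 S u" "x \<in> S"
  shows "frechet_derivative (\<lambda>y. frechet_derivative u (at y) v) (at x) w
       = frechet_derivative (\<lambda>y. frechet_derivative u (at y) w) (at x) v"
proof (rule ccontr)
  define D where "D v w y = frechet_derivative (\<lambda>y. frechet_derivative u (at y) v) (at y) w" for v w y
  assume "\<not> ?thesis"
  then have ne: "\<bar>D v w x - D w v x\<bar> > 0"
    by (simp add: D_def)
  have "continuous_on S (D a b)" for a b
    using assms(2) by (simp add: numeral_2_eq_2 D_def[abs_def])
  then have cont: "isCont (D a b) x" for a b
    using assms(1,3) by (simp add: continuous_on_eq_continuous_at)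
  \<comment> \<open>With half the gap as tolerance, values within \<open>e\<close> of
    \<open>D v w x\<close> and of \<open>D w v x\<close> cannot coincide.\<close>
  define e where "e = \<bar>D v w x - D w v x\<bar> / 2"
  have "e > 0" using ne by (simp add: e_def)
  obtain d1 where d1: "d1 > 0" "\<And>y. dist y x < d1 \<Longrightarrow> dist (D v w y) (D v w x) < e"
    using cont[of v w] \<open>e > 0\<close> unfolding continuous_at_eps_delta dist_norm[symmetric] by blast
  obtain d2 where d2: "d2 > 0" "\<And>y. dist y x < d2 \<Longrightarrow> dist (D w v y) (D w v x) < e"
    using cont[of w v] \<open>e > 0\<close> unfolding continuous_at_eps_delta dist_norm[symmetric] by blast
  obtain d3 where d3: "d3 > 0" "ball x d3 \<subseteq> S"
    using assms(1,3) openE by blast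
  define d where "d = Min {d1, d2, d3}"
  have d: "d > 0" "d \<le> d1" "d \<le> d2" "ball x d \<subseteq> S"
    using d1 d2 d3 by (auto simp: d_def)
  define s where "s = d / (norm v + norm w + 1)"
  have pos: "norm v + norm w + 1 > 0"
    by (smt (verit) norm_ge_zero)
  have s: "s > 0" "s * (norm v + norm w) < d"
    using d pos by (auto simp: s_def field_simps)
  from second_difference[OF d(4) assms(2) s] obtain r1 where r1: "r1 \<in> ball x d"
    "u (x + s *\<^sub>R v + s *\<^sub>R w) - u (x + s *\<^sub>R v) - u (x + s *\<^sub>R w) + u x = s\<^sup>2 * D v w r1"
    unfolding D_def by blast
  from second_difference[OF d(4) assms(2) s(1), of w v] s(2) obtain r2 where r2: "r2 \<in> ball x d"
    "u (x + s *\<^sub>R w + s *\<^sub>R v) - u (x + s *\<^sub>R w) - u (x + s *\<^sub>R v) + u x = s\<^sup>2 * D w v r2"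
    unfolding D_def by (auto simp: add.commute)
  have "s\<^sup>2 * D v w r1 = s\<^sup>2 * D w v r2"
    using r1(2) r2(2) by (simp add: algebra_simps)
  then have "D v w r1 = D w v r2"
    using s by simp
  moreover have "\<bar>D v w r1 - D v w x\<bar> < e" "\<bar>D w v r2 - D w v x\<bar> < e"
    using d1(2)[of r1] d2(2)[of r2] r1(1) r2(1) d by (auto simp: dist_commute dist_real_def)
  ultimately show False
    by (simp add: e_def abs_if split: if_splits)
qed

text \<open>The classical flat function \<open>exp (- 1 / x)\<close> with powers of
  \<open>1 / x\<close> in front: the powers make the family closed under differentiation up to
  linear combinations, so one induction shows all members to be smooth.\<close>

definition flat_exp :: "nat \<Rightarrow> real \<Rightarrow> real" where
  "flat_exp n x = (if x > 0 then inverse x ^ n * exp (- inverse x) else 0)"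

lemma has_real_derivative_flat_exp:
  "(flat_exp n has_real_derivative flat_exp (n + 2) x - n * flat_exp (n + 1) x) (at x)"
proof -
  consider "x > 0" | "x < 0" | "x = 0" by linarith
  then show ?thesis
  proof cases
    case 1
    have "((\<lambda>x. inverse x ^ n) has_real_derivative - (n * inverse x ^ (n + 1))) (at x)"
      using DERIV_power[OF DERIV_inverse[of x UNIV], of n] 1
      by (cases n) (auto simp: algebra_simps)
    moreover have "((\<lambda>x. exp (- inverse x)) has_real_derivative exp (- inverse x) * (inverse x)\<^sup>2) (at x)"
      using 1 by (auto intro!: derivative_eq_intros simp: power2_eq_square)
    ultimately have "((\<lambda>x. inverse x ^ n * exp (- inverse x)) has_real_derivative
        flat_exp (n + 2) x - n * flat_exp (n + 1) x) (at x)"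
      by (rule DERIV_cong[OF DERIV_mult]) (use 1 in \<open>simp add: flat_exp_def algebra_simps power2_eq_square\<close>)
    then show ?thesis
      by (rule has_field_derivative_transform_within_open[where S = "{0<..}"])
        (use 1 in \<open>auto simp: flat_exp_def\<close>)
  next
    case 2
    have "((\<lambda>x. 0) has_real_derivative 0) (at x)" by simp
    then have "(flat_exp n has_real_derivative 0) (at x)"
      by (rule has_field_derivative_transform_within_open[where S = "{..<0}"])
        (use 2 in \<open>auto simp: flat_exp_def\<close>)
    then show ?thesis using 2 by (simp add: flat_exp_def)
  next
    case 3
    \<comment> \<open>The difference quotient at \<open>0\<close> from the right; from the left it
      vanishes identically.\<close>
    have "((\<lambda>h. inverse h ^ (n + 1) * exp (- inverse h)) \<longlongrightarrow> (0::real)) (at_right 0)"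
      by real_asymp
    then have "((\<lambda>h. (flat_exp n h - 0) / h) \<longlongrightarrow> 0) (at_right 0)"
      by (rule Lim_transform_eventually)
        (auto simp: eventually_at_filter flat_exp_def divide_inverse algebra_simps)
    moreover have "((\<lambda>h. (flat_exp n h - 0) / h) \<longlongrightarrow> 0) (at_left 0)"
      by (rule Lim_transform_eventually[where f = "\<lambda>h. 0"])
        (auto simp: eventually_at_filter flat_exp_def)
    ultimately have "((\<lambda>h. (flat_exp n h - 0) / h) \<longlongrightarrow> 0) (at 0)"
      by (simp add: filterlim_split_at)
    then show ?thesis
      using 3 by (simp add: has_field_derivative_iff flat_exp_def)
  qed
qed

lemma Ck_on_flat_exp: "Ck_on k UNIV (flat_exp n)"
proof (induction k arbitrary: n)
  case 0
  then show ?case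
    by (auto intro!: continuous_at_imp_continuous_on DERIV_isCont[OF has_real_derivative_flat_exp])
next
  case (Suc k)
  show ?case
  proof (rule Ck_on_SucI)
    show "(flat_exp n has_derivative (*) (flat_exp (n + 2) x + (- n) * flat_exp (n + 1) x)) (at x)" for x
      using has_real_derivative_flat_exp[of n x] by (simp add: has_field_derivative_def)
    show "Ck_on k UNIV (\<lambda>x. (flat_exp (n + 2) x + (- n) * flat_exp (n + 1) x) * v)" for v
      by (intro Ck_on_mult Ck_on_add Ck_on_const Suc) auto
  qed auto
qed

text \<open>For positive \<open>s\<close>, \<open>\<theta> s\<close> is the convex combination
  \<open>s * (1 - q) + q\<close> of two positive numbers, where the smooth step
  \<open>q = a / b\<close> is \<open>0\<close> up to \<open>d / 2\<close> and \<open>1\<close> from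
  \<open>d\<close> on.\<close>

lemma smooth_cutoff:
  fixes d :: real
  assumes "d > 0"
  obtains \<theta> where "\<And>k. Ck_on k UNIV \<theta>" "\<And>s. s \<le> d / 2 \<Longrightarrow> \<theta> s = s"
    "\<And>s. s \<ge> d \<Longrightarrow> \<theta> s = 1" "\<And>s::real. s > 0 \<Longrightarrow> \<theta> s > 0"
proof -
  \<comment> \<open>\<open>l\<close> maps \<open>d / 2\<close> to \<open>0\<close> and
    \<open>d\<close> to \<open>1\<close>; since \<open>l\<close> and \<open>1 - l\<close> are never
    both nonpositive, \<open>b\<close> is positive everywhere. Subtractions are written with a
    factor \<open>- 1\<close> to match the closure rules.\<close>
  define l where "l s = 2 / d * s + (- 1)" for s :: real
  define a where "a s = flat_exp 0 (l s)" for s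
  define b where "b s = a s + flat_exp 0 (1 + - 1 * l s)" for s
  define \<theta> where "\<theta> s = s + (1 + (- 1) * s) * (a s * inverse (b s))" for s
  have nonneg: "a s \<ge> 0" "a s \<le> b s" for s
    by (auto simp: a_def b_def flat_exp_def)
  have pos: "b s > 0" for s
    by (auto simp: a_def b_def flat_exp_def add_pos_nonneg)
  have l: "Ck_on k UNIV l" for k
    unfolding l_def[abs_def]
    by (intro Ck_on_mult Ck_on_add Ck_on_const Ck_on_bounded_linear[of UNIV "\<lambda>x. x"]) auto
  then have a: "Ck_on k UNIV a" for k
    unfolding a_def[abs_def] by (intro Ck_on_compose[OF _ _ _ Ck_on_flat_exp]) auto
  have b: "Ck_on k UNIV b" for k
    unfolding b_def[abs_def]
    by (intro Ck_on_mult Ck_on_add Ck_on_const Ck_on_compose[OF _ _ _ Ck_on_flat_exp] a l) auto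
  have inv: "Ck_on k UNIV (\<lambda>s. inverse (b s))" for k
    by (rule Ck_on_compose[OF _ _ _ Ck_on_inverse b]) (use pos in \<open>auto simp: open_Compl less_imp_neq[symmetric]\<close>)
  show ?thesis
  proof (rule that[of \<theta>])
    show "Ck_on k UNIV \<theta>" for k
      unfolding \<theta>_def[abs_def]
      by (intro Ck_on_mult Ck_on_add Ck_on_const Ck_on_bounded_linear[of UNIV "\<lambda>x. x"] a inv) auto
    show "\<theta> s = s" if "s \<le> d / 2" for s
    proof -
      have "l s \<le> 0" using that assms by (simp add: l_def field_simps)
      then show ?thesis by (simp add: \<theta>_def a_def flat_exp_def)
    qed
    show "\<theta> s = 1" if "s \<ge> d" for s
    proof -
      have "l s \<ge> 1" using that assms by (simp add: l_def field_simps)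
      then have "b s = a s" by (simp add: b_def a_def flat_exp_def)
      then show ?thesis using pos[of s] by (simp add: \<theta>_def)
    qed
    show "\<theta> s > 0" if "s > 0" for s
    proof -
      define q where "q = a s * inverse (b s)"
      have q: "0 \<le> q" "q \<le> 1"
        using nonneg[of s] pos[of s] by (auto simp: q_def field_simps)
      have "\<theta> s = s * (1 - q) + q"
        by (simp add: \<theta>_def q_def algebra_simps)
      also have "\<dots> > 0"
        using q that by (cases "q = 0") (auto intro: add_nonneg_pos)
      finally show ?thesis .
    qed
  qed
qed


lemma Ck_on_local:
  assumes "open S" "\<And>x. x \<in> S \<Longrightarrow> \<exists>V. open V \<and> x \<in> V \<and> Ck_on k V f"
  shows "Ck_on k S f"
  using assms(2)
proof (induction k arbitrary: f)
  case 0
  then show ?case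
    using continuous_at_imp_continuous_on continuous_on_interior interior_open by (metis Ck_on.simps(1))
next
  case (Suc k)
  have "f differentiable (at x)" if "x \<in> S" for x
    using Suc.prems[OF that] by auto
  moreover have "Ck_on k S (\<lambda>x. frechet_derivative f (at x) v)" for v
    by (rule Suc.IH) (use Suc.prems in force)
  ultimately show ?case by simp
qed

text \<open>On an open set the local extensions coincide with the function itself, and
  \<open>Ck_on\<close> is a local property.\<close>

lemma smooth_on_open:
  assumes "open S"
  shows "smooth_on S f \<longleftrightarrow> (\<forall>k. Ck_on k S f)"
proof
  assume L: "smooth_on S f"
  show "\<forall>k. Ck_on k S f"
  proof
    fix k
    show "Ck_on k S f"
    proof (rule Ck_on_local[OF assms])
      fix x assume "x \<in> S"
      with L obtain V h where V: "open V" "x \<in> V" "\<forall>k. Ck_on k V h" "\<forall>q\<in>V \<inter> S. h q = f q"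
        unfolding smooth_on_def by meson
      have "Ck_on k (V \<inter> S) f"
        by (rule Ck_on_cong[of _ h]) (use V assms in \<open>auto intro: Ck_on_subset[of _ V]\<close>)
      then show "\<exists>V. open V \<and> x \<in> V \<and> Ck_on k V f"
        using V assms \<open>x \<in> S\<close> by blast
    qed
  qed
qed (use assms in \<open>auto simp: smooth_on_def\<close>)

section \<open>The divergence of the unit normal in coordinates\<close>

text \<open>The content of \<open>riemannian_metric\<close> for one chart, isolated on an open set
  so that the calculus below takes place in Euclidean space. Smoothness is stated for the entries,
  on which all computations are done.\<close>

definition metric_on :: "(real ^ 'n::finite) set \<Rightarrow> (real ^ 'n \<Rightarrow> real ^ 'n ^ 'n) \<Rightarrow> bool" where
  "metric_on U G \<longleftrightarrow> open U \<and> (\<forall>k i j. Ck_on k U (\<lambda>y. G y $ i $ j)) \<and>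
     (\<forall>y\<in>U. transpose (G y) = G y \<and> (\<forall>v. v \<noteq> 0 \<longrightarrow> v \<bullet> (G y *v v) > 0))"

lemma symmetric_matrix_inner:
  fixes M :: "real ^ 'n ^ 'n"
  assumes "transpose M = M"
  shows "(M *v v) \<bullet> w = v \<bullet> (M *v w)"
  by (metis assms dot_lmul_matrix vector_transpose_matrix)

lemma pos_def_invertible:
  fixes M :: "real ^ 'n ^ 'n"
  assumes "\<And>v. v \<noteq> 0 \<Longrightarrow> v \<bullet> (M *v v) > 0"
  shows "M ** matrix_inv M = mat 1" "matrix_inv M ** M = mat 1" "det M \<noteq> 0"
proof -
  have "invertible M"
    unfolding invertible_left_inverse matrix_left_invertible_ker using assms by force
  then show "M ** matrix_inv M = mat 1" "matrix_inv M ** M = mat 1" "det M \<noteq> 0"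
    using someI_ex[of "\<lambda>B. M ** B = mat 1 \<and> B ** M = mat 1"]
    by (auto simp: matrix_inv_def invertible_def invertible_det_nz[symmetric])
qed

lemma continuous_on_det:
  fixes M :: "'b::topological_space \<Rightarrow> real ^ 'n ^ 'n"
  assumes "\<And>i j. continuous_on S (\<lambda>x. M x $ i $ j)"
  shows "continuous_on S (\<lambda>x. det (M x))"
  unfolding det_def by (intro continuous_intros assms)

text \<open>The segment from the identity matrix to \<open>M\<close> consists of positive definite,
  hence invertible matrices, so the determinant cannot change sign along it.\<close>

lemma pos_def_det_pos:
  fixes M :: "real ^ 'n ^ 'n"
  assumes "\<And>v. v \<noteq> 0 \<Longrightarrow> v \<bullet> (M *v v) > 0"
  shows "det M > 0"
proof (rule ccontr)
  assume "\<not> det M > 0"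
  define N where "N t = (1 - t) *\<^sub>R mat 1 + t *\<^sub>R M" for t
  have c: "continuous_on {0..1} (\<lambda>t. det (N t))"
    by (rule continuous_on_det) (auto simp: N_def intro!: continuous_intros)
  have "det (N 1) \<le> 0" "0 \<le> det (N 0)"
    using \<open>\<not> det M > 0\<close> by (auto simp: N_def)
  then obtain t where t: "0 \<le> t" "t \<le> 1" "det (N t) = 0"
    using IVT2'[of "\<lambda>t. det (N t)" 1 0 0] c by auto
  have "v \<bullet> (N t *v v) > 0" if "v \<noteq> 0" for v
  proof -
    have "v \<bullet> (N t *v v) = (1 - t) * (v \<bullet> v) + t * (v \<bullet> (M *v v))"
      by (simp add: N_def matrix_vector_mult_add_rdistrib scaleR_matrix_vector_assoc[symmetric] inner_add_right)
    moreover have "v \<bullet> v > 0" "v \<bullet> (M *v v) > 0"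
      using assms that by auto
    ultimately show ?thesis
      using t(1,2) by (cases "t = 0") (auto intro: add_nonneg_pos)
  qed
  then show False
    using pos_def_invertible(3)[of "N t"] t(3) by blast
qed

lemma Ck_on_det:
  fixes M :: "'b::euclidean_space \<Rightarrow> real ^ 'n ^ 'n"
  assumes "open S" "\<And>i j. Ck_on k S (\<lambda>x. M x $ i $ j)"
  shows "Ck_on k S (\<lambda>x. det (M x))"
  unfolding det_def by (intro Ck_on_sum Ck_on_mult Ck_on_prod Ck_on_const assms)

context
  fixes U :: "(real ^ 'n::finite) set" and G :: "real ^ 'n \<Rightarrow> real ^ 'n ^ 'n"
  assumes metric: "metric_on U G"
begin

lemma metric_pos: "y \<in> U \<Longrightarrow> v \<noteq> 0 \<Longrightarrow> v \<bullet> (G y *v v) > 0"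
  and metric_sym: "y \<in> U \<Longrightarrow> transpose (G y) = G y"
  and metric_Ck: "Ck_on k U (\<lambda>y. G y $ i $ j)"
  and metric_open: "open U"
  using metric by (auto simp: metric_on_def)

lemma metric_det_pos: "y \<in> U \<Longrightarrow> det (G y) > 0"
  by (rule pos_def_det_pos) (use metric_pos in blast)

lemma metric_inv:
  assumes "y \<in> U"
  shows "G y ** matrix_inv (G y) = mat 1" "matrix_inv (G y) ** G y = mat 1"
  using pos_def_invertible[of "G y"] metric_pos[OF assms] by blast+

lemma metric_mult_inv: "y \<in> U \<Longrightarrow> G y *v (matrix_inv (G y) *v p) = p"
  by (simp add: matrix_vector_mul_assoc metric_inv)

lemma inv_metric_inner: 
  assumes "y \<in> U"
  shows "(matrix_inv (G y) *v p) \<bullet> q = p \<bullet> (matrix_inv (G y) *v q)"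
  using symmetric_matrix_inner[OF metric_sym[OF assms], of "matrix_inv (G y) *v p" "matrix_inv (G y) *v q"]
  by (simp add: metric_mult_inv[OF assms])

lemma inv_metric_pos:
  assumes "y \<in> U" "p \<noteq> 0"
  shows "p \<bullet> (matrix_inv (G y) *v p) > 0"
proof -
  define v where "v = matrix_inv (G y) *v p"
  have p: "G y *v v = p" by (simp add: v_def metric_mult_inv assms)
  with assms(2) have "v \<noteq> 0" by auto
  from metric_pos[OF assms(1) this] show ?thesis
    by (simp add: p v_def[symmetric] inner_commute)
qed

lemma inv_metric_sym: "y \<in> U \<Longrightarrow> matrix_inv (G y) $ i $ j = matrix_inv (G y) $ j $ i"
  using inv_metric_inner[of y "axis i 1" "axis j 1"]
  by (simp add: matrix_vector_mult_basis column_def inner_axis inner_axis')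

text \<open>Cramer's rule: the entry is the determinant of \<open>G y\<close> with column
  \<open>i\<close> replaced by the \<open>j\<close>-th unit vector, divided by
  \<open>det (G y)\<close>.\<close>

lemma Ck_on_inv_metric: "Ck_on k U (\<lambda>y. matrix_inv (G y) $ i $ j)"
proof -
  define A where "A y = (\<chi> a b. if b = i then axis j 1 $ a else G y $ a $ b)" for y
  have "Ck_on k U (\<lambda>y. A y $ a $ b)" for a b
    using metric_Ck Ck_on_const[OF metric_open] by (cases "b = i") (simp_all add: A_def)
  then have "Ck_on k U (\<lambda>y. det (A y))"
    by (intro Ck_on_det metric_open)
  moreover have "Ck_on k U (\<lambda>y. inverse (det (G y)))"
    by (rule Ck_on_compose[OF metric_open _ _ Ck_on_inverse Ck_on_det[OF metric_open metric_Ck]])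
      (use metric_det_pos in \<open>auto simp: open_Compl dest: less_imp_neq\<close>)
  ultimately have "Ck_on k U (\<lambda>y. det (A y) * inverse (det (G y)))"
    by (intro Ck_on_mult metric_open)
  then show ?thesis
  proof (rule Ck_on_cong[OF metric_open, rotated])
    fix y assume y: "y \<in> U"
    have "matrix_inv (G y) *v axis j 1 = (\<chi> k. det (\<chi> a b. if b = k then axis j 1 $ a else G y $ a $ b) / det (G y))"
      using cramer[of "G y" "matrix_inv (G y) *v axis j 1" "axis j 1"] metric_det_pos[OF y] metric_mult_inv[OF y]
      by auto
    then have "(matrix_inv (G y) *v axis j 1) $ i = det (A y) / det (G y)"
      by (simp add: A_def)
    then show "det (A y) * inverse (det (G y)) = matrix_inv (G y) $ i $ j"
      by (simp add: matrix_vector_mult_basis column_def divide_inverse)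
  qed
qed

end

section \<open>The divergence of the unit normal in terms of differential and Hessian\<close>

definition covec :: "(real ^ 'n::finite \<Rightarrow> real) \<Rightarrow> real ^ 'n \<Rightarrow> real ^ 'n" where
  "covec u y = (\<chi> i. partial_deriv u i y)"

text \<open>The coordinate Hessian, not the covariant one: the Christoffel terms end up in
  \<open>frozen_div\<close>.\<close>

definition hess :: "(real ^ 'n::finite \<Rightarrow> real) \<Rightarrow> real ^ 'n \<Rightarrow> real ^ 'n ^ 'n" where
  "hess u y = (\<chi> i j. partial_deriv (\<lambda>z. partial_deriv u j z) i y)"

text \<open>The squared length of a covector in the dual metric; for the differential of
  \<open>u\<close> it is the squared length of \<open>grad G u\<close>.\<close>

definition conorm_sq :: "(real ^ 'n::finite \<Rightarrow> real ^ 'n ^ 'n) \<Rightarrow> real ^ 'n \<Rightarrow> real ^ 'n \<Rightarrow> real" where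
  "conorm_sq G y p = p \<bullet> (matrix_inv (G y) *v p)"

text \<open>Here \<open>p\<close> stands for the differential of a function at \<open>y\<close>; \<open>normal_of_dy\<close> and \<open>normal_of_dp\<close>
  are the derivatives of \<open>normal_of\<close> in \<open>y\<close> and \<open>p\<close>, and \<open>frozen_div\<close> is the part of the divergence
  of the unit normal that does not involve second derivatives of the function.\<close>

definition normal_of :: "(real ^ 'n::finite \<Rightarrow> real ^ 'n ^ 'n) \<Rightarrow> real ^ 'n \<Rightarrow> real ^ 'n \<Rightarrow> real ^ 'n" where
  "normal_of G y p = (matrix_inv (G y) *v p) /\<^sub>R sqrt (conorm_sq G y p)"

definition normal_of_dy ::
  "(real ^ 'n::finite \<Rightarrow> real ^ 'n ^ 'n) \<Rightarrow> real ^ 'n \<Rightarrow> real ^ 'n \<Rightarrow> 'n \<Rightarrow> real ^ 'n \<Rightarrow> real" where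
  "normal_of_dy G y p i v =
    (\<Sum>j\<in>UNIV. frechet_derivative (\<lambda>z. matrix_inv (G z) $ i $ j) (at y) v * p $ j) / sqrt (conorm_sq G y p)
    - (matrix_inv (G y) *v p) $ i *
      (\<Sum>j\<in>UNIV. \<Sum>k\<in>UNIV. p $ j * (frechet_derivative (\<lambda>z. matrix_inv (G z) $ j $ k) (at y) v * p $ k))
      / (2 * conorm_sq G y p * sqrt (conorm_sq G y p))"

definition normal_of_dp :: "(real ^ 'n::finite \<Rightarrow> real ^ 'n ^ 'n) \<Rightarrow> real ^ 'n \<Rightarrow> real ^ 'n \<Rightarrow> real ^ 'n ^ 'n" where
  "normal_of_dp G y p = (\<chi> i j. matrix_inv (G y) $ i $ j / sqrt (conorm_sq G y p)
    - (matrix_inv (G y) *v p) $ i * (matrix_inv (G y) *v p) $ j / (conorm_sq G y p * sqrt (conorm_sq G y p)))"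

definition frozen_div :: "(real ^ 'n::finite \<Rightarrow> real ^ 'n ^ 'n) \<Rightarrow> real ^ 'n \<Rightarrow> real ^ 'n \<Rightarrow> real" where
  "frozen_div G y p = divergence G (\<lambda>z. normal_of G z p) y"

text \<open>The divergence of the unit normal as a function of three independent variables: point,
  differential and Hessian. It is affine in \<open>H\<close>, and separating the variables makes
  continuity and perturbation arguments finite-dimensional.\<close>

definition curv :: "(real ^ 'n::finite \<Rightarrow> real ^ 'n ^ 'n) \<Rightarrow> real ^ 'n \<Rightarrow> real ^ 'n \<Rightarrow> real ^ 'n ^ 'n \<Rightarrow> real" where
  "curv G y p H = frozen_div G y p + (\<Sum>i\<in>UNIV. \<Sum>j\<in>UNIV. normal_of_dp G y p $ i $ j * H $ i $ j)"

lemma partial_deriv_eq: "(u has_derivative u') (at y) \<Longrightarrow> partial_deriv u i y = u' (axis i 1)"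
  by (simp add: partial_deriv_def frechet_derivative_at[symmetric])

lemma has_derivative_vec_nth_fun:
  "(q has_derivative q') F \<Longrightarrow> ((\<lambda>z. q z $ j) has_derivative (\<lambda>v. q' v $ j)) F"
  by (rule bounded_linear.has_derivative[OF bounded_linear_vec_nth])

lemma has_derivative_vec_lambda:
  fixes f :: "'n::finite \<Rightarrow> 'b::real_normed_vector \<Rightarrow> real"
  assumes "\<And>j. (f j has_derivative f' j) F"
  shows "((\<lambda>z. \<chi> j. f j z) has_derivative (\<lambda>v. \<chi> j. f' j v)) F"
proof -
  have eq: "(\<chi> j. h j) = (\<Sum>j\<in>UNIV. h j *\<^sub>R axis j 1)" for h :: "'n \<Rightarrow> real"
    by (simp add: vec_eq_iff axis_def if_distrib cong: if_cong)
  show ?thesis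
    unfolding eq by (intro has_derivative_sum has_derivative_scaleR_left assms)
qed

lemma covec_has_derivative:
  assumes "open V" "y \<in> V" "Ck_on 2 V u"
  shows "(covec u has_derivative (\<lambda>v. \<chi> j. frechet_derivative (\<lambda>z. partial_deriv u j z) (at y) v)) (at y)"
proof -
  have "((\<lambda>z. partial_deriv u j z) has_derivative frechet_derivative (\<lambda>z. partial_deriv u j z) (at y)) (at y)" for j
    unfolding partial_deriv_def
    by (rule Ck_on_has_derivative[of 0 V]) (use assms in \<open>auto simp: numeral_2_eq_2\<close>)
  then have "((\<lambda>z. \<chi> j. partial_deriv u j z) has_derivative (\<lambda>v. \<chi> j. frechet_derivative (\<lambda>z. partial_deriv u j z) (at y) v)) (at y)"
    by (intro has_derivative_vec_lambda)
  then show ?thesis by (simp add: covec_def[abs_def])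
qed

lemmas continuous_on_field = continuous_on_sum continuous_on_mult continuous_on_add continuous_on_diff
  continuous_on_divide continuous_on_real_sqrt continuous_on_const

context
  fixes U :: "(real ^ 'n::finite) set" and G :: "real ^ 'n \<Rightarrow> real ^ 'n ^ 'n"
  assumes metric: "metric_on U G"
begin

lemma conorm_sq_pos: "y \<in> U \<Longrightarrow> p \<noteq> 0 \<Longrightarrow> conorm_sq G y p > 0"
  by (simp add: conorm_sq_def inv_metric_pos[OF metric])

lemma metric_norm_grad: "y \<in> U \<Longrightarrow> metric_norm G y (grad G u y) = sqrt (conorm_sq G y (covec u y))"
  by (simp add: metric_norm_def grad_def conorm_sq_def metric_mult_inv[OF metric] covec_def[symmetric] inner_commute)

lemma grad_eq_0_iff: "y \<in> U \<Longrightarrow> grad G u y = 0 \<longleftrightarrow> covec u y = 0"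
  by (metis covec_def grad_def metric metric_mult_inv matrix_vector_mult_0_right)

lemma unit_normal_eq: "y \<in> U \<Longrightarrow> unit_normal G u y = normal_of G y (covec u y)"
  unfolding unit_normal_def normal_of_def metric_norm_grad by (simp add: grad_def covec_def)

lemma inv_metric_has_derivative:
  "y \<in> U \<Longrightarrow> ((\<lambda>z. matrix_inv (G z) $ i $ j) has_derivative
    frechet_derivative (\<lambda>z. matrix_inv (G z) $ i $ j) (at y)) (at y)"
  by (rule Ck_on_has_derivative[OF Ck_on_inv_metric[OF metric]])

text \<open>Product rule for \<open>N / sqrt Q\<close>, where \<open>N\<close> is the vector dual to
  the covector field \<open>q\<close> and \<open>Q\<close> its squared length. Terms that
  differentiate the metric form \<open>normal_of_dy\<close>, terms that differentiate
  \<open>q\<close> form \<open>normal_of_dp\<close>.\<close>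

lemma normal_of_has_derivative:
  assumes y: "y \<in> U" and q: "(q has_derivative q') (at y)" and nz: "q y \<noteq> 0"
  shows "((\<lambda>z. normal_of G z (q z) $ i) has_derivative
    (\<lambda>v. normal_of_dy G y (q y) i v + (normal_of_dp G y (q y) *v q' v) $ i)) (at y)"
proof -
  define g where "g z i j = matrix_inv (G z) $ i $ j" for z i j
  define dg where "dg i j = frechet_derivative (\<lambda>z. g z i j) (at y)" for i j
  define N where "N z i = (\<Sum>j\<in>UNIV. g z i j * q z $ j)" for z i
  define Q where "Q z = (\<Sum>j\<in>UNIV. q z $ j * N z j)" for z
  have N: "(matrix_inv (G z) *v q z) $ i = N z i" for z i
    by (simp add: matrix_vector_mult_def N_def g_def)
  have Q: "conorm_sq G z (q z) = Q z" for z
    by (simp add: conorm_sq_def Q_def inner_vec_def N)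
  have Qpos: "Q y > 0"
    using conorm_sq_pos[OF y nz] Q by simp
  have sym: "g y i j = g y j i" for i j
    unfolding g_def by (rule inv_metric_sym[OF metric y])
  note q'' = has_derivative_vec_nth_fun[OF q]
  have dg: "((\<lambda>z. g z i j) has_derivative dg i j) (at y)" for i j
    unfolding g_def dg_def by (rule inv_metric_has_derivative[OF y])
  have dN: "((\<lambda>z. N z i) has_derivative (\<lambda>v. \<Sum>j\<in>UNIV. g y i j * q' v $ j + dg i j v * q y $ j)) (at y)" for i
    unfolding N_def by (intro has_derivative_sum has_derivative_mult dg q'')
  have "(Q has_derivative (\<lambda>v. \<Sum>j\<in>UNIV. q y $ j * (\<Sum>k\<in>UNIV. g y j k * q' v $ k + dg j k v * q y $ k) + q' v $ j * N y j)) (at y)"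
    unfolding Q_def by (intro has_derivative_sum has_derivative_mult dN q'')
  moreover have "(\<Sum>j\<in>UNIV. q y $ j * (\<Sum>k\<in>UNIV. g y j k * q' v $ k + dg j k v * q y $ k) + q' v $ j * N y j)
      = (\<Sum>j\<in>UNIV. \<Sum>k\<in>UNIV. q y $ j * (dg j k v * q y $ k)) + 2 * (\<Sum>j\<in>UNIV. N y j * q' v $ j)" for v
  proof -
    \<comment> \<open>By symmetry of the inverse metric both terms with \<open>q'\<close> agree,
      whence the factor 2.\<close>
    have "(\<Sum>j\<in>UNIV. \<Sum>k\<in>UNIV. q y $ j * (g y j k * q' v $ k)) = (\<Sum>k\<in>UNIV. \<Sum>j\<in>UNIV. q y $ j * (g y j k * q' v $ k))"
      by (rule sum.swap)
    also have "\<dots> = (\<Sum>k\<in>UNIV. N y k * q' v $ k)"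
      by (simp add: N_def sum_distrib_right sum_distrib_left sym mult_ac)
    finally show ?thesis
      by (simp add: sum.distrib sum_distrib_left distrib_left mult.commute)
  qed
  ultimately have dQ: "(Q has_derivative (\<lambda>v. (\<Sum>j\<in>UNIV. \<Sum>k\<in>UNIV. q y $ j * (dg j k v * q y $ k))
      + 2 * (\<Sum>j\<in>UNIV. N y j * q' v $ j))) (at y)"
    by simp
  have "((\<lambda>r. inverse (sqrt r)) has_derivative (\<lambda>h. - h / (2 * Q y * sqrt (Q y)))) (at (Q y))"
    using Qpos by (auto intro!: derivative_eq_intros simp: field_simps)
  from has_derivative_mult[OF dN has_derivative_compose[OF dQ this]]
  have "((\<lambda>z. N z i * inverse (sqrt (Q z))) has_derivative
    (\<lambda>v. N y i * (- ((\<Sum>j\<in>UNIV. \<Sum>k\<in>UNIV. q y $ j * (dg j k v * q y $ k)) + 2 * (\<Sum>j\<in>UNIV. N y j * q' v $ j)) / (2 * Q y * sqrt (Q y)))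
      + (\<Sum>j\<in>UNIV. g y i j * q' v $ j + dg i j v * q y $ j) * inverse (sqrt (Q y)))) (at y)" .
  moreover have "normal_of G z (q z) $ i = N z i * inverse (sqrt (Q z))" for z
    by (simp add: normal_of_def Q N)
  moreover have "normal_of_dy G y (q y) i v + (normal_of_dp G y (q y) *v q' v) $ i =
     N y i * (- ((\<Sum>j\<in>UNIV. \<Sum>k\<in>UNIV. q y $ j * (dg j k v * q y $ k)) + 2 * (\<Sum>j\<in>UNIV. N y j * q' v $ j)) / (2 * Q y * sqrt (Q y)))
      + (\<Sum>j\<in>UNIV. g y i j * q' v $ j + dg i j v * q y $ j) * inverse (sqrt (Q y))" for v
  proof -
    have "(normal_of_dp G y (q y) *v q' v) $ i
      = (\<Sum>j\<in>UNIV. g y i j * q' v $ j) / sqrt (Q y) - N y i * (\<Sum>j\<in>UNIV. N y j * q' v $ j) / (Q y * sqrt (Q y))"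
      unfolding matrix_vector_mult_def[of "normal_of_dp G y (q y)"]
      by (simp add: normal_of_dp_def Q N g_def[symmetric] left_diff_distrib sum_subtractf
          sum_divide_distrib sum_distrib_left mult.assoc)
    moreover have "normal_of_dy G y (q y) i v = (\<Sum>j\<in>UNIV. dg i j v * q y $ j) / sqrt (Q y)
        - N y i * (\<Sum>j\<in>UNIV. \<Sum>k\<in>UNIV. q y $ j * (dg j k v * q y $ k)) / (2 * Q y * sqrt (Q y))"
      by (simp add: normal_of_dy_def Q N g_def[symmetric] dg_def)
    moreover have "(\<Sum>j\<in>UNIV. g y i j * q' v $ j + dg i j v * q y $ j) = (\<Sum>j\<in>UNIV. g y i j * q' v $ j) + (\<Sum>j\<in>UNIV. dg i j v * q y $ j)"
      by (rule sum.distrib)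
    moreover have "A / s - n * B / (2 * r * s) + (C / s - n * D / (r * s)) = n * (- (B + 2 * D) / (2 * r * s)) + (C + A) * inverse s"
      if "r > 0" "s > 0" for A B C D n r s :: real
      using that by (simp add: field_simps)
    ultimately show ?thesis
      using Qpos by simp
  qed
  ultimately show ?thesis by simp
qed

text \<open>The density \<open>sqrt (det G)\<close> contributes only its logarithmic derivative,
  which is half that of \<open>det G\<close>; this removes the square root from later
  computations.\<close>

lemma divergence_expand:
  assumes y: "y \<in> U" and X: "\<And>i. (\<lambda>z. X z $ i) differentiable (at y)"
  shows "divergence G X y = (\<Sum>i\<in>UNIV. partial_deriv (\<lambda>z. X z $ i) i y)
    + (\<Sum>i\<in>UNIV. partial_deriv (\<lambda>z. det (G z)) i y * X y $ i) / (2 * det (G y))"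
proof -
  define D where "D = frechet_derivative (\<lambda>z. det (G z)) (at y)"
  have pos: "det (G y) > 0" by (rule metric_det_pos[OF metric y])
  have D: "((\<lambda>z. det (G z)) has_derivative D) (at y)"
    unfolding D_def by (rule Ck_on_has_derivative[OF Ck_on_det[OF metric_open[OF metric] metric_Ck[OF metric]] y])
  have sq: "(sqrt has_derivative (\<lambda>h. h / (2 * sqrt (det (G y))))) (at (det (G y)))"
    using pos by (auto intro!: derivative_eq_intros simp: field_simps)
  have "partial_deriv (\<lambda>z. sqrt (det (G z)) * X z $ i) i y
    = sqrt (det (G y)) * partial_deriv (\<lambda>z. X z $ i) i y + D (axis i 1) / (2 * sqrt (det (G y))) * X y $ i" for i
    using has_derivative_mult[OF has_derivative_compose[OF D sq] X[of i, unfolded frechet_derivative_works]]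
    by (subst partial_deriv_eq, assumption) (simp add: partial_deriv_def)
  moreover have "(sqrt d * a + b / (2 * sqrt d) * c) / sqrt d = a + b * c / (2 * d)" if "d > 0" for a b c d :: real
  proof -
    have "(sqrt d * a + b / (2 * sqrt d) * c) / sqrt d = a + b * c / (2 * (sqrt d * sqrt d))"
      using that by (simp add: add_divide_distrib)
    then show ?thesis using that by simp
  qed
  ultimately have "divergence G X y = (\<Sum>i\<in>UNIV. partial_deriv (\<lambda>z. X z $ i) i y + D (axis i 1) * X y $ i / (2 * det (G y)))"
    unfolding divergence_def sum_divide_distrib using pos by simp
  then show ?thesis
    by (simp add: sum.distrib sum_divide_distrib partial_deriv_def D_def)
qed

lemma normal_of_differentiable:
  "y \<in> U \<Longrightarrow> p \<noteq> 0 \<Longrightarrow> (\<lambda>z. normal_of G z p $ i) differentiable (at y)"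
  using normal_of_has_derivative[of y "\<lambda>_. p" "\<lambda>_. 0" i] by (auto simp: differentiable_def)

lemma frozen_div_eq:
  assumes "y \<in> U" "p \<noteq> 0"
  shows "frozen_div G y p = (\<Sum>i\<in>UNIV. normal_of_dy G y p i (axis i 1))
    + (\<Sum>i\<in>UNIV. partial_deriv (\<lambda>z. det (G z)) i y * normal_of G y p $ i) / (2 * det (G y))"
proof -
  have "partial_deriv (\<lambda>z. normal_of G z p $ i) i y = normal_of_dy G y p i (axis i 1)" for i
    using partial_deriv_eq[OF normal_of_has_derivative[of y "\<lambda>_. p" "\<lambda>_. 0" i]] assms by simp
  then show ?thesis
    using divergence_expand[of y "\<lambda>z. normal_of G z p"] assms normal_of_differentiable
    by (simp add: frozen_div_def)
qed

lemma unit_normal_differentiable: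
  assumes V: "open V" "V \<subseteq> U" "y \<in> V" and u: "Ck_on 2 V u" and nz: "covec u y \<noteq> 0"
  shows "((\<lambda>z. unit_normal G u z $ i) has_derivative
    (\<lambda>v. normal_of_dy G y (covec u y) i v + (normal_of_dp G y (covec u y) *v
      (\<chi> j. frechet_derivative (\<lambda>z. partial_deriv u j z) (at y) v)) $ i)) (at y)"
proof (rule has_derivative_transform_within_open[OF normal_of_has_derivative[OF _ covec_has_derivative nz] V(1)])
  show "normal_of G z (covec u z) $ i = unit_normal G u z $ i" if "z \<in> V" for z
    using that V by (auto simp: unit_normal_eq)
qed (use V u in auto)

text \<open>Chain rule for \<open>normal_of\<close> composed with the differential. The terms at
  frozen differential, together with the volume term, add up to \<open>frozen_div\<close>; the
  others contract \<open>normal_of_dp\<close> with the Hessian.\<close>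

lemma divergence_unit_normal:
  assumes V: "open V" "V \<subseteq> U" "y \<in> V" and u: "Ck_on 2 V u" and nz: "covec u y \<noteq> 0"
  shows "divergence G (unit_normal G u) y = curv G y (covec u y) (hess u y)"
proof -
  have y: "y \<in> U" using V by auto
  note D = unit_normal_differentiable[OF assms]
  have "partial_deriv (\<lambda>z. unit_normal G u z $ i) i y = normal_of_dy G y (covec u y) i (axis i 1)
    + (\<Sum>j\<in>UNIV. normal_of_dp G y (covec u y) $ i $ j * hess u y $ i $ j)" for i
    unfolding partial_deriv_eq[OF D]
    by (simp add: matrix_vector_mult_def hess_def partial_deriv_def[abs_def])
  moreover have "(\<lambda>z. unit_normal G u z $ i) differentiable (at y)" for i
    using D by (auto simp: differentiable_def)
  ultimately show ?thesis
    using y nz by (simp add: divergence_expand frozen_div_eq curv_def unit_normal_eq sum.distrib)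
qed

lemma
  assumes "continuous_on S f" "f ` S \<subseteq> U" "continuous_on S p"
  shows continuous_on_inv_metric_mult: "continuous_on S (\<lambda>x. (matrix_inv (G (f x)) *v p x) $ i)"
    and continuous_on_conorm_sq: "continuous_on S (\<lambda>x. conorm_sq G (f x) (p x))"
proof -
  have g: "continuous_on S (\<lambda>x. matrix_inv (G (f x)) $ i $ j)" for i j
    using continuous_on_compose2[OF Ck_on_continuous_on[OF Ck_on_inv_metric[OF metric]] assms(1,2)] .
  have p: "continuous_on S (\<lambda>x. p x $ i)" for i
    by (intro continuous_intros assms)
  show N: "continuous_on S (\<lambda>x. (matrix_inv (G (f x)) *v p x) $ i)" for i
    unfolding matrix_vector_mult_def by (simp, intro continuous_on_field g p)
  show "continuous_on S (\<lambda>x. conorm_sq G (f x) (p x))"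
    unfolding conorm_sq_def inner_vec_def inner_real_def by (intro continuous_on_field N p)
qed

text \<open>Serves to bound curvature on a compact annulus and to keep a strict inequality for the
  speed under small perturbations.\<close>

lemma continuous_on_curv:
  assumes f: "continuous_on S f" "f ` S \<subseteq> U" and p: "continuous_on S p" "\<And>x. x \<in> S \<Longrightarrow> p x \<noteq> 0"
    and H: "continuous_on S H"
  shows "continuous_on S (\<lambda>x. curv G (f x) (p x) (H x))"
proof -
  have g: "continuous_on S (\<lambda>x. matrix_inv (G (f x)) $ i $ j)" for i j
    using continuous_on_compose2[OF Ck_on_continuous_on[OF Ck_on_inv_metric[OF metric]] f] .
  have "continuous_on U (\<lambda>y. frechet_derivative (\<lambda>z. matrix_inv (G z) $ i $ j) (at y) v)" for i j v
    using Ck_on_inv_metric[OF metric, of 1] by simp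
  note dg = continuous_on_compose2[OF this f]
  have d: "continuous_on S (\<lambda>x. det (G (f x)))"
    using continuous_on_compose2[OF Ck_on_continuous_on[OF Ck_on_det[OF metric_open[OF metric] metric_Ck[OF metric]]] f] .
  have "continuous_on U (\<lambda>y. partial_deriv (\<lambda>z. det (G z)) i y)" for i
    unfolding partial_deriv_def
    using Ck_on_det[OF metric_open[OF metric] metric_Ck[OF metric], of 1] by simp
  note dd = continuous_on_compose2[OF this f]
  have p': "continuous_on S (\<lambda>x. p x $ i)" and H': "continuous_on S (\<lambda>x. H x $ i $ j)" for i j
    by (intro continuous_intros p H)+
  note N = continuous_on_inv_metric_mult[OF f p(1)] and Q = continuous_on_conorm_sq[OF f p(1)]
  have Qnz: "conorm_sq G (f x) (p x) \<noteq> 0" and dnz: "det (G (f x)) \<noteq> 0" if "x \<in> S" for x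
    using conorm_sq_pos[of "f x" "p x"] metric_det_pos[OF metric, of "f x"] that f(2) p(2) by auto
  have "continuous_on S (\<lambda>x. frozen_div G (f x) (p x))"
  proof (subst continuous_on_cong[OF refl frozen_div_eq])
    show "continuous_on S (\<lambda>x. (\<Sum>i\<in>UNIV. normal_of_dy G (f x) (p x) i (axis i 1))
        + (\<Sum>i\<in>UNIV. partial_deriv (\<lambda>z. det (G z)) i (f x) * normal_of G (f x) (p x) $ i) / (2 * det (G (f x))))"
      unfolding normal_of_dy_def normal_of_def vector_scaleR_component inverse_eq_divide real_scaleR_def
      by (intro continuous_on_field g dg d dd N Q p') (use Qnz dnz in auto)
  qed (use f p in auto)
  moreover have "continuous_on S (\<lambda>x. normal_of_dp G (f x) (p x) $ i $ j)" for i j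
    unfolding normal_of_dp_def using Qnz
    by (simp, intro continuous_on_field g N Q) auto
  ultimately show ?thesis
    unfolding curv_def by (intro continuous_on_field H')
qed

end

section \<open>Comparison of touching level sets\<close>

text \<open>On the line \<open>axis i 1 + t *\<^sub>R axis j 1\<close> the quadratic form is
  \<open>2 * t * a + t\<^sup>2 * b\<close>, which keeps its sign near \<open>t = 0\<close> only if
  the linear part vanishes.\<close>

lemma psd_diag_zero:
  fixes M :: "real ^ 'n ^ 'n"
  assumes sym: "transpose M = M" and psd: "\<And>x. x \<bullet> (M *v x) \<ge> 0" and z: "M $ i $ i = 0"
  shows "M $ i $ j = 0"
proof (cases "i = j")
  case False
  define a b where "a = M $ i $ j" and "b = M $ j $ j"
  have "M $ j $ i = a"
    using sym by (metis a_def transpose_def vec_lambda_beta)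
  have ax: "axis k 1 \<bullet> (M *v axis l 1) = M $ k $ l" for k l
    by (simp add: matrix_vector_mult_basis column_def inner_axis')
  have q: "2 * t * a + t\<^sup>2 * b \<ge> 0" for t
  proof -
    have "0 \<le> (axis i 1 + t *\<^sub>R axis j 1) \<bullet> (M *v (axis i 1 + t *\<^sub>R axis j 1))"
      by (rule psd)
    also have "\<dots> = 2 * t * a + t\<^sup>2 * b"
      by (simp add: matrix_vector_right_distrib matrix_vector_mult_scaleR inner_add_left inner_add_right ax z
          \<open>M $ j $ i = a\<close> a_def[symmetric] b_def[symmetric] power2_eq_square algebra_simps)
    finally show ?thesis .
  qed
  have "b \<ge> 0"
    using psd[of "axis j 1"] by (simp add: ax b_def)
  \<comment> \<open>A substitute for the minimizer \<open>- a / b\<close> that also makes sense for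
    \<open>b = 0\<close>.\<close>
  have "2 * (- a / (b + 1)) * a + (- a / (b + 1))\<^sup>2 * b = - (a\<^sup>2 * (b + 2) / (b + 1)\<^sup>2)"
    using \<open>b \<ge> 0\<close> by (simp add: power2_eq_square divide_simps) (simp add: algebra_simps)
  with q[of "- a / (b + 1)"] have "a\<^sup>2 * (b + 2) / (b + 1)\<^sup>2 \<le> 0"
    by simp
  then show ?thesis
    using \<open>b \<ge> 0\<close> by (simp add: a_def[symmetric] divide_le_0_iff mult_le_0_iff add_nonneg_eq_0_iff)
qed (use z in simp)

text \<open>Peels off rank one matrices from \<open>M\<close>, as in the Cholesky decomposition.\<close>

lemma psd_trace_nonneg:
  fixes M H :: "real ^ 'n ^ 'n"
  assumes "transpose M = M" "\<And>x. x \<bullet> (M *v x) \<ge> 0" "\<And>x. (M *v x) \<bullet> (H *v (M *v x)) \<ge> 0"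
  shows "(\<Sum>i\<in>UNIV. \<Sum>j\<in>UNIV. M $ i $ j * H $ i $ j) \<ge> 0"
  using assms
proof (induction "card {i. M $ i $ i \<noteq> 0}" arbitrary: M rule: less_induct)
  case less
  note sym = less.prems(1) and psd = less.prems(2) and Hpos = less.prems(3)
  have symc: "M $ i $ j = M $ j $ i" for i j
    using sym by (metis transpose_def vec_lambda_beta)
  show ?case
  proof (cases "\<forall>i. M $ i $ i = 0")
    case True
    then show ?thesis
      using psd_diag_zero[OF sym psd] by simp
  next
    case False
    then obtain k where "M $ k $ k \<noteq> 0" by blast
    define d where "d = M $ k $ k"
    define a where "a = M *v axis k 1"
    have a: "a $ i = M $ i $ k" for i
      by (simp add: a_def matrix_vector_mult_basis column_def)
    have "axis k 1 \<bullet> (M *v axis k 1) = d"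
      by (simp add: matrix_vector_mult_basis column_def inner_axis' d_def)
    then have d: "d > 0"
      using psd[of "axis k 1"] \<open>M $ k $ k \<noteq> 0\<close> by (simp add: d_def)
    \<comment> \<open>The subtracted matrix is chosen to clear row and column \<open>k\<close>. The
      range of \<open>N\<close> stays inside that of \<open>M\<close>, so the hypothesis on
      \<open>H\<close> is inherited.\<close>
    define N where "N = (\<chi> i j. M $ i $ j - a $ i * a $ j / d)"
    have N: "N *v x = M *v (x - ((a \<bullet> x) / d) *\<^sub>R axis k 1)" for x
    proof -
      have "(N *v x) $ i = (M *v x) $ i - a $ i * (a \<bullet> x) / d" for i
        by (simp add: N_def matrix_vector_mult_def inner_vec_def left_diff_distrib sum_subtractf
            sum_distrib_left sum_divide_distrib mult.assoc)
      then show ?thesis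
        by (simp add: vec_eq_iff matrix_vector_mult_diff_distrib matrix_vector_mult_scaleR a_def[symmetric])
    qed
    have inner_a: "axis k 1 \<bullet> (M *v x) = a \<bullet> x" for x
      using symmetric_matrix_inner[OF sym, of "axis k 1" x] by (simp add: a_def)
    have "(\<Sum>i\<in>UNIV. \<Sum>j\<in>UNIV. N $ i $ j * H $ i $ j) \<ge> 0"
    proof (rule less.hyps)
      \<comment> \<open>The measure drops: diagonal entry \<open>k\<close> becomes zero, and entries
        that were zero stay so.\<close>
      have "N $ k $ k = 0"
        using d by (simp add: N_def a d_def)
      moreover have "N $ i $ i = 0" if "M $ i $ i = 0" for i
        using psd_diag_zero[OF sym psd that] that by (simp add: N_def a)
      ultimately have "{i. N $ i $ i \<noteq> 0} \<subset> {i. M $ i $ i \<noteq> 0}"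
        using \<open>M $ k $ k \<noteq> 0\<close> by blast
      then show "card {i. N $ i $ i \<noteq> 0} < card {i. M $ i $ i \<noteq> 0}"
        by (intro psubset_card_mono) auto
      show "transpose N = N"
        by (simp add: N_def transpose_def vec_eq_iff symc mult.commute)
      show "x \<bullet> (N *v x) \<ge> 0" for x
      proof -
        \<comment> \<open>\<open>?y\<close> is \<open>x\<close> made orthogonal to
          \<open>axis k 1\<close> with respect to \<open>M\<close>; the form of \<open>N\<close> at
          \<open>x\<close> is that of \<open>M\<close> at \<open>?y\<close>.\<close>
        let ?y = "x - ((a \<bullet> x) / d) *\<^sub>R axis k 1"
        have "axis k 1 \<bullet> (N *v x) = a \<bullet> ?y"
          unfolding N by (rule inner_a)
        also have "\<dots> = 0"
          using d by (simp add: inner_diff_right inner_axis a d_def)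
        finally have "x \<bullet> (N *v x) = ?y \<bullet> (M *v ?y)"
          by (simp add: N[symmetric] inner_diff_left)
        then show ?thesis using psd by simp
      qed
      show "(N *v x) \<bullet> (H *v (N *v x)) \<ge> 0" for x
        unfolding N by (rule Hpos)
    qed
    moreover have "(\<Sum>i\<in>UNIV. \<Sum>j\<in>UNIV. M $ i $ j * H $ i $ j)
      = (\<Sum>i\<in>UNIV. \<Sum>j\<in>UNIV. N $ i $ j * H $ i $ j) + (a \<bullet> (H *v a)) / d"
    proof -
      have "(\<Sum>i\<in>UNIV. \<Sum>j\<in>UNIV. M $ i $ j * H $ i $ j)
        = (\<Sum>i\<in>UNIV. \<Sum>j\<in>UNIV. N $ i $ j * H $ i $ j + a $ i * (H $ i $ j * a $ j) / d)"
        by (intro sum.cong refl) (simp add: N_def algebra_simps)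
      then show ?thesis
        by (simp add: sum.distrib inner_vec_def matrix_vector_mult_def sum_distrib_left sum_divide_distrib)
    qed
    moreover have "a \<bullet> (H *v a) \<ge> 0"
      using Hpos[of "axis k 1"] by (simp add: a_def)
    ultimately show ?thesis
      using d by simp
  qed
qed

lemma frechet_derivative_covec:
  assumes "u differentiable (at y)"
  shows "frechet_derivative u (at y) v = covec u y \<bullet> v"
proof -
  have lin: "linear (frechet_derivative u (at y))"
    using assms by (rule linear_frechet_derivative)
  have "v = (\<Sum>i\<in>UNIV. (v $ i) *\<^sub>R axis i 1)"
    by (simp add: vec_eq_iff axis_def if_distrib cong: if_cong)
  then have "frechet_derivative u (at y) v = frechet_derivative u (at y) (\<Sum>i\<in>UNIV. (v $ i) *\<^sub>R axis i 1)"
    by (rule arg_cong)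
  also have "\<dots> = (\<Sum>i\<in>UNIV. v $ i * frechet_derivative u (at y) (axis i 1))"
    by (simp add: linear_sum[OF lin] linear_cmul[OF lin])
  finally have "frechet_derivative u (at y) v = (\<Sum>i\<in>UNIV. v $ i * frechet_derivative u (at y) (axis i 1))" .
  then show ?thesis
    by (simp add: covec_def partial_deriv_def inner_vec_def mult.commute)
qed

text \<open>Along this parabola \<open>k\<close> has vanishing first derivative at \<open>0\<close>,
  and the quantity assumed negative is its second derivative there.\<close>

lemma second_order_curve:
  fixes k :: "real ^ 'n \<Rightarrow> real"
  assumes V: "open V" "q \<in> V" and k: "Ck_on 2 V k"
    and v: "covec k q \<bullet> v = 0" and neg: "v \<bullet> (hess k q *v v) + 2 * (covec k q \<bullet> z) < 0"
  shows "\<forall>\<^sub>F r in at_right 0. q + r *\<^sub>R v + r\<^sup>2 *\<^sub>R z \<in> V \<and> k (q + r *\<^sub>R v + r\<^sup>2 *\<^sub>R z) < k q"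
proof -
  define \<gamma> where "\<gamma> r = q + r *\<^sub>R v + r\<^sup>2 *\<^sub>R z" for r :: real
  have \<gamma>0: "\<gamma> 0 = q" by (simp add: \<gamma>_def)
  have d\<gamma>: "(\<gamma> has_derivative (\<lambda>h. h *\<^sub>R (v + (2 * r) *\<^sub>R z))) (at r)" for r
    unfolding \<gamma>_def by (auto intro!: derivative_eq_intros simp: algebra_simps)
  have "isCont \<gamma> 0"
    using d\<gamma> has_derivative_continuous by blast
  then have "\<forall>\<^sub>F r in at 0. \<gamma> r \<in> V"
    using V \<gamma>0 by (auto simp: isCont_def intro: topological_tendstoD)
  then obtain d1 where d1: "d1 > 0" and d1': "\<forall>r\<in>UNIV. r \<noteq> 0 \<and> dist r 0 < d1 \<longrightarrow> \<gamma> r \<in> V"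
    unfolding eventually_at by blast
  have d1V: "\<gamma> r \<in> V" if "\<bar>r\<bar> < d1" for r
    using d1' V(2) \<gamma>0 that by (cases "r = 0") (simp_all add: dist_real_def)
  define \<phi> where "\<phi> r = covec k (\<gamma> r) \<bullet> (v + (2 * r) *\<^sub>R z)" for r
  have dk: "((\<lambda>r. k (\<gamma> r)) has_real_derivative \<phi> r) (at r)" if "\<bar>r\<bar> < d1" for r
  proof -
    have "k differentiable (at (\<gamma> r))"
      using k d1V[OF that] by (simp add: numeral_2_eq_2)
    then have "(k has_derivative (\<lambda>w. covec k (\<gamma> r) \<bullet> w)) (at (\<gamma> r))"
      unfolding frechet_derivative_works frechet_derivative_covec[OF \<open>k differentiable _\<close>, abs_def] .
    from has_derivative_compose[OF d\<gamma> this]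
    have "((\<lambda>r. k (\<gamma> r)) has_derivative (\<lambda>h. h * \<phi> r)) (at r)"
      by (simp add: \<phi>_def)
    then show ?thesis
      by (simp add: has_field_derivative_def mult_commute_abs)
  qed
  define c' where "c' w = (\<chi> j. frechet_derivative (\<lambda>z. partial_deriv k j z) (at q) w)" for w
  have "(covec k has_derivative c') (at (\<gamma> 0))"
    unfolding \<gamma>0 c'_def by (rule covec_has_derivative[OF V k])
  from has_derivative_compose[OF d\<gamma> this]
  have "((\<lambda>r. covec k (\<gamma> r)) has_derivative (\<lambda>h. c' (h *\<^sub>R v))) (at 0)"
    by simp
  moreover have "((\<lambda>r. v + (2 * r) *\<^sub>R z) has_derivative (\<lambda>h. (2 * h) *\<^sub>R z)) (at 0)"
    by (auto intro!: derivative_eq_intros)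
  ultimately have "((\<lambda>r. covec k (\<gamma> r) \<bullet> (v + (2 * r) *\<^sub>R z)) has_derivative
      (\<lambda>h. covec k (\<gamma> 0) \<bullet> ((2 * h) *\<^sub>R z) + c' (h *\<^sub>R v) \<bullet> (v + (2 * 0) *\<^sub>R z))) (at 0)"
    by (rule has_derivative_inner)
  then have "(\<phi> has_derivative (\<lambda>h. covec k q \<bullet> ((2 * h) *\<^sub>R z) + c' (h *\<^sub>R v) \<bullet> v)) (at 0)"
    by (simp add: \<phi>_def[abs_def] \<gamma>0)
  moreover have "c' (h *\<^sub>R v) \<bullet> v = h * (v \<bullet> (hess k q *v v))" for h
  proof -
    have "(\<lambda>z. partial_deriv k j z) differentiable (at q)" for j
      unfolding partial_deriv_def using k V by (simp add: numeral_2_eq_2)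
    then have "c' w \<bullet> v = (\<Sum>j\<in>UNIV. (\<Sum>i\<in>UNIV. hess k q $ i $ j * w $ i) * v $ j)" for w
      by (simp add: c'_def inner_vec_def frechet_derivative_covec covec_def hess_def)
    then show ?thesis
      by (simp add: inner_vec_def matrix_vector_mult_def sum_distrib_left sum_distrib_right mult_ac)
        (subst sum.swap, simp add: mult_ac)
  qed
  ultimately have "(\<phi> has_derivative (\<lambda>h. h * (v \<bullet> (hess k q *v v) + 2 * (covec k q \<bullet> z)))) (at 0)"
    by (simp add: algebra_simps)
  then have "(\<phi> has_real_derivative (v \<bullet> (hess k q *v v) + 2 * (covec k q \<bullet> z))) (at 0)"
    by (simp add: has_field_derivative_def mult_commute_abs)
  from DERIV_neg_dec_right[OF this neg]
  obtain d2 where d2: "d2 > 0" and "\<forall>h>0. h < d2 \<longrightarrow> \<phi> (0 + h) < \<phi> 0"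
    by blast
  moreover have "\<phi> 0 = 0"
    using v by (simp add: \<phi>_def \<gamma>0)
  ultimately have \<phi>neg: "\<phi> h < 0" if "0 < h" "h < d2" for h
    using that by simp
  have "\<gamma> r \<in> V \<and> k (\<gamma> r) < k q" if "0 < r" "r < min d1 d2" for r
  proof -
    have "((\<lambda>r. k (\<gamma> r)) has_real_derivative \<phi> x) (at x)" if "0 \<le> x" "x \<le> r" for x
      by (rule dk) (use that \<open>r < min d1 d2\<close> in auto)
    from MVT2[OF \<open>0 < r\<close> this]
    obtain s where "0 < s" "s < r" "k (\<gamma> r) - k (\<gamma> 0) = (r - 0) * \<phi> s"
      by blast
    moreover have "\<phi> s < 0"
      by (rule \<phi>neg) (use \<open>0 < s\<close> \<open>s < r\<close> that in auto)
    ultimately show ?thesis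
      using that d1V[of r] mult_pos_neg[of r "\<phi> s"] by (simp add: \<gamma>0)
  qed
  then show ?thesis
    unfolding \<gamma>_def[symmetric] using d1 d2
    by (intro eventually_at_rightI[of 0 "min d1 d2"]) auto
qed

text \<open>The quantity \<open>\<Phi>\<close> for the sublevel sets of a function on an open part
  of space-time. The curvature term has a plus sign because the mean curvature, which is subtracted
  in \<open>\<Phi>\<close>, is minus a divergence.\<close>

definition level_speed :: "(real ^ 'n::finite \<Rightarrow> real ^ 'n ^ 'n) \<Rightarrow> ((real ^ 'n) \<times> real \<Rightarrow> real) \<Rightarrow> real ^ 'n \<Rightarrow> real \<Rightarrow> real" where
  "level_speed G f y t = - frechet_derivative f (at (y, t)) (0, 1) / sqrt (conorm_sq G y (covec (\<lambda>z. f (z, t)) y))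
    + curv G y (covec (\<lambda>z. f (z, t)) y) (hess (\<lambda>z. f (z, t)) y)"

lemma frechet_derivative_spacetime:
  assumes "f differentiable (at (y, s))"
  shows "frechet_derivative f (at (y, s)) (z, \<tau>) =
    covec (\<lambda>z. f (z, s)) y \<bullet> z + \<tau> * frechet_derivative f (at (y, s)) (0, 1)"
proof -
  let ?D = "frechet_derivative f (at (y, s))"
  have D: "(f has_derivative ?D) (at (y, s))"
    using assms by (simp add: frechet_derivative_works)
  then have lin: "linear ?D" by (rule has_derivative_linear)
  have "((\<lambda>z. (z, s)) has_derivative (\<lambda>z. (z, 0))) (at y)"
    by (auto intro!: derivative_eq_intros)
  from has_derivative_compose[OF this D]
  have slice: "((\<lambda>z. f (z, s)) has_derivative (\<lambda>z. ?D (z, 0))) (at y)" .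
  have "?D (z, \<tau>) = ?D ((z, 0) + \<tau> *\<^sub>R (0, 1))"
    by simp
  also have "\<dots> = ?D (z, 0) + \<tau> * ?D (0, 1)"
    by (simp only: linear_add[OF lin] linear_cmul[OF lin] real_scaleR_def)
  also have "?D (z, 0) = frechet_derivative (\<lambda>z. f (z, s)) (at y) z"
    using fun_cong[OF frechet_derivative_at[OF slice]] .
  also have "\<dots> = covec (\<lambda>z. f (z, s)) y \<bullet> z"
    by (rule frechet_derivative_covec) (use slice in \<open>auto simp: differentiable_def\<close>)
  finally show ?thesis .
qed

lemma Ck_on_slice:
  fixes f :: "'b::euclidean_space \<times> real \<Rightarrow> real"
  assumes "open V" "Ck_on k V f"
  shows "open {z. (z, s) \<in> V}" "Ck_on k {z. (z, s) \<in> V} (\<lambda>z. f (z, s))"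
proof -
  have "{z. (z, s) \<in> V} = (\<lambda>z. (z, s)) -` V" by auto
  then show op: "open {z. (z, s) \<in> V}"
    using assms(1) by (auto intro!: open_vimage continuous_intros)
  have "Ck_on k {z. (z, s) \<in> V} (\<lambda>z. (z, 0::real) + (0, s))"
    by (intro Ck_on_add Ck_on_const Ck_on_bounded_linear op bounded_linear_Pair bounded_linear_ident bounded_linear_zero)
  then have "Ck_on k {z. (z, s) \<in> V} (\<lambda>z. (z, s))" by simp
  from Ck_on_compose[OF op assms(1) _ assms(2) this]
  show "Ck_on k {z. (z, s) \<in> V} (\<lambda>z. f (z, s))" by auto
qed

lemma eventually_less_at_right:
  fixes \<phi> :: "real \<Rightarrow> real"
  assumes "(\<phi> has_real_derivative l) (at 0)" "l < 0"
  shows "\<forall>\<^sub>F r in at_right 0. \<phi> r < \<phi> 0"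
proof -
  obtain d where "d > 0" "\<forall>h>0. h < d \<longrightarrow> \<phi> (0 + h) < \<phi> 0"
    using DERIV_neg_dec_right[OF assms] by blast
  then show ?thesis
    by (intro eventually_at_rightI[of 0 d]) auto
qed

text \<open>Half-space duality: by a small shift into the half-space, \<open>p\<close> is
  nonnegative on the hyperplane orthogonal to \<open>q\<close>. Applied to \<open>z\<close> and
  \<open>- z\<close> this makes \<open>p\<close> a multiple of \<open>q\<close>, and testing with
  \<open>- q\<close> gives the sign.\<close>

lemma opposite_covector:
  fixes p q :: "'b::real_inner"
  assumes "q \<noteq> 0" "p \<noteq> 0" and opp: "\<And>z. q \<bullet> z < 0 \<Longrightarrow> p \<bullet> z \<ge> 0"
  obtains l where "l > 0" "p = - (l *\<^sub>R q)"
proof -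
  define m where "m = (p \<bullet> q) / (q \<bullet> q)"
  have qq: "q \<bullet> q > 0" using assms(1) by simp
  have opp': "p \<bullet> z \<ge> 0" if "q \<bullet> z = 0" for z
  proof (rule ccontr)
    assume "\<not> p \<bullet> z \<ge> 0"
    \<comment> \<open>So small that moving \<open>z\<close> by \<open>- t *\<^sub>R q\<close> costs
      at most half of \<open>- (p \<bullet> z)\<close>.\<close>
    define t where "t = - (p \<bullet> z) / (2 * (\<bar>p \<bullet> q\<bar> + 1))"
    have t: "t > 0" using \<open>\<not> p \<bullet> z \<ge> 0\<close> by (simp add: t_def field_simps)
    have "q \<bullet> (z - t *\<^sub>R q) < 0"
      using that t qq by (simp add: inner_diff_right)
    then have "p \<bullet> z - t * (p \<bullet> q) \<ge> 0"
      using opp[of "z - t *\<^sub>R q"] by (simp add: inner_diff_right)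
    moreover have "- (t * (p \<bullet> q)) \<le> t * (\<bar>p \<bullet> q\<bar> + 1)"
      using t by (smt (verit) mult_minus_right mult_left_mono)
    moreover have "t * (\<bar>p \<bullet> q\<bar> + 1) = - (p \<bullet> z) / 2"
      by (simp add: t_def field_simps)
    ultimately show False
      using \<open>\<not> p \<bullet> z \<ge> 0\<close> by simp
  qed
  define z where "z = p - m *\<^sub>R q"
  have qz: "q \<bullet> z = 0"
    using qq by (simp add: z_def m_def inner_diff_right inner_commute)
  then have "p \<bullet> z \<ge> 0" "p \<bullet> (- z) \<ge> 0"
    using opp'[of z] opp'[of "- z"] by simp_all
  then have "p \<bullet> z = 0" by simp
  then have "z \<bullet> z = 0"
    using qz by (simp add: z_def inner_diff_left)
  then have p: "p = m *\<^sub>R q"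
    by (simp add: z_def)
  have "p \<bullet> (- q) \<ge> 0"
    using opp[of "- q"] qq by simp
  then have "m \<le> 0"
    using qq by (simp add: m_def divide_nonpos_pos)
  moreover have "m \<noteq> 0"
    using p assms(2) by auto
  ultimately show ?thesis
    using that[of "- m"] p by simp
qed

context
  fixes U :: "(real ^ 'n::finite) set" and G :: "real ^ 'n \<Rightarrow> real ^ 'n ^ 'n"
  assumes metric: "metric_on U G"
begin

lemma conorm_sq_scale: "conorm_sq G y (c *\<^sub>R p) = c\<^sup>2 * conorm_sq G y p"
  by (simp add: conorm_sq_def matrix_vector_mult_scaleR power2_eq_square)

lemma normal_of_neg:
  "c < 0 \<Longrightarrow> normal_of G y (c *\<^sub>R p) = - normal_of G y p"
  by (simp add: normal_of_def conorm_sq_scale real_sqrt_mult matrix_vector_mult_scaleR)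

text \<open>\<open>normal_of\<close> is odd in the covector and positively homogeneous of degree
  \<open>0\<close>, so its derivative in that variable is even and of degree
  \<open>- 1\<close>.\<close>

lemma normal_of_dp_neg:
  assumes "c < 0"
  shows "normal_of_dp G y (c *\<^sub>R p) = (1 / \<bar>c\<bar>) *\<^sub>R normal_of_dp G y p"
  using assms
  by (simp add: vec_eq_iff normal_of_dp_def conorm_sq_scale real_sqrt_mult matrix_vector_mult_scaleR
      power2_eq_square divide_simps)

lemma frozen_div_neg:
  assumes "y \<in> U" "p \<noteq> 0" "c < 0"
  shows "frozen_div G y (c *\<^sub>R p) = - frozen_div G y p"
proof -
  note diff = normal_of_differentiable[OF metric assms(1,2)]
  have "partial_deriv (\<lambda>z. - normal_of G z p $ i) i y = - partial_deriv (\<lambda>z. normal_of G z p $ i) i y" for i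
    using partial_deriv_eq[OF has_derivative_minus[OF diff[unfolded frechet_derivative_works]]]
    by (simp add: partial_deriv_def)
  moreover have "(\<lambda>z. (- normal_of G z p) $ i) differentiable (at y)" for i
    using diff by simp
  ultimately show ?thesis
    using divergence_expand[OF metric assms(1), of "\<lambda>z. - normal_of G z p"]
      divergence_expand[OF metric assms(1), of "\<lambda>z. normal_of G z p"] diff
    by (simp add: frozen_div_def normal_of_neg[OF assms(3)] sum_negf)
qed

text \<open>The matrix is the inverse metric minus the tensor square of the unit normal, divided by
  the length of \<open>p\<close>: up to a factor, the part of the inverse metric tangent to the
  level set. Nonnegativity is the Cauchy-Schwarz inequality.\<close>

lemma normal_of_dp_psd:
  assumes y: "y \<in> U" and p: "p \<noteq> 0"
  shows "transpose (normal_of_dp G y p) = normal_of_dp G y p"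
    "x \<bullet> (normal_of_dp G y p *v x) \<ge> 0" "p \<bullet> (normal_of_dp G y p *v x) = 0"
proof -
  define g where "g = matrix_inv (G y)"
  define Q where "Q = conorm_sq G y p"
  have Q: "Q > 0" unfolding Q_def by (rule conorm_sq_pos[OF metric y p])
  have Qp: "p \<bullet> (g *v p) = Q"
    by (simp add: Q_def conorm_sq_def g_def)
  show "transpose (normal_of_dp G y p) = normal_of_dp G y p"
    by (simp add: transpose_def vec_eq_iff normal_of_dp_def inv_metric_sym[OF metric y] mult.commute)
  have sym: "(g *v a) \<bullet> b = a \<bullet> (g *v b)" for a b
    unfolding g_def by (rule inv_metric_inner[OF metric y])
  have A: "normal_of_dp G y p *v x = (1 / (Q * sqrt Q)) *\<^sub>R (Q *\<^sub>R (g *v x) - ((g *v p) \<bullet> x) *\<^sub>R (g *v p))" for x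
  proof -
    have "(normal_of_dp G y p *v x) $ i = (\<Sum>j\<in>UNIV. g $ i $ j * x $ j) / sqrt Q
      - (g *v p) $ i * (\<Sum>j\<in>UNIV. (g *v p) $ j * x $ j) / (Q * sqrt Q)" for i
      unfolding matrix_vector_mult_def[of "normal_of_dp G y p"]
      by (simp add: normal_of_dp_def Q_def[symmetric] g_def[symmetric] left_diff_distrib sum_subtractf
          sum_divide_distrib sum_distrib_left mult.assoc)
    then have "(normal_of_dp G y p *v x) $ i = (g *v x) $ i / sqrt Q
      - (g *v p) $ i * ((g *v p) \<bullet> x) / (Q * sqrt Q)" for i
      by (simp add: matrix_vector_mult_def[of g x] inner_vec_def)
    then show ?thesis
      using Q by (simp add: vec_eq_iff field_simps)
  qed
  show "p \<bullet> (normal_of_dp G y p *v x) = 0"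
    by (simp add: A inner_diff_right Qp sym)
  \<comment> \<open>\<open>Q\<close> times the component of \<open>x\<close> orthogonal to
    \<open>p\<close> in the dual metric; its squared length is \<open>Q\<close> times the
    Cauchy-Schwarz difference.\<close>
  let ?z = "Q *\<^sub>R x - (p \<bullet> (g *v x)) *\<^sub>R p"
  have "?z \<bullet> (g *v ?z) \<ge> 0"
    using inv_metric_pos[OF metric y, of ?z] by (cases "?z = 0") (auto simp: g_def)
  also have "?z \<bullet> (g *v ?z) = Q * (Q * (x \<bullet> (g *v x)) - (p \<bullet> (g *v x))\<^sup>2)"
    using sym[of x p] 
    by (simp add: matrix_vector_mult_diff_distrib matrix_vector_mult_scaleR inner_diff_left inner_diff_right
        Qp power2_eq_square inner_commute algebra_simps)
  finally have "Q * (x \<bullet> (g *v x)) - (p \<bullet> (g *v x))\<^sup>2 \<ge> 0"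
    using Q by (simp add: zero_le_mult_iff)
  moreover have "x \<bullet> (normal_of_dp G y p *v x) = (Q * (x \<bullet> (g *v x)) - (p \<bullet> (g *v x))\<^sup>2) / (Q * sqrt Q)"
    using sym[of x p] sym[of p x] by (simp add: A inner_diff_right power2_eq_square inner_commute)
  ultimately show "x \<bullet> (normal_of_dp G y p *v x) \<ge> 0"
    using Q by simp
qed

text \<open>The first derivatives are compared along space-time lines, and the Hessians along the parabolas
  \<open>q + r v + r\<^sup>2 z\<close> with \<open>v\<close> tangential, where \<open>z\<close> is used to push the curve into \<open>{h < 0}\<close>.\<close>

lemma touching_level_speed:
  fixes f h :: "(real ^ 'n) \<times> real \<Rightarrow> real"
  assumes V: "open V" "(q, s) \<in> V" and q: "q \<in> U"
    and f: "Ck_on 2 V f" "f (q, s) = 0" "covec (\<lambda>z. f (z, s)) q \<noteq> 0"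
    and h: "Ck_on 2 V h" "h (q, s) = 0" "covec (\<lambda>z. h (z, s)) q \<noteq> 0"
    and sep: "\<And>y t. (y, t) \<in> V \<Longrightarrow> t \<le> s \<Longrightarrow> h (y, t) < 0 \<Longrightarrow> f (y, t) \<ge> 0"
  shows "level_speed G f q s + level_speed G h q s \<ge> 0"
proof -
  define pf where "pf = covec (\<lambda>z. f (z, s)) q"
  define ph where "ph = covec (\<lambda>z. h (z, s)) q"
  define tf where "tf = frechet_derivative f (at (q, s)) (0, 1)"
  define th where "th = frechet_derivative h (at (q, s)) (0, 1)"
  define Hf where "Hf = hess (\<lambda>z. f (z, s)) q"
  define Hh where "Hh = hess (\<lambda>z. h (z, s)) q"
  have path: "((\<lambda>r. u (q + r *\<^sub>R z, s - r * \<tau>)) has_real_derivative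
      (covec (\<lambda>z. u (z, s)) q \<bullet> z - \<tau> * frechet_derivative u (at (q, s)) (0, 1))) (at 0)"
    if "Ck_on 2 V u" for u z \<tau>
  proof -
    have diff: "u differentiable (at (q, s))"
      using that V by (simp add: numeral_2_eq_2)
    have "((\<lambda>r. (q + r *\<^sub>R z, s - r * \<tau>)) has_derivative (\<lambda>r. (r *\<^sub>R z, r * - \<tau>))) (at 0)"
      by (auto intro!: derivative_eq_intros)
    moreover have "(u has_derivative frechet_derivative u (at (q, s))) (at (q + 0 *\<^sub>R z, s - 0 * \<tau>))"
      using diff by (simp add: frechet_derivative_works)
    ultimately have "((\<lambda>r. u (q + r *\<^sub>R z, s - r * \<tau>)) has_derivative
        (\<lambda>r. frechet_derivative u (at (q, s)) (r *\<^sub>R z, r * - \<tau>))) (at 0)"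
      by (rule has_derivative_compose)
    moreover have "frechet_derivative u (at (q, s)) (r *\<^sub>R z, r * - \<tau>) =
        (covec (\<lambda>z. u (z, s)) q \<bullet> z - \<tau> * frechet_derivative u (at (q, s)) (0, 1)) * r" for r
      by (subst frechet_derivative_spacetime[OF diff]) (simp add: algebra_simps)
    ultimately show ?thesis
      by (simp add: has_field_derivative_def)
  qed
  \<comment> \<open>Separation is known up to time \<open>s\<close> only, so the lines may run
    backwards in time but not forwards. This is why the space part will give proportionality and the
    time part just an inequality.\<close>
  have first: "pf \<bullet> z - \<tau> * tf \<ge> 0" if "ph \<bullet> z - \<tau> * th < 0" "\<tau> \<ge> 0" for z \<tau>
  proof (rule ccontr)
    assume "\<not> pf \<bullet> z - \<tau> * tf \<ge> 0"
    then have "\<forall>\<^sub>F r in at_right 0. f (q + r *\<^sub>R z, s - r * \<tau>) < 0"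
      using eventually_less_at_right[OF path[OF f(1), of z \<tau>]] f(2) by (simp add: pf_def tf_def)
    moreover have "\<forall>\<^sub>F r in at_right 0. h (q + r *\<^sub>R z, s - r * \<tau>) < 0"
      using eventually_less_at_right[OF path[OF h(1), of z \<tau>]] h(2) that by (simp add: ph_def th_def)
    moreover have "\<forall>\<^sub>F r in at_right 0. (q + r *\<^sub>R z, s - r * \<tau>) \<in> V"
    proof -
      have "((\<lambda>r. (q + r *\<^sub>R z, s - r * \<tau>)) \<longlongrightarrow> (q + 0 *\<^sub>R z, s - 0 * \<tau>)) (at_right 0)"
        by (intro tendsto_intros)
      then show ?thesis
        using V by (auto dest: topological_tendstoD)
    qed
    moreover have "\<forall>\<^sub>F r in at_right (0::real). r > 0"
      by (simp add: eventually_at_right_less)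
    ultimately have "\<forall>\<^sub>F r in at_right 0. f (q + r *\<^sub>R z, s - r * \<tau>) < 0 \<and> h (q + r *\<^sub>R z, s - r * \<tau>) < 0
        \<and> (q + r *\<^sub>R z, s - r * \<tau>) \<in> V \<and> r > 0"
      by eventually_elim auto
    then obtain r where r: "f (q + r *\<^sub>R z, s - r * \<tau>) < 0" "h (q + r *\<^sub>R z, s - r * \<tau>) < 0"
        "(q + r *\<^sub>R z, s - r * \<tau>) \<in> V" "r > 0"
      using eventually_happens'[OF trivial_limit_at_right_real] by blast
    then show False
      using sep[OF r(3) _ r(2)] that by auto
  qed
  obtain l where l: "l > 0" "pf = - (l *\<^sub>R ph)"
  proof (rule opposite_covector[of ph pf])
    show "pf \<bullet> z \<ge> 0" if "ph \<bullet> z < 0" for z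
      using first[of z 0] that by simp
  qed (use f h in \<open>auto simp: pf_def ph_def\<close>)
  have pp: "ph \<bullet> ph > 0"
    using h(3) by (simp add: ph_def)
  have time: "tf + l * th \<le> 0"
  proof (rule field_le_epsilon)
    fix e :: real assume "e > 0"
    \<comment> \<open>For \<open>z = \<theta> *\<^sub>R ph\<close> and \<open>\<tau> = 1\<close> the
      function \<open>h\<close> changes along the line at the rate \<open>- e / l\<close>, just
      enough to apply \<open>first\<close>.\<close>
    define \<theta> where "\<theta> = (th - e / l) / (ph \<bullet> ph)"
    have 1: "ph \<bullet> (\<theta> *\<^sub>R ph) = th - e / l"
      using pp by (simp add: \<theta>_def)
    have "pf \<bullet> (\<theta> *\<^sub>R ph) - 1 * tf \<ge> 0"
      by (rule first) (use 1 \<open>e > 0\<close> l in auto)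
    moreover have "pf \<bullet> (\<theta> *\<^sub>R ph) = - l * (ph \<bullet> (\<theta> *\<^sub>R ph))"
      by (simp add: l(2))
    ultimately have "- l * (th - e / l) - tf \<ge> 0"
      unfolding 1 by simp
    then show "tf + l * th \<le> 0 + e"
      using l(1) by (simp add: algebra_simps)
  qed
  define S where "S = {z. (z, s) \<in> V}"
  have S: "open S" "q \<in> S" and fS: "Ck_on 2 S (\<lambda>z. f (z, s))" and hS: "Ck_on 2 S (\<lambda>z. h (z, s))"
    unfolding S_def using Ck_on_slice V f(1) h(1) by auto
  have second: "v \<bullet> (Hf *v v) + 2 * (pf \<bullet> z) \<ge> 0" if "ph \<bullet> v = 0" "v \<bullet> (Hh *v v) + 2 * (ph \<bullet> z) < 0" for v z
  proof (rule ccontr)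
    assume neg: "\<not> v \<bullet> (Hf *v v) + 2 * (pf \<bullet> z) \<ge> 0"
    have "pf \<bullet> v = 0" using that l by simp
    have "\<forall>\<^sub>F r in at_right 0. q + r *\<^sub>R v + r\<^sup>2 *\<^sub>R z \<in> S \<and> f (q + r *\<^sub>R v + r\<^sup>2 *\<^sub>R z, s) < f (q, s)"
      by (rule second_order_curve[OF S fS]) (use neg \<open>pf \<bullet> v = 0\<close> in \<open>auto simp: pf_def Hf_def\<close>)
    moreover have "\<forall>\<^sub>F r in at_right 0. q + r *\<^sub>R v + r\<^sup>2 *\<^sub>R z \<in> S \<and> h (q + r *\<^sub>R v + r\<^sup>2 *\<^sub>R z, s) < h (q, s)"
      by (rule second_order_curve[OF S hS]) (use that in \<open>auto simp: ph_def Hh_def\<close>)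
    ultimately have "\<forall>\<^sub>F r in at_right 0. q + r *\<^sub>R v + r\<^sup>2 *\<^sub>R z \<in> S
        \<and> f (q + r *\<^sub>R v + r\<^sup>2 *\<^sub>R z, s) < 0 \<and> h (q + r *\<^sub>R v + r\<^sup>2 *\<^sub>R z, s) < 0"
      by eventually_elim (use f(2) h(2) in auto)
    then obtain r where "q + r *\<^sub>R v + r\<^sup>2 *\<^sub>R z \<in> S" "f (q + r *\<^sub>R v + r\<^sup>2 *\<^sub>R z, s) < 0"
        "h (q + r *\<^sub>R v + r\<^sup>2 *\<^sub>R z, s) < 0"
      using eventually_happens'[OF trivial_limit_at_right_real] by blast
    then show False
      using sep[of "q + r *\<^sub>R v + r\<^sup>2 *\<^sub>R z" s] by (auto simp: S_def)
  qed
  have tangential: "v \<bullet> ((Hf + l *\<^sub>R Hh) *v v) \<ge> 0" if v: "pf \<bullet> v = 0" for v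
  proof -
    have "0 \<le> (v \<bullet> (Hf *v v) + l * (v \<bullet> (Hh *v v))) + e" if "e > 0" for e
    proof -
      \<comment> \<open>With this correction the second derivative of \<open>h\<close> along the
        parabola is \<open>- e / l\<close>.\<close>
      define \<theta> where "\<theta> = (- (v \<bullet> (Hh *v v)) - e / l) / (2 * (ph \<bullet> ph))"
      have 1: "2 * (ph \<bullet> (\<theta> *\<^sub>R ph)) = - (v \<bullet> (Hh *v v)) - e / l"
        using pp by (simp add: \<theta>_def)
      have "v \<bullet> (Hf *v v) + 2 * (pf \<bullet> (\<theta> *\<^sub>R ph)) \<ge> 0"
        by (rule second) (use 1 that l v in auto)
      moreover have "2 * (pf \<bullet> (\<theta> *\<^sub>R ph)) = - l * (2 * (ph \<bullet> (\<theta> *\<^sub>R ph)))"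
        by (simp add: l(2))
      ultimately show ?thesis
        unfolding 1 using l(1) by (simp add: algebra_simps)
    qed
    then have "0 \<le> v \<bullet> (Hf *v v) + l * (v \<bullet> (Hh *v v))"
      using field_le_epsilon[of 0 "v \<bullet> (Hf *v v) + l * (v \<bullet> (Hh *v v))"] by simp
    then show ?thesis
      by (simp add: matrix_vector_mult_add_rdistrib scaleR_matrix_vector_assoc[symmetric] inner_add_right)
  qed
  \<comment> \<open>Both speeds are now expressed by the covector \<open>pf\<close>. Passing to
    \<open>ph\<close>, a negative multiple of it, reverses \<open>frozen_div\<close>, which
    therefore cancels in the sum, and multiplies \<open>normal_of_dp\<close> by
    \<open>l\<close>.\<close>
  define c where "c = - (1 / l)"
  have c: "c < 0" "ph = c *\<^sub>R pf"
    using l by (auto simp: c_def)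
  have pf: "pf \<noteq> 0" using f(3) by (simp add: pf_def)
  have "level_speed G h q s = - th / (\<bar>c\<bar> * sqrt (conorm_sq G q pf)) - frozen_div G q pf
      + l * (\<Sum>i\<in>UNIV. \<Sum>j\<in>UNIV. normal_of_dp G q pf $ i $ j * Hh $ i $ j)"
    unfolding level_speed_def ph_def[symmetric] th_def[symmetric] Hh_def[symmetric] c(2) curv_def
      conorm_sq_scale frozen_div_neg[OF q pf c(1)] normal_of_dp_neg[OF c(1)]
    using l(1) by (simp add: c_def real_sqrt_mult sum_distrib_left mult.assoc real_sqrt_divide)
  moreover have "level_speed G f q s = - tf / sqrt (conorm_sq G q pf) + frozen_div G q pf
      + (\<Sum>i\<in>UNIV. \<Sum>j\<in>UNIV. normal_of_dp G q pf $ i $ j * Hf $ i $ j)"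
    by (simp add: level_speed_def pf_def tf_def Hf_def curv_def)
  moreover have "- th / (\<bar>c\<bar> * sqrt (conorm_sq G q pf)) = - (l * th) / sqrt (conorm_sq G q pf)"
    using l(1) by (simp add: c_def)
  \<comment> \<open>The range of \<open>normal_of_dp\<close> is orthogonal to \<open>pf\<close>, so
    nonnegativity of the combined Hessian on tangential vectors suffices.\<close>
  moreover have "(\<Sum>i\<in>UNIV. \<Sum>j\<in>UNIV. normal_of_dp G q pf $ i $ j * (Hf + l *\<^sub>R Hh) $ i $ j) \<ge> 0"
    by (rule psd_trace_nonneg) (use normal_of_dp_psd[OF q pf] tangential in auto)
  moreover have "(\<Sum>i\<in>UNIV. \<Sum>j\<in>UNIV. normal_of_dp G q pf $ i $ j * (Hf + l *\<^sub>R Hh) $ i $ j)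
     = (\<Sum>i\<in>UNIV. \<Sum>j\<in>UNIV. normal_of_dp G q pf $ i $ j * Hf $ i $ j)
     + l * (\<Sum>i\<in>UNIV. \<Sum>j\<in>UNIV. normal_of_dp G q pf $ i $ j * Hh $ i $ j)"
    by (simp add: sum_distrib_left sum.distrib algebra_simps)
  moreover have "- tf / sqrt (conorm_sq G q pf) + - (l * th) / sqrt (conorm_sq G q pf) \<ge> 0"
  proof -
    have "- tf / sqrt (conorm_sq G q pf) + - (l * th) / sqrt (conorm_sq G q pf) = - (tf + l * th) / sqrt (conorm_sq G q pf)"
      by (simp add: add_divide_distrib diff_divide_distrib)
    then show ?thesis
      using time conorm_sq_pos[OF metric q pf] by (simp add: divide_nonpos_pos)
  qed
  ultimately show ?thesis by linarith
qed

end

section \<open>Independence of the chart\<close>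

text \<open>A permutation other than the identity moves at least two indices, so with one factor
  differentiated another off-diagonal entry of the identity matrix remains, and the term
  vanishes.\<close>

lemma has_derivative_det_mat_1:
  fixes N :: "'b::real_normed_vector \<Rightarrow> real ^ 'n ^ 'n"
  assumes N: "\<And>i j. ((\<lambda>z. N z $ i $ j) has_derivative N' i j) (at y)" and y: "N y = mat 1"
  shows "((\<lambda>z. det (N z)) has_derivative (\<lambda>v. \<Sum>i\<in>UNIV. N' i i v)) (at y)"
proof -
  define T where "T p v = of_int (sign p) * (\<Sum>i\<in>UNIV. N' i (p i) v * (\<Prod>j\<in>UNIV - {i}. N y $ j $ p j))" for p :: "'n \<Rightarrow> 'n" and v
  have "((\<lambda>z. det (N z)) has_derivative (\<lambda>v. \<Sum>p | p permutes UNIV. T p v)) (at y)"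
    unfolding det_def T_def by (intro has_derivative_sum has_derivative_mult_right has_derivative_prod N)
  moreover have "(\<Sum>p | p permutes UNIV. T p v) = (\<Sum>i\<in>UNIV. N' i i v)" for v
  proof -
    have "T p v = 0" if p: "p permutes UNIV" "p \<noteq> id" for p
    proof -
      obtain a where a: "p a \<noteq> a" using p(2) by (auto simp: fun_eq_iff)
      have "(\<Prod>j\<in>UNIV - {i}. N y $ j $ p j) = 0" for i
      proof -
        have "p (p a) \<noteq> p a"
          using a permutes_inj[OF p(1)] by (auto dest: injD)
        then obtain j where "j \<noteq> i" "p j \<noteq> j"
          using a by metis
        then show ?thesis
          by (intro prod_zero) (auto simp: y mat_def intro!: bexI[of _ j])
      qed
      then show ?thesis
        unfolding T_def by (simp only: mult_zero_right sum.neutral_const)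
    qed
    then have "(\<Sum>p | p permutes UNIV. T p v) = (\<Sum>p\<in>{id}. T p v)"
      by (intro sum.mono_neutral_right) (auto simp: permutes_id)
    also have "\<dots> = (\<Sum>i\<in>UNIV. N' i i v)"
      by (simp add: T_def y mat_def)
    finally show ?thesis .
  qed
  ultimately show ?thesis by simp
qed

text \<open>Jacobi's formula, reduced to the identity matrix by left multiplication with the inverse
  \<open>B\<close> of \<open>M y\<close>.\<close>

lemma has_derivative_det:
  fixes M :: "'b::real_normed_vector \<Rightarrow> real ^ 'n ^ 'n"
  assumes M: "\<And>i j. ((\<lambda>z. M z $ i $ j) has_derivative M' i j) (at y)" and B: "B ** M y = mat 1"
  shows "((\<lambda>z. det (M z)) has_derivative (\<lambda>v. det (M y) * (\<Sum>i\<in>UNIV. \<Sum>k\<in>UNIV. B $ i $ k * M' k i v))) (at y)"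
proof -
  have "((\<lambda>z. (B ** M z) $ i $ j) has_derivative (\<lambda>v. \<Sum>k\<in>UNIV. B $ i $ k * M' k j v)) (at y)" for i j
    by (simp add: matrix_matrix_mult_def) (intro has_derivative_sum has_derivative_mult_right M)
  from has_derivative_det_mat_1[OF this B]
  have "((\<lambda>z. det (M y) * det (B ** M z)) has_derivative (\<lambda>v. det (M y) * (\<Sum>i\<in>UNIV. \<Sum>k\<in>UNIV. B $ i $ k * M' k i v))) (at y)"
    by (rule has_derivative_mult_right)
  moreover have "det (M y) * det (B ** M z) = det (M z)" for z
  proof -
    have "det B * det (M y) = 1"
      using arg_cong[OF B, of det] by (simp add: det_mul)
    then show ?thesis by (simp add: det_mul mult.left_commute)
  qed
  ultimately show ?thesis by simp
qed

text \<open>Differentiability is not assumed: both sides choose from the same set of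
  derivatives.\<close>

lemma frechet_derivative_cong_local:
  assumes "open V" "y \<in> V" "\<And>z. z \<in> V \<Longrightarrow> u z = v z"
  shows "frechet_derivative u (at y) = frechet_derivative v (at y)"
proof -
  have "(u has_derivative D) (at y) \<longleftrightarrow> (v has_derivative D) (at y)" for D
    using has_derivative_transform_within_open[OF _ assms(1,2)] assms(3) by metis
  then show ?thesis by (simp add: frechet_derivative_def)
qed

lemma covec_cong:
  assumes "open V" "y \<in> V" "\<And>z. z \<in> V \<Longrightarrow> u z = v z"
  shows "covec u y = covec v y"
  using frechet_derivative_cong_local[OF assms] by (simp add: covec_def partial_deriv_def)

lemma hess_cong:
  assumes "open V" "y \<in> V" "\<And>z. z \<in> V \<Longrightarrow> u z = v z"
  shows "hess u y = hess v y"
proof -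
  have "partial_deriv u j z = partial_deriv v j z" if "z \<in> V" for j z
    using frechet_derivative_cong_local[OF assms(1) that assms(3)] by (simp add: partial_deriv_def)
  then show ?thesis
    using frechet_derivative_cong_local[OF assms(1,2), of "\<lambda>z. partial_deriv u _ z"]
    by (simp add: hess_def partial_deriv_def[of "\<lambda>z. partial_deriv _ _ z"])
qed

locale coordinate_change =
  fixes S S' :: "(real ^ 'n::finite) set" and G G' :: "real ^ 'n \<Rightarrow> real ^ 'n ^ 'n"
    and T :: "real ^ 'n \<Rightarrow> real ^ 'n" and J :: "real ^ 'n \<Rightarrow> real ^ 'n ^ 'n"
  assumes metric: "metric_on S G" and metric': "metric_on S' G'"
    and T: "Ck_on 2 S T" "T ` S \<subseteq> S'"
    and J: "\<And>y. J y = matrix (frechet_derivative T (at y))"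
    and G: "\<And>y. y \<in> S \<Longrightarrow> G y = transpose (J y) ** G' (T y) ** J y"
begin

lemma S: "open S" and T_mem: "y \<in> S \<Longrightarrow> T y \<in> S'"
  using metric_open[OF metric] T(2) by auto

lemma T_has_derivative: 
  assumes "y \<in> S"
  shows "(T has_derivative (\<lambda>v. J y *v v)) (at y)"
proof -
  have D: "(T has_derivative frechet_derivative T (at y)) (at y)"
    using T(1) assms Ck_on_has_derivative[of 1 S T] by (simp add: numeral_2_eq_2)
  then show ?thesis
    using matrix_works[of "frechet_derivative T (at y)"] has_derivative_linear[OF D]
    by (simp add: J linear_matrix_vector_mul_eq)
qed

lemma det_G: "y \<in> S \<Longrightarrow> det (G y) = (det (J y))\<^sup>2 * det (G' (T y))"
  by (simp add: G det_mul power2_eq_square)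

text \<open>Invertibility of the Jacobian comes from the metric: \<open>det (G y)\<close> is
  positive and contains the factor \<open>(det (J y))\<^sup>2\<close>.\<close>

lemma J_inverse:
  assumes "y \<in> S"
  shows "J y ** matrix_inv (J y) = mat 1" "matrix_inv (J y) ** J y = mat 1" "det (J y) \<noteq> 0"
proof -
  show nz: "det (J y) \<noteq> 0"
    using det_G[OF assms] metric_det_pos[OF metric assms] by auto
  then have "invertible (J y)" by (simp add: invertible_det_nz)
  then show "J y ** matrix_inv (J y) = mat 1" "matrix_inv (J y) ** J y = mat 1"
    using someI_ex[of "\<lambda>B. J y ** B = mat 1 \<and> B ** J y = mat 1"]
    by (auto simp: matrix_inv_def invertible_def)
qed

text \<open>Cancelling \<open>transpose (J y)\<close> in the transformation law shows that
  \<open>J y\<close> carries the vector dual to \<open>p\<close> to the vector dual to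
  \<open>p'\<close>; the claims on length and normal follow.\<close>

lemma
  assumes y: "y \<in> S" and p: "p = transpose (J y) *v p'"
  shows conorm_sq_eq: "conorm_sq G y p = conorm_sq G' (T y) p'"
    and push_normal: "J y *v normal_of G y p = normal_of G' (T y) p'"
proof -
  define N where "N = matrix_inv (G y) *v p"
  have "transpose (J y) *v (G' (T y) *v (J y *v N)) = G y *v N"
    by (simp add: G[OF y] matrix_vector_mul_assoc matrix_mul_assoc)
  also have "\<dots> = transpose (J y) *v p'"
    by (simp add: N_def metric_mult_inv[OF metric y] p)
  finally have eq: "transpose (J y) *v (G' (T y) *v (J y *v N)) = transpose (J y) *v p'" .
  have "transpose (matrix_inv (J y)) ** transpose (J y) = mat 1"
    using J_inverse[OF y] by (metis matrix_transpose_mul transpose_mat)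
  then have inv: "transpose (matrix_inv (J y)) *v (transpose (J y) *v w) = w" for w
    by (simp only: matrix_vector_mul_assoc matrix_vector_mul_lid)
  have "G' (T y) *v (J y *v N) = p'"
    using arg_cong[OF eq, of "\<lambda>v. transpose (matrix_inv (J y)) *v v"] by (simp only: inv)
  then have push: "J y *v (matrix_inv (G y) *v p) = matrix_inv (G' (T y)) *v p'"
    using metric_inv[OF metric' T_mem[OF y]] by (metis N_def matrix_vector_mul_assoc matrix_vector_mul_lid)
  have "p \<bullet> N = p' \<bullet> (J y *v N)"
    by (simp add: p dot_lmul_matrix[symmetric])
  then show "conorm_sq G y p = conorm_sq G' (T y) p'"
    by (simp add: conorm_sq_def N_def push)
  then show "J y *v normal_of G y p = normal_of G' (T y) p'"
    by (simp add: normal_of_def matrix_vector_mult_scaleR push)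
qed

context
  fixes u u' :: "real ^ 'n \<Rightarrow> real"
  assumes u': "Ck_on 2 S' u'" and u: "\<And>y. y \<in> S \<Longrightarrow> u y = u' (T y)"
begin

lemma covec_pullback:
  assumes y: "y \<in> S"
  shows "covec u y = transpose (J y) *v covec u' (T y)"
proof -
  have du': "u' differentiable (at (T y))"
    using u' T_mem[OF y] by (simp add: numeral_2_eq_2)
  from has_derivative_compose[OF T_has_derivative[OF y] du'[unfolded frechet_derivative_works]]
  have "((\<lambda>z. u' (T z)) has_derivative (\<lambda>v. covec u' (T y) \<bullet> (J y *v v))) (at y)"
    by (simp add: frechet_derivative_covec[OF du'])
  then have "(u has_derivative (\<lambda>v. covec u' (T y) \<bullet> (J y *v v))) (at y)"
    by (rule has_derivative_transform_within_open[OF _ S y]) (simp add: u)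
  note D = partial_deriv_eq[OF this]
  have "(transpose (J y) *v q) $ i = q \<bullet> column i (J y)" for q i
    by (simp add: matrix_vector_mult_def transpose_def column_def inner_vec_def mult.commute)
  then show ?thesis
    by (simp add: vec_eq_iff covec_def[of u] D matrix_vector_mult_basis)
qed

lemma Ck_on_pullback: "Ck_on 2 S u"
  by (rule Ck_on_cong[OF S _ Ck_on_compose[OF S metric_open[OF metric'] T(2) u' T(1)]]) (simp add: u)

text \<open>Differentiate \<open>J X = X' \<circ> T\<close>: the terms with second derivatives of \<open>T\<close> combine, by their
  symmetry, to the logarithmic derivative of \<open>det J\<close>.\<close>

lemma divergence_unit_normal_pullback:
  assumes y: "y \<in> S" and nz: "covec u y \<noteq> 0"
  shows "divergence G (unit_normal G u) y = divergence G' (unit_normal G' u') (T y)"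
proof -
  define X where "X = unit_normal G u"
  define X' where "X' = unit_normal G' u'"
  define B where "B = matrix_inv (J y)"
  have nz': "covec u' (T y) \<noteq> 0"
    using nz covec_pullback[OF y] by auto
  have push: "J z *v X z = X' (T z)" if "z \<in> S" for z
    unfolding X_def X'_def unit_normal_eq[OF metric that] unit_normal_eq[OF metric' T_mem[OF that]]
    by (rule push_normal[OF that covec_pullback[OF that]])
  have dX: "(\<lambda>z. X z $ i) differentiable (at y)" for i
    using unit_normal_differentiable[OF metric S order_refl y Ck_on_pullback nz, of i]
    by (auto simp: X_def differentiable_def)
  have dX': "(\<lambda>z. X' z $ i) differentiable (at (T y))" for i
    using unit_normal_differentiable[OF metric' metric_open[OF metric'] order_refl T_mem[OF y] u' nz', of i]
    by (auto simp: X'_def differentiable_def)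
  define d where "d i f = partial_deriv f i y" for i :: 'n and f :: "real ^ 'n \<Rightarrow> real"
  define d' where "d' i f = partial_deriv f i (T y)" for i :: 'n and f :: "real ^ 'n \<Rightarrow> real"
  have TC: "Ck_on 2 S (\<lambda>z. T z $ k)" for k
    by (rule Ck_on_linear_comp[OF S bounded_linear_vec_nth T(1)])
  have J_entry: "J z $ k $ l = frechet_derivative (\<lambda>z. T z $ k) (at z) (axis l 1)" if "z \<in> S" for z k l
    using partial_deriv_eq[OF has_derivative_vec_nth_fun[OF T_has_derivative[OF that]], of k l]
    by (simp add: partial_deriv_def matrix_vector_mult_basis column_def)
  define J' where "J' k l = frechet_derivative (\<lambda>z. J z $ k $ l) (at y)" for k l
  have J_C1: "Ck_on 1 S (\<lambda>z. J z $ k $ l)" for k l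
    by (rule Ck_on_cong[OF S _]) (use J_entry TC[of k] in \<open>auto simp: numeral_2_eq_2\<close>)
  have J': "((\<lambda>z. J z $ k $ l) has_derivative J' k l) (at y)" for k l
    unfolding J'_def by (rule Ck_on_has_derivative[of 0 S]) (use J_C1[of k l] y in auto)
  have J'_sym: "J' k l (axis i 1) = J' k i (axis l 1)" for k l i
  proof -
    have "J' k l = frechet_derivative (\<lambda>z. frechet_derivative (\<lambda>z. T z $ k) (at z) (axis l 1)) (at y)" for l
      unfolding J'_def by (rule frechet_derivative_cong_local[OF S y]) (simp add: J_entry)
    then show ?thesis
      using symmetric_second_derivative[OF S TC y] by simp
  qed
  have chain: "partial_deriv (\<lambda>z. h (T z)) i y = (\<Sum>m\<in>UNIV. d' m h * J y $ m $ i)"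
    if "h differentiable (at (T y))" for h i
  proof -
    have "((\<lambda>z. h (T z)) has_derivative (\<lambda>v. covec h (T y) \<bullet> (J y *v v))) (at y)"
      using has_derivative_compose[OF T_has_derivative[OF y] that[unfolded frechet_derivative_works]]
      by (simp add: frechet_derivative_covec[OF that])
    from partial_deriv_eq[OF this] show ?thesis
      by (simp add: inner_vec_def covec_def d'_def matrix_vector_mult_basis column_def)
  qed
  have BJ: "(\<Sum>k\<in>UNIV. B $ i $ k * J y $ k $ l) = (if i = l then 1 else 0)" for i l
    using J_inverse(2)[OF y] by (simp add: B_def[symmetric] vec_eq_iff matrix_matrix_mult_def mat_def)
  have JB: "(\<Sum>k\<in>UNIV. J y $ i $ k * B $ k $ l) = (if i = l then 1 else 0)" for i l
    using J_inverse(1)[OF y] by (simp add: B_def[symmetric] vec_eq_iff matrix_matrix_mult_def mat_def)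
  have product: "(\<Sum>l\<in>UNIV. J y $ k $ l * d i (\<lambda>z. X z $ l) + J' k l (axis i 1) * X y $ l)
      = (\<Sum>m\<in>UNIV. d' m (\<lambda>z. X' z $ k) * J y $ m $ i)" for i k
  proof -
    have "((\<lambda>z. \<Sum>l\<in>UNIV. J z $ k $ l * X z $ l) has_derivative
      (\<lambda>v. \<Sum>l\<in>UNIV. J y $ k $ l * frechet_derivative (\<lambda>z. X z $ l) (at y) v + J' k l v * X y $ l)) (at y)"
      by (intro has_derivative_sum has_derivative_mult J' dX[unfolded frechet_derivative_works])
    from partial_deriv_eq[OF this, of i]
    have "(\<Sum>l\<in>UNIV. J y $ k $ l * d i (\<lambda>z. X z $ l) + J' k l (axis i 1) * X y $ l)
        = partial_deriv (\<lambda>z. \<Sum>l\<in>UNIV. J z $ k $ l * X z $ l) i y"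
      by (simp add: d_def partial_deriv_def)
    also have "\<dots> = partial_deriv (\<lambda>z. X' (T z) $ k) i y"
      unfolding partial_deriv_def
      by (rule fun_cong[OF frechet_derivative_cong_local[OF S y]])
        (simp add: push[symmetric] matrix_vector_mult_def)
    also have "\<dots> = (\<Sum>m\<in>UNIV. d' m (\<lambda>z. X' z $ k) * J y $ m $ i)"
      by (rule chain[OF dX'])
    finally show ?thesis .
  qed
  \<comment> \<open>The trace of the inverse Jacobian times the derivative of \<open>J\<close>; by
    Jacobi's formula it is the logarithmic derivative of \<open>det J\<close>.\<close>
  define tr where "tr v = (\<Sum>i\<in>UNIV. \<Sum>k\<in>UNIV. B $ i $ k * J' k i v)" for v
  \<comment> \<open>Contract the product rule with the inverse Jacobian \<open>B\<close>: the
    factors \<open>J\<close> disappear and the second derivatives of \<open>T\<close> leave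
    \<open>tr\<close>.\<close>
  have 1: "(\<Sum>i\<in>UNIV. d i (\<lambda>z. X z $ i)) + (\<Sum>l\<in>UNIV. tr (axis l 1) * X y $ l)
      = (\<Sum>k\<in>UNIV. d' k (\<lambda>z. X' z $ k))"
  proof -
    have "(\<Sum>i\<in>UNIV. \<Sum>k\<in>UNIV. B $ i $ k * (\<Sum>l\<in>UNIV. J y $ k $ l * d i (\<lambda>z. X z $ l)))
        = (\<Sum>i\<in>UNIV. \<Sum>l\<in>UNIV. (\<Sum>k\<in>UNIV. B $ i $ k * J y $ k $ l) * d i (\<lambda>z. X z $ l))"
      by (simp add: sum_distrib_left sum_distrib_right mult.assoc) (subst sum.swap, rule refl)
    also have "\<dots> = (\<Sum>i\<in>UNIV. d i (\<lambda>z. X z $ i))"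
      by (simp add: BJ if_distrib[of "\<lambda>x. x * _"] cong: if_cong)
    finally have a: "(\<Sum>i\<in>UNIV. \<Sum>k\<in>UNIV. B $ i $ k * (\<Sum>l\<in>UNIV. J y $ k $ l * d i (\<lambda>z. X z $ l)))
        = (\<Sum>i\<in>UNIV. d i (\<lambda>z. X z $ i))" .
    have "(\<Sum>l\<in>UNIV. tr (axis l 1) * X y $ l) = (\<Sum>l\<in>UNIV. \<Sum>i\<in>UNIV. \<Sum>k\<in>UNIV. B $ i $ k * (J' k l (axis i 1) * X y $ l))"
    proof -
      have "(\<Sum>l\<in>UNIV. tr (axis l 1) * X y $ l) = (\<Sum>l\<in>UNIV. \<Sum>i\<in>UNIV. \<Sum>k\<in>UNIV. B $ i $ k * (J' k i (axis l 1) * X y $ l))"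
        by (simp add: tr_def sum_distrib_right mult.assoc)
      then show ?thesis
        by (simp only: J'_sym)
    qed
    also have "\<dots> = (\<Sum>i\<in>UNIV. \<Sum>k\<in>UNIV. \<Sum>l\<in>UNIV. B $ i $ k * (J' k l (axis i 1) * X y $ l))"
      by (subst sum.swap, rule sum.cong[OF refl], rule sum.swap)
    finally have b: "(\<Sum>l\<in>UNIV. tr (axis l 1) * X y $ l)
        = (\<Sum>i\<in>UNIV. \<Sum>k\<in>UNIV. B $ i $ k * (\<Sum>l\<in>UNIV. J' k l (axis i 1) * X y $ l))"
      by (simp add: sum_distrib_left)
    have "(\<Sum>i\<in>UNIV. \<Sum>k\<in>UNIV. B $ i $ k * (\<Sum>m\<in>UNIV. d' m (\<lambda>z. X' z $ k) * J y $ m $ i))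
      = (\<Sum>k\<in>UNIV. \<Sum>m\<in>UNIV. \<Sum>i\<in>UNIV. d' m (\<lambda>z. X' z $ k) * (J y $ m $ i * B $ i $ k))"
      by (simp add: sum_distrib_left mult_ac)
        (subst sum.swap, rule sum.cong[OF refl], rule sum.swap)
    also have "\<dots> = (\<Sum>k\<in>UNIV. \<Sum>m\<in>UNIV. d' m (\<lambda>z. X' z $ k) * (\<Sum>i\<in>UNIV. J y $ m $ i * B $ i $ k))"
      by (simp add: sum_distrib_left)
    also have "\<dots> = (\<Sum>k\<in>UNIV. d' k (\<lambda>z. X' z $ k))"
      by (simp add: JB if_distrib[of "\<lambda>x. _ * x"] cong: if_cong)
    finally show ?thesis
      using a b by (simp add: product[symmetric] sum.distrib distrib_left)
  qed
  \<comment> \<open>Since \<open>det G\<close> is \<open>(det J)\<^sup>2\<close> times the pulled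
    back \<open>det G'\<close>, the volume terms differ by the same \<open>tr\<close>.\<close>
  have 2: "d l (\<lambda>z. det (G z)) / (2 * det (G y)) = tr (axis l 1) + (\<Sum>m\<in>UNIV. d' m (\<lambda>z. det (G' z)) * J y $ m $ l) / (2 * det (G' (T y)))" for l
  proof -
    have dJ: "((\<lambda>z. det (J z)) has_derivative (\<lambda>v. det (J y) * tr v)) (at y)"
      unfolding tr_def by (rule has_derivative_det[OF J']) (simp add: B_def J_inverse[OF y])
    define h where "h z = det (G' z)" for z
    have "Ck_on 1 S' h"
      unfolding h_def using Ck_on_det[OF metric_open[OF metric'] metric_Ck[OF metric']] .
    then have dh: "h differentiable (at (T y))"
      using T_mem[OF y] by simp
    from differentiable_chain_at[of T y h] T_has_derivative[OF y] dh
    have "(\<lambda>z. h (T z)) differentiable (at y)"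
      by (auto simp: differentiable_def o_def)
    note has_derivative_mult[OF has_derivative_power[OF dJ, of 2] this[unfolded frechet_derivative_works]]
    then have "((\<lambda>z. det (G z)) has_derivative (\<lambda>v. (det (J y))\<^sup>2 * frechet_derivative (\<lambda>z. h (T z)) (at y) v
        + (2 * (det (J y) * tr v) * det (J y)) * h (T y))) (at y)"
      by (elim has_derivative_transform_within_open[OF _ S y, THEN has_derivative_eq_rhs])
        (auto simp: det_G h_def fun_eq_iff)
    from partial_deriv_eq[OF this, of l]
    have "d l (\<lambda>z. det (G z)) = (det (J y))\<^sup>2 * (\<Sum>m\<in>UNIV. d' m h * J y $ m $ l)
        + 2 * (det (J y))\<^sup>2 * tr (axis l 1) * h (T y)"
      using chain[OF dh, of l] by (simp add: d_def partial_deriv_def[of "\<lambda>z. h (T z)"] power2_eq_square)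
    moreover have "det (G y) = (det (J y))\<^sup>2 * h (T y)"
      by (simp add: det_G[OF y] h_def)
    moreover have "h (T y) > 0"
      unfolding h_def by (rule metric_det_pos[OF metric' T_mem[OF y]])
    ultimately have "d l (\<lambda>z. det (G z)) / (2 * det (G y)) = tr (axis l 1) + (\<Sum>m\<in>UNIV. d' m h * J y $ m $ l) / (2 * h (T y))"
      using J_inverse(3)[OF y] by (simp add: add_divide_distrib)
    then show ?thesis by (simp add: h_def[abs_def])
  qed
  have "divergence G X y = (\<Sum>i\<in>UNIV. d i (\<lambda>z. X z $ i)) + (\<Sum>l\<in>UNIV. d l (\<lambda>z. det (G z)) / (2 * det (G y)) * X y $ l)"
    by (simp add: divergence_expand[OF metric y dX] d_def sum_divide_distrib)
  also have "\<dots> = (\<Sum>k\<in>UNIV. d' k (\<lambda>z. X' z $ k))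
      + (\<Sum>l\<in>UNIV. (\<Sum>m\<in>UNIV. d' m (\<lambda>z. det (G' z)) * J y $ m $ l) / (2 * det (G' (T y))) * X y $ l)"
    unfolding 1[symmetric] 2 by (simp add: distrib_right sum.distrib)
  also have "(\<Sum>l\<in>UNIV. (\<Sum>m\<in>UNIV. d' m (\<lambda>z. det (G' z)) * J y $ m $ l) / (2 * det (G' (T y))) * X y $ l)
      = (\<Sum>m\<in>UNIV. d' m (\<lambda>z. det (G' z)) * (J y *v X y) $ m) / (2 * det (G' (T y)))"
    by (simp add: matrix_vector_mult_def sum_distrib_left sum_distrib_right sum_divide_distrib mult_ac)
      (subst sum.swap, rule refl)
  also have "(\<Sum>k\<in>UNIV. d' k (\<lambda>z. X' z $ k)) + (\<Sum>m\<in>UNIV. d' m (\<lambda>z. det (G' z)) * (J y *v X y) $ m) / (2 * det (G' (T y)))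
      = divergence G' X' (T y)"
    by (simp add: divergence_expand[OF metric' T_mem[OF y] dX'] d'_def push[OF y])
  finally show ?thesis by (simp add: X_def X'_def)
qed

end

end

section \<open>Barriers in coordinates\<close>

abbreviation coords :: "('a, 'n::finite) chart \<Rightarrow> (real ^ 'n) set" where
  "coords c \<equiv> snd c ` fst c"

lemma metric_on_subset: "metric_on U G \<Longrightarrow> open V \<Longrightarrow> V \<subseteq> U \<Longrightarrow> metric_on V G"
  unfolding metric_on_def by (meson Ck_on_subset subsetD)

context
  fixes A :: "('a::{t2_space,second_countable_topology}, 'n::finite) chart set"
    and g :: "('a, 'n) chart \<Rightarrow> real ^ 'n \<Rightarrow> real ^ 'n ^ 'n"
  assumes manifold: "riemannian_manifold A g"
begin

lemma
  assumes "c \<in> A"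
  shows open_chart: "open (fst c)" and open_coords: "open (coords c)"
    and chart_inv_left: "x \<in> fst c \<Longrightarrow> chart_inv c (snd c x) = x"
    and chart_inv_right: "y \<in> coords c \<Longrightarrow> snd c (chart_inv c y) = y"
    and chart_inv_mem: "y \<in> coords c \<Longrightarrow> chart_inv c y \<in> fst c"
    and continuous_on_chart: "continuous_on (fst c) (snd c)"
    and continuous_on_chart_inv: "continuous_on (coords c) (chart_inv c)"
proof -
  have "is_chart c"
    using manifold assms by (auto simp: riemannian_manifold_def smooth_atlas_def)
  then have o: "open (fst c)" "open (coords c)" and h: "homeomorphism (fst c) (coords c) (snd c) (chart_inv c)"
    by (auto simp: is_chart_def)
  show "open (fst c)" "open (coords c)"
    by (fact o)+
  show "continuous_on (fst c) (snd c)" "continuous_on (coords c) (chart_inv c)"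
    using h by (auto simp: homeomorphism_def)
  show "x \<in> fst c \<Longrightarrow> chart_inv c (snd c x) = x"
    "y \<in> coords c \<Longrightarrow> snd c (chart_inv c y) = y" "y \<in> coords c \<Longrightarrow> chart_inv c y \<in> fst c"
    using h by (auto simp: homeomorphism_def)
qed

lemma chart_exists: "\<exists>c\<in>A. x \<in> fst c"
  using manifold by (auto simp: riemannian_manifold_def smooth_atlas_def)

lemma metric_on_chart:
  assumes c: "c \<in> A"
  shows "metric_on (coords c) (g c)"
proof -
  have "riemannian_metric A g"
    using manifold by (simp add: riemannian_manifold_def)
  then have sm: "smooth_on (coords c) (g c)"
    and pos: "\<forall>y\<in>coords c. transpose (g c y) = g c y \<and> (\<forall>v. v \<noteq> 0 \<longrightarrow> v \<bullet> (g c y *v v) > 0)"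
    using c unfolding riemannian_metric_def by blast+
  have "Ck_on k (coords c) (g c)" for k
    using sm smooth_on_open[OF open_coords[OF c]] by blast
  then have "Ck_on k (coords c) (\<lambda>y. g c y $ i $ j)" for k i j
    by (intro Ck_on_linear_comp[OF open_coords[OF c] bounded_linear_vec_nth])
  then show ?thesis
    using pos open_coords[OF c] by (auto simp: metric_on_def)
qed

lemma open_coords_overlap:
  assumes c: "c \<in> A" and d: "d \<in> A"
  shows "open (snd c ` (fst c \<inter> fst d))"
proof -
  have "snd c ` (fst c \<inter> fst d) = coords c \<inter> chart_inv c -` fst d"
    using chart_inv_left[OF c] chart_inv_right[OF c] chart_inv_mem[OF c] by force
  then show ?thesis
    using continuous_open_preimage[OF continuous_on_chart_inv[OF c] open_coords[OF c] open_chart[OF d]] by simp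
qed

lemma coordinate_change_charts:
  assumes c: "c \<in> A" and d: "d \<in> A"
  shows "coordinate_change (snd c ` (fst c \<inter> fst d)) (coords d) (g c) (g d) (transition c d)
    (\<lambda>y. matrix (frechet_derivative (transition c d) (at y)))"
proof
  let ?S = "snd c ` (fst c \<inter> fst d)"
  show "metric_on ?S (g c)"
    by (rule metric_on_subset[OF metric_on_chart[OF c] open_coords_overlap[OF c d]]) auto
  show "metric_on (coords d) (g d)"
    by (rule metric_on_chart[OF d])
  have "smooth_on ?S (transition c d)"
    using manifold c d by (auto simp: riemannian_manifold_def smooth_atlas_def)
  then show "Ck_on 2 ?S (transition c d)"
    using smooth_on_open[OF open_coords_overlap[OF c d]] by blast
  show "transition c d ` ?S \<subseteq> coords d"
    using chart_inv_left[OF c] by (auto simp: transition_def)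
  show "g c y = transpose (matrix (frechet_derivative (transition c d) (at y))) ** g d (transition c d y) **
      matrix (frechet_derivative (transition c d) (at y))" if "y \<in> ?S" for y
    using manifold c d that unfolding riemannian_manifold_def riemannian_metric_def Let_def by blast
qed auto

lemma coord_rep_transition:
  assumes c: "c \<in> A" and d: "d \<in> A" and y: "y \<in> snd c ` (fst c \<inter> fst d)"
  shows "coord_rep c u y = coord_rep d u (transition c d y)"
  using y chart_inv_left[OF c] chart_inv_left[OF d] by (auto simp: coord_rep_def transition_def)

text \<open>Smoothness up to the end points of \<open>{a..b}\<close> means local extension. Such an
  \<open>F\<close> has two-sided time derivatives at \<open>b\<close> and continues the barrier
  beyond \<open>b\<close>.\<close>

lemma spacetime_extension:
  assumes f: "smooth_in_spacetime A a b f" and c: "c \<in> A" and y: "y \<in> coords c" and t: "t \<in> {a..b}"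
  obtains V F where "open V" "(y, t) \<in> V" "V \<subseteq> coords c \<times> UNIV" "\<And>k. Ck_on k V F"
    "\<And>z s. (z, s) \<in> V \<Longrightarrow> s \<in> {a..b} \<Longrightarrow> F (z, s) = f (chart_inv c z) s"
proof -
  have "smooth_on (coords c \<times> {a..b}) (\<lambda>(y, t). f (chart_inv c y) t)"
    using f c by (simp add: smooth_in_spacetime_def)
  moreover have "(y, t) \<in> coords c \<times> {a..b}"
    using y t by simp
  ultimately have "\<exists>V F. open V \<and> (y, t) \<in> V \<and> (\<forall>k. Ck_on k V F) \<and>
      (\<forall>q\<in>V \<inter> coords c \<times> {a..b}. F q = (\<lambda>(y, t). f (chart_inv c y) t) q)"
    unfolding smooth_on_def by (rule bspec)
  then obtain V F where V: "open V" "(y, t) \<in> V" "\<And>k. Ck_on k V F"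
    "\<forall>q\<in>V \<inter> coords c \<times> {a..b}. F q = (\<lambda>(y, t). f (chart_inv c y) t) q"
    by (elim exE conjE) (rule that, assumption+, erule spec, assumption)
  show ?thesis
  proof (rule that[of "V \<inter> coords c \<times> UNIV" F])
    show "open (V \<inter> coords c \<times> UNIV)"
      using V(1) open_coords[OF c] by (auto intro: open_Times)
    show "Ck_on k (V \<inter> coords c \<times> UNIV) F" for k
      by (rule Ck_on_subset[OF _ V(3)]) auto
    show "F (z, s) = f (chart_inv c z) s" if "(z, s) \<in> V \<inter> coords c \<times> UNIV" "s \<in> {a..b}" for z s
      using bspec[OF V(4), of "(z, s)"] that by auto
  qed (use V y in auto)
qed

lemma Ck_on_coord_rep:
  assumes f: "smooth_in_spacetime A a b f" and c: "c \<in> A" and t: "t \<in> {a..b}"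
  shows "Ck_on k (coords c) (coord_rep c (\<lambda>z. f z t))"
proof (rule Ck_on_local[OF open_coords[OF c]])
  fix y assume y: "y \<in> coords c"
  obtain V F where V: "open V" "(y, t) \<in> V" "\<And>k. Ck_on k V F"
    "\<And>z s. (z, s) \<in> V \<Longrightarrow> s \<in> {a..b} \<Longrightarrow> F (z, s) = f (chart_inv c z) s"
    using spacetime_extension[OF f c y t] by metis
  have "Ck_on k {z. (z, t) \<in> V} (coord_rep c (\<lambda>z. f z t))"
    by (rule Ck_on_cong[OF Ck_on_slice(1)[OF V(1) V(3)] _ Ck_on_slice(2)[OF V(1) V(3)]]) (use V(4) t in \<open>auto simp: coord_rep_def\<close>)
  then show "\<exists>V. open V \<and> y \<in> V \<and> Ck_on k V (coord_rep c (\<lambda>z. f z t))"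
    using Ck_on_slice(1)[OF V(1) V(3)] V(2) by blast
qed

lemma spatial_grad_eq_0_iff:
  assumes "c \<in> A" "x \<in> fst c"
  shows "spatial_grad g c f x t = 0 \<longleftrightarrow> covec (coord_rep c (\<lambda>z. f z t)) (snd c x) = 0"
  unfolding spatial_grad_def using grad_eq_0_iff[OF metric_on_chart[OF assms(1)]] assms(2) by blast

lemma barrier_Phi_eq:
  assumes f: "smooth_in_spacetime A a b f" and c: "c \<in> A" "x \<in> fst c" and t: "t \<in> {a..b}"
    and nz: "covec (coord_rep c (\<lambda>z. f z t)) (snd c x) \<noteq> 0"
  shows "barrier_Phi g c a b f x t = - vector_derivative (f x) (at t within {a..b})
      / sqrt (conorm_sq (g c) (snd c x) (covec (coord_rep c (\<lambda>z. f z t)) (snd c x)))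
      + curv (g c) (snd c x) (covec (coord_rep c (\<lambda>z. f z t)) (snd c x)) (hess (coord_rep c (\<lambda>z. f z t)) (snd c x))"
proof -
  have y: "snd c x \<in> coords c" using c by auto
  note m = metric_on_chart[OF c(1)]
  show ?thesis
    unfolding barrier_Phi_def normal_velocity_def mean_curv_def spatial_grad_def metric_norm_grad[OF m y]
      divergence_unit_normal[OF m open_coords[OF c(1)] order_refl y Ck_on_coord_rep[OF f c(1) t] nz]
    by simp
qed

text \<open>Needed because the touching argument works in a single chart. Gradient length and
  divergence of the unit normal are invariant, and the time derivative involves no
  coordinates.\<close>

lemma barrier_Phi_chart:
  assumes f: "smooth_in_spacetime A a b f" and c: "c \<in> A" "x \<in> fst c" and d: "d \<in> A" "x \<in> fst d"
    and t: "t \<in> {a..b}" and nz: "covec (coord_rep c (\<lambda>z. f z t)) (snd c x) \<noteq> 0"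
  shows "covec (coord_rep d (\<lambda>z. f z t)) (snd d x) \<noteq> 0"
    and "barrier_Phi g c a b f x t = barrier_Phi g d a b f x t"
proof -
  define J where "J y = matrix (frechet_derivative (transition c d) (at y))" for y
  interpret coordinate_change "snd c ` (fst c \<inter> fst d)" "coords d" "g c" "g d" "transition c d" J
    unfolding J_def by (rule coordinate_change_charts[OF c(1) d(1)])
  define uc where "uc = coord_rep c (\<lambda>z. f z t)"
  define ud where "ud = coord_rep d (\<lambda>z. f z t)"
  have ud: "Ck_on 2 (coords d) ud"
    unfolding ud_def by (rule Ck_on_coord_rep[OF f d(1) t])
  have uc: "uc y = ud (transition c d y)" if "y \<in> snd c ` (fst c \<inter> fst d)" for y
    unfolding uc_def ud_def by (rule coord_rep_transition[OF c(1) d(1) that])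
  have x: "snd c x \<in> snd c ` (fst c \<inter> fst d)" and x': "snd c x \<in> coords c" and Tx: "transition c d (snd c x) = snd d x"
    using c d chart_inv_left[OF c(1)] by (auto simp: transition_def)
  note cv = covec_pullback[OF ud uc x, unfolded Tx]
  have nzc: "covec uc (snd c x) \<noteq> 0" using nz by (simp add: uc_def)
  then show nzd: "covec (coord_rep d (\<lambda>z. f z t)) (snd d x) \<noteq> 0"
    using cv by (auto simp: ud_def)
  have div: "curv (g c) (snd c x) (covec uc (snd c x)) (hess uc (snd c x))
      = curv (g d) (snd d x) (covec ud (snd d x)) (hess ud (snd d x))"
  proof -
    have "divergence (g c) (unit_normal (g c) uc) (snd c x) = divergence (g d) (unit_normal (g d) ud) (snd d x)"
      using divergence_unit_normal_pullback[OF ud uc x nzc] Tx by simp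
    then show ?thesis
      using divergence_unit_normal[OF metric_on_chart[OF c(1)] open_coords[OF c(1)] order_refl x'
            Ck_on_coord_rep[OF f c(1) t, folded uc_def] nzc]
        divergence_unit_normal[OF metric_on_chart[OF d(1)] open_coords[OF d(1)] order_refl _ ud, of "snd d x"]
        nzd d by (simp add: ud_def)
  qed
  have "conorm_sq (g c) (snd c x) (covec uc (snd c x)) = conorm_sq (g d) (snd d x) (covec ud (snd d x))"
    using conorm_sq_eq[OF x cv] Tx by simp
  with div show "barrier_Phi g c a b f x t = barrier_Phi g d a b f x t"
    unfolding barrier_Phi_eq[OF f c t nz] barrier_Phi_eq[OF f d t nzd]
    by (simp add: uc_def[symmetric] ud_def[symmetric])
qed

text \<open>At a fixed time in \<open>{a..b}\<close> the slices of \<open>F\<close> and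
  \<open>f\<close> agree near the point. For the time derivative, derivatives within a nondegenerate
  interval are unique, so the two-sided derivative of \<open>F\<close> is the one-sided one of
  \<open>f\<close>.\<close>

lemma
  assumes c: "c \<in> A" "x \<in> fst c" and V: "open V" "(snd c x, t) \<in> V" and F: "Ck_on (Suc k) V F"
    and eq: "\<And>z s. (z, s) \<in> V \<Longrightarrow> s \<in> {a..b} \<Longrightarrow> F (z, s) = f (chart_inv c z) s"
    and t: "t \<in> {a..b}" "a < b"
  shows covec_extension: "covec (coord_rep c (\<lambda>z. f z t)) (snd c x) = covec (\<lambda>z. F (z, t)) (snd c x)"
    and hess_extension: "hess (coord_rep c (\<lambda>z. f z t)) (snd c x) = hess (\<lambda>z. F (z, t)) (snd c x)"
    and vector_derivative_extension:
      "vector_derivative (f x) (at t within {a..b}) = frechet_derivative F (at (snd c x, t)) (0, 1)"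
proof -
  have S: "open {z. (z, t) \<in> V}" "snd c x \<in> {z. (z, t) \<in> V}"
    using Ck_on_slice(1)[OF V(1) F] V(2) by auto
  have eq': "coord_rep c (\<lambda>z. f z t) z = F (z, t)" if "z \<in> {z. (z, t) \<in> V}" for z
    using that eq[of z t] t by (simp add: coord_rep_def)
  show "covec (coord_rep c (\<lambda>z. f z t)) (snd c x) = covec (\<lambda>z. F (z, t)) (snd c x)"
    by (rule covec_cong[OF S eq'])
  show "hess (coord_rep c (\<lambda>z. f z t)) (snd c x) = hess (\<lambda>z. F (z, t)) (snd c x)"
    by (rule hess_cong[OF S eq'])
  let ?D = "frechet_derivative F (at (snd c x, t))"
  have D: "(F has_derivative ?D) (at (snd c x, t))"
    by (rule Ck_on_has_derivative[OF F V(2)])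
  have "((\<lambda>s. (snd c x, s)) has_derivative (\<lambda>h. (0, h))) (at t within {a..b})"
    by (auto intro!: derivative_eq_intros)
  from has_derivative_compose[OF this D]
  have "((\<lambda>s. F (snd c x, s)) has_derivative (\<lambda>h. ?D (0, h))) (at t within {a..b})" .
  moreover have "(\<lambda>h. ?D (0, h)) = (\<lambda>h. h *\<^sub>R ?D (0, 1))"
    by (rule ext, rule trans[OF _ linear_cmul[OF has_derivative_linear[OF D]]]) simp
  ultimately have vd: "((\<lambda>s. F (snd c x, s)) has_vector_derivative ?D (0, 1)) (at t within {a..b})"
    by (simp only: has_vector_derivative_def)
  have "open {s. (snd c x, s) \<in> V}"
  proof -
    have "{s. (snd c x, s) \<in> V} = (\<lambda>s. (snd c x, s)) -` V" by auto
    then show ?thesis using V(1) by (auto intro!: open_vimage continuous_intros)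
  qed
  then obtain e where e: "e > 0" "\<And>s. dist s t < e \<Longrightarrow> (snd c x, s) \<in> V"
    using V(2) unfolding open_dist by blast
  have "(f x has_vector_derivative ?D (0, 1)) (at t within {a..b})"
    by (rule has_vector_derivative_transform_within[OF vd e(1) t(1)])
      (use e eq chart_inv_left[OF c] in auto)
  then show "vector_derivative (f x) (at t within {a..b}) = ?D (0, 1)"
    using vector_derivative_within_cbox[of a b t] t by simp
qed

lemma barrier_Phi_level_speed:
  assumes f: "smooth_in_spacetime A a b f"
    and c: "c \<in> A" "x \<in> fst c" and V: "open V" "(snd c x, t) \<in> V" and F: "Ck_on (Suc k) V F"
    and eq: "\<And>z s. (z, s) \<in> V \<Longrightarrow> s \<in> {a..b} \<Longrightarrow> F (z, s) = f (chart_inv c z) s"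
    and t: "t \<in> {a..b}" "a < b" and nz: "covec (\<lambda>z. F (z, t)) (snd c x) \<noteq> 0"
  shows "barrier_Phi g c a b f x t = level_speed (g c) F (snd c x) t"
proof -
  have ext: "covec (coord_rep c (\<lambda>z. f z t)) (snd c x) = covec (\<lambda>z. F (z, t)) (snd c x)"
    "hess (coord_rep c (\<lambda>z. f z t)) (snd c x) = hess (\<lambda>z. F (z, t)) (snd c x)"
    "vector_derivative (f x) (at t within {a..b}) = frechet_derivative F (at (snd c x, t)) (0, 1)"
    by (rule covec_extension[OF c V F _ t] hess_extension[OF c V F _ t] vector_derivative_extension[OF c V F _ t];
      erule (1) eq)+
  have "covec (coord_rep c (\<lambda>z. f z t)) (snd c x) \<noteq> 0"
    using nz unfolding ext .
  from barrier_Phi_eq[OF f c t(1) this] show ?thesis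
    unfolding ext level_speed_def .
qed

end

section \<open>Critical points and quadratic perturbations\<close>

lemma covec_local_extremum:
  assumes "u differentiable (at y)" "open S" "y \<in> S" "(\<forall>z\<in>S. u y \<le> u z) \<or> (\<forall>z\<in>S. u z \<le> u y)"
  shows "covec u y = 0"
proof -
  have D: "(u has_derivative frechet_derivative u (at y)) (at y)"
    using assms(1) by (simp add: frechet_derivative_works)
  have S: "\<forall>\<^sub>F z in at y. z \<in> S"
    using assms(2,3) by (rule eventually_at_in_open')
  have "frechet_derivative u (at y) = (\<lambda>h. 0)"
    using assms(4)
  proof
    assume "\<forall>z\<in>S. u y \<le> u z"
    then have "\<forall>\<^sub>F z in at y. u y \<le> u z"
      using S by (auto elim: eventually_mono)
    then show ?thesis by (rule has_derivative_local_min[OF D])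
  next
    assume "\<forall>z\<in>S. u z \<le> u y"
    then have "\<forall>\<^sub>F z in at y. u z \<le> u y"
      using S by (auto elim: eventually_mono)
    then show ?thesis by (rule has_derivative_local_max[OF D])
  qed
  then show ?thesis
    by (simp add: covec_def partial_deriv_def vec_eq_iff)
qed

text \<open>With \<open>F = 0\<close> these functions describe shrinking coordinate balls, with an
  extension of a barrier function they describe the enlarged barrier; the derivatives are computed
  once for both.\<close>

lemma
  fixes F :: "(real ^ 'n::finite) \<times> real \<Rightarrow> real" and \<eta> \<kappa> m :: real
    and y0 :: "real ^ 'n"
  assumes V: "open V" and F: "Ck_on 2 V F"
  defines "w \<equiv> (\<lambda>(z, t). F (z, t) + \<eta> * ((z - y0) \<bullet> (z - y0)) + \<kappa> * t + m)"
  shows Ck_on_perturbed: "Ck_on 2 V w"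
    and covec_perturbed: "(z, t) \<in> V \<Longrightarrow> covec (\<lambda>z. w (z, t)) z = covec (\<lambda>z. F (z, t)) z + (2 * \<eta>) *\<^sub>R (z - y0)"
    and hess_perturbed: "(z, t) \<in> V \<Longrightarrow> hess (\<lambda>z. w (z, t)) z = hess (\<lambda>z. F (z, t)) z + (2 * \<eta>) *\<^sub>R mat 1"
    and time_derivative_perturbed:
      "(z, t) \<in> V \<Longrightarrow> frechet_derivative w (at (z, t)) (0, 1) = frechet_derivative F (at (z, t)) (0, 1) + \<kappa>"
proof -
  have "Ck_on 2 V (\<lambda>q. fst q + (- y0))"
    by (intro Ck_on_add Ck_on_const Ck_on_bounded_linear[OF V bounded_linear_fst] V)
  from Ck_on_bilinear[OF V bounded_bilinear_inner this this]
  have sq: "Ck_on 2 V (\<lambda>q. (fst q + (- y0)) \<bullet> (fst q + (- y0)))" .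
  have "Ck_on 2 V (\<lambda>q. F q + \<eta> * ((fst q + (- y0)) \<bullet> (fst q + (- y0))) + \<kappa> * snd q + m)"
    by (intro Ck_on_add Ck_on_mult Ck_on_const sq Ck_on_bounded_linear[OF V bounded_linear_snd] V F)
  then show "Ck_on 2 V w"
    by (simp add: w_def case_prod_unfold)
  have DF: "(F has_derivative frechet_derivative F (at q)) (at q)" if "q \<in> V" for q
    using Ck_on_has_derivative[of 1 V F] F that by (simp add: numeral_2_eq_2)
  show "frechet_derivative w (at (z, t)) (0, 1) = frechet_derivative F (at (z, t)) (0, 1) + \<kappa>" if "(z, t) \<in> V" for z t
  proof -
    have "((\<lambda>q. F q + \<eta> * ((fst q - y0) \<bullet> (fst q - y0)) + \<kappa> * snd q + m) has_derivative
      (\<lambda>v. frechet_derivative F (at (z, t)) v + \<eta> * ((z - y0) \<bullet> fst v + fst v \<bullet> (z - y0)) + \<kappa> * snd v)) (at (z, t))"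
      by (rule derivative_eq_intros DF[OF that] refl | simp)+
    then have "(w has_derivative
      (\<lambda>v. frechet_derivative F (at (z, t)) v + \<eta> * ((z - y0) \<bullet> fst v + fst v \<bullet> (z - y0)) + \<kappa> * snd v)) (at (z, t))"
      by (simp add: w_def case_prod_unfold)
    from fun_cong[OF frechet_derivative_at[OF this], of "(0, 1)"] show ?thesis
      by simp
  qed
  have partial: "partial_deriv (\<lambda>z. w (z, t)) i z = partial_deriv (\<lambda>z. F (z, t)) i z + 2 * \<eta> * (z - y0) $ i"
    if "(z, t) \<in> V" for z t i
  proof -
    have "(\<lambda>z. F (z, t)) differentiable (at z)"
      using Ck_on_slice(2)[OF V F, of t] that by (simp add: numeral_2_eq_2)
    then have "((\<lambda>z. F (z, t)) has_derivative frechet_derivative (\<lambda>z. F (z, t)) (at z)) (at z)"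
      by (simp add: frechet_derivative_works)
    then have "((\<lambda>z. F (z, t) + \<eta> * ((z - y0) \<bullet> (z - y0)) + \<kappa> * t + m) has_derivative
      (\<lambda>v. frechet_derivative (\<lambda>z. F (z, t)) (at z) v + \<eta> * ((z - y0) \<bullet> v + v \<bullet> (z - y0)))) (at z)"
      by (auto intro!: derivative_eq_intros)
    from partial_deriv_eq[OF this] show ?thesis
      by (simp add: w_def partial_deriv_def inner_axis inner_axis')
  qed
  then show "covec (\<lambda>z. w (z, t)) z = covec (\<lambda>z. F (z, t)) z + (2 * \<eta>) *\<^sub>R (z - y0)" if "(z, t) \<in> V" for z t
    using that by (simp add: covec_def vec_eq_iff)
  show "hess (\<lambda>z. w (z, t)) z = hess (\<lambda>z. F (z, t)) z + (2 * \<eta>) *\<^sub>R mat 1" if "(z, t) \<in> V" for z t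
  proof -
    have "hess (\<lambda>z. w (z, t)) z $ i $ j = hess (\<lambda>z. F (z, t)) z $ i $ j + 2 * \<eta> * (if i = j then 1 else 0)" for i j
    proof -
      have S: "open {z. (z, t) \<in> V}" "z \<in> {z. (z, t) \<in> V}"
        using Ck_on_slice(1)[OF V F] that by auto
      have "(\<lambda>z. partial_deriv (\<lambda>z. F (z, t)) j z) differentiable (at z)"
        using Ck_on_slice(2)[OF V F, of t] that by (simp add: numeral_2_eq_2 partial_deriv_def)
      then have "((\<lambda>z. partial_deriv (\<lambda>z. F (z, t)) j z) has_derivative
          frechet_derivative (\<lambda>z. partial_deriv (\<lambda>z. F (z, t)) j z) (at z)) (at z)"
        by (simp only: frechet_derivative_works)
      moreover have "((\<lambda>z. 2 * \<eta> * (z - y0) $ j) has_derivative (\<lambda>v. 2 * \<eta> * v $ j)) (at z)"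
        by (intro has_derivative_mult_right has_derivative_vec_nth_fun) (auto intro!: derivative_eq_intros)
      ultimately have "((\<lambda>z. partial_deriv (\<lambda>z. F (z, t)) j z + 2 * \<eta> * (z - y0) $ j) has_derivative
          (\<lambda>v. frechet_derivative (\<lambda>z. partial_deriv (\<lambda>z. F (z, t)) j z) (at z) v + 2 * \<eta> * v $ j)) (at z)"
        by (rule has_derivative_add)
      then have "((\<lambda>z. partial_deriv (\<lambda>z. w (z, t)) j z) has_derivative
          (\<lambda>v. frechet_derivative (\<lambda>z. partial_deriv (\<lambda>z. F (z, t)) j z) (at z) v + 2 * \<eta> * v $ j)) (at z)"
        by (rule has_derivative_transform_within_open[OF _ S]) (simp add: partial)
      from partial_deriv_eq[OF this, of i]
      show ?thesis
        by (simp add: hess_def partial_deriv_def[of "\<lambda>z. partial_deriv _ _ z"] axis_def)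
    qed
    then show ?thesis by (simp add: vec_eq_iff mat_def)
  qed
qed

section \<open>Subsolutions are contained in the biggest flow\<close>

lemma weak_set_flowD:
  assumes "weak_set_flow A g Z" "0 \<le> a" "compact_barrier A g a b K f"
    "\<And>t. t \<in> {a..<b} \<Longrightarrow> K t \<inter> time_slice Z t = {}" "p \<in> K b" "(p, b) \<in> Z"
  shows "p \<in> frontier (K b)" "c \<in> A \<Longrightarrow> p \<in> fst c \<Longrightarrow> barrier_Phi g c a b f p b \<ge> 0"
proof -
  have "\<forall>a b K f p.
        0 \<le> a \<and> compact_barrier A g a b K f \<and>
        (\<forall>t\<in>{a..<b}. K t \<inter> time_slice Z t = {}) \<and>
        p \<in> K b \<inter> time_slice Z b \<longrightarrow>
        p \<in> frontier (K b) \<and> (\<forall>c\<in>A. p \<in> fst c \<longrightarrow> barrier_Phi g c a b f p b \<ge> 0)"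
    using assms(1) unfolding weak_set_flow_def by (elim conjE)
  note this[rule_format, of a b K f p]
  moreover have "0 \<le> a \<and> compact_barrier A g a b K f \<and>
        (\<forall>t\<in>{a..<b}. K t \<inter> time_slice Z t = {}) \<and> p \<in> K b \<inter> time_slice Z b"
    using assms by (auto simp: time_slice_def)
  ultimately show "p \<in> frontier (K b)" "c \<in> A \<Longrightarrow> p \<in> fst c \<Longrightarrow> barrier_Phi g c a b f p b \<ge> 0"
    by blast+
qed

context
  fixes A :: "('a::{t2_space,second_countable_topology}, 'n::finite) chart set"
    and g :: "('a, 'n) chart \<Rightarrow> real ^ 'n \<Rightarrow> real ^ 'n ^ 'n"
  assumes manifold: "riemannian_manifold A g"
begin

lemma barrier_covec_nz:
  assumes "smooth_barrier A g a b K f" "t \<in> {a..b}" "f x t = 0" "c \<in> A" "x \<in> fst c"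
  shows "covec (coord_rep c (\<lambda>z. f z t)) (snd c x) \<noteq> 0"
proof -
  have "spatial_grad g c f x t \<noteq> 0"
    using assms unfolding smooth_barrier_def by blast
  then show ?thesis
    by (simp add: spatial_grad_eq_0_iff[OF manifold assms(4,5)])
qed

text \<open>At an interior point of \<open>K t\<close> the slice of \<open>f\<close> would have a
  local maximum, against its nonvanishing gradient.\<close>

lemma barrier_frontier:
  assumes bar: "smooth_barrier A g a b K f" and t: "t \<in> {a..b}" and x: "f x t = 0"
  shows "x \<in> frontier (K t)"
proof -
  obtain c where c: "c \<in> A" "x \<in> fst c" using chart_exists[OF manifold] by blast
  have K: "K t = {x. f x t \<le> 0}" and sm: "smooth_in_spacetime A a b f"
    using bar t by (auto simp: smooth_barrier_def)
  define u where "u = coord_rep c (\<lambda>z. f z t)"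
  have y: "snd c x \<in> coords c" using c by auto
  have ux: "u (snd c x) = 0"
    using x chart_inv_left[OF manifold c] by (simp add: u_def coord_rep_def)
  have "x \<notin> interior (K t)"
  proof
    assume "x \<in> interior (K t)"
    then have "snd c x \<in> coords c \<inter> chart_inv c -` interior (K t)"
      using y chart_inv_left[OF manifold c] by simp
    moreover have "open (coords c \<inter> chart_inv c -` interior (K t))"
      by (rule continuous_open_preimage[OF continuous_on_chart_inv[OF manifold c(1)] open_coords[OF manifold c(1)]]) simp
    moreover have "u z \<le> u (snd c x)" if "z \<in> coords c \<inter> chart_inv c -` interior (K t)" for z
    proof -
      have "chart_inv c z \<in> K t"
        using that interior_subset[of "K t"] by blast
      then show ?thesis
        unfolding ux by (simp add: K u_def coord_rep_def)
    qed
    moreover have "u differentiable (at (snd c x))"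
      using Ck_on_coord_rep[OF manifold sm c(1) t, of 1] c(2) by (simp add: u_def)
    ultimately have "covec u (snd c x) = 0"
      using covec_local_extremum by blast
    then show False
      using barrier_covec_nz[OF bar t x c] by (simp add: u_def)
  qed
  moreover have "x \<in> K t" using K x by simp
  ultimately show ?thesis
    using closure_subset by (auto simp: frontier_def)
qed

context
  fixes C :: "'a set" and \<C> :: "('a \<times> real) set"
  assumes biggest: "biggest_flow A g C \<C>"
begin

lemma flow: "weak_set_flow A g \<C>" and flow_start: "time_slice \<C> 0 = C"
  and flow_closed: "closed \<C>" and flow_nonneg: "(x, t) \<in> \<C> \<Longrightarrow> t \<ge> 0"
  using biggest by (auto simp: biggest_flow_def weak_set_flow_def)

lemma flow_maximal:
  assumes "weak_set_flow A g Z" "time_slice Z 0 \<subseteq> C" "(x, t) \<in> Z"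
  shows "(x, t) \<in> \<C>"
proof -
  have "t \<ge> 0"
    using assms(1,3) unfolding weak_set_flow_def by auto
  then have "time_slice Z t \<subseteq> time_slice \<C> t"
    using biggest assms(1,2) by (simp add: biggest_flow_def)
  then show ?thesis using assms(3) by (auto simp: time_slice_def)
qed

text \<open>The union of \<open>\<C>\<close> with the given region is again a weak set flow: a barrier touching the
  region outside \<open>\<C>\<close> touches a level set of \<open>w\<close> from outside, so \<open>touching_level_speed\<close> applies.\<close>

lemma subsolution_in_flow:
  assumes c: "c \<in> A" and ball: "cball y0 \<rho> \<subseteq> coords c" and s1: "0 \<le> s1"
    and V: "open V" "cball y0 \<rho> \<times> {s1..s2} \<subseteq> V" and w: "Ck_on 2 V w"
    and init: "\<And>z. z \<in> cball y0 \<rho> \<Longrightarrow> w (z, s1) \<le> 0 \<Longrightarrow> (chart_inv c z, s1) \<in> \<C>"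
    and lateral: "\<And>z t. dist y0 z = \<rho> \<Longrightarrow> t \<in> {s1..s2} \<Longrightarrow> w (z, t) \<le> 0 \<Longrightarrow> (chart_inv c z, t) \<in> \<C>"
    and sub: "\<And>z t. z \<in> cball y0 \<rho> \<Longrightarrow> t \<in> {s1..s2} \<Longrightarrow> w (z, t) = 0 \<Longrightarrow>
        covec (\<lambda>z. w (z, t)) z \<noteq> 0 \<and> level_speed (g c) w z t \<le> 0"
    and z: "z \<in> cball y0 \<rho>" "t \<in> {s1..s2}" "w (z, t) \<le> 0"
  shows "(chart_inv c z, t) \<in> \<C>"
proof -
  define P where "P = {q \<in> cball y0 \<rho> \<times> {s1..s2}. w q \<le> 0}"
  define W where "W = (\<lambda>(z, t). (chart_inv c z, t)) ` P"
  have "closed P"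
    unfolding P_def
    by (intro continuous_on_closed_Collect_le continuous_on_const continuous_on_subset[OF Ck_on_continuous_on[OF w]] V
        closed_Times closed_cball closed_atLeastAtMost)
  moreover have "P = (cball y0 \<rho> \<times> {s1..s2}) \<inter> P"
    by (auto simp: P_def)
  ultimately have "compact P"
    using compact_Int_closed[of "cball y0 \<rho> \<times> {s1..s2}" P] compact_Times[OF compact_cball compact_Icc] by metis
  moreover have "continuous_on P (\<lambda>(z, t). (chart_inv c z, t))"
  proof -
    have "continuous_on P (\<lambda>q. chart_inv c (fst q))"
      by (rule continuous_on_compose2[OF continuous_on_chart_inv[OF manifold c]])
        (use ball in \<open>auto simp: P_def intro!: continuous_intros\<close>)
    then show ?thesis
      by (auto simp: case_prod_beta intro!: continuous_intros)
  qed
  ultimately have "compact W"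
    unfolding W_def by (intro compact_continuous_image)
  then have Wcl: "closed W" by (rule compact_imp_closed)
  have WI: "(chart_inv c z, t) \<in> W" if "z \<in> cball y0 \<rho>" "t \<in> {s1..s2}" "w (z, t) \<le> 0" for z t
    using that by (force simp: W_def P_def)
  have "weak_set_flow A g (\<C> \<union> W)"
    unfolding weak_set_flow_def
  proof (rule conjI[OF _ conjI], goal_cases)
    case 1
    show ?case
      using flow_nonneg s1 by (auto simp: W_def P_def)
  next
    case 2
    show ?case
      using flow_closed Wcl by (rule closed_Un)
  next
    case 3
    show ?case
    proof (intro allI impI)
      fix a b K f p
      assume "0 \<le> a \<and> compact_barrier A g a b K f \<and>
          (\<forall>t\<in>{a..<b}. K t \<inter> time_slice (\<C> \<union> W) t = {}) \<and> p \<in> K b \<inter> time_slice (\<C> \<union> W) b"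
      then have a: "0 \<le> a" and comp: "compact_barrier A g a b K f"
        and disj: "\<And>t. t \<in> {a..<b} \<Longrightarrow> K t \<inter> time_slice (\<C> \<union> W) t = {}"
        and pK: "p \<in> K b" and pZ: "(p, b) \<in> \<C> \<union> W"
        by (auto simp: time_slice_def)
      have bar: "smooth_barrier A g a b K f" and sm: "smooth_in_spacetime A a b f" and ab: "a < b"
        and K: "\<And>t. t \<in> {a..b} \<Longrightarrow> K t = {x. f x t \<le> 0}"
        using comp by (auto simp: compact_barrier_def smooth_barrier_def)
      show "p \<in> frontier (K b) \<and> (\<forall>c\<in>A. p \<in> fst c \<longrightarrow> 0 \<le> barrier_Phi g c a b f p b)"
      proof (cases "(p, b) \<in> \<C>")
        case True
        have "K t \<inter> time_slice \<C> t = {}" if "t \<in> {a..<b}" for t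
          using disj[OF that] by (auto simp: time_slice_def)
        from weak_set_flowD[OF flow a comp this pK True] show ?thesis by blast
      next
        case False
        with pZ obtain z where pz: "p = chart_inv c z" "z \<in> cball y0 \<rho>" "b \<in> {s1..s2}" "w (z, b) \<le> 0"
          by (auto simp: W_def P_def)
        \<comment> \<open>Bottom and lateral side of the region lie in \<open>\<C>\<close> already,
          so a contact point outside \<open>\<C>\<close> is in the open cylinder and after the
          initial time.\<close>
        have "b \<noteq> s1" "dist y0 z \<noteq> \<rho>"
          using init[of z] lateral[of z b] pz False by auto
        then have b: "s1 < b" "b \<le> s2" and zb: "z \<in> ball y0 \<rho>"
          using pz by auto
        have zc: "z \<in> coords c" using pz ball by blast
        have pc: "p \<in> fst c" "snd c p = z"
          using chart_inv_mem[OF manifold c zc] chart_inv_right[OF manifold c zc] pz by auto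
        have bab: "b \<in> {a..b}" using ab by simp
        obtain V2 F where V2: "open V2" "(z, b) \<in> V2" "V2 \<subseteq> coords c \<times> UNIV" "\<And>k. Ck_on k V2 F"
          and F: "\<And>z s. (z, s) \<in> V2 \<Longrightarrow> s \<in> {a..b} \<Longrightarrow> F (z, s) = f (chart_inv c z) s"
          by (rule spacetime_extension[OF manifold sm c zc bab]) (rule that)
        \<comment> \<open>Earlier times in \<open>Q\<close> belong to the life spans of both the
          barrier and the region, so their disjointness can be used there.\<close>
        define Q where "Q = V \<inter> V2 \<inter> ball y0 \<rho> \<times> {max a s1<..}"
        have Q: "open Q" "(z, b) \<in> Q"
          using V V2 zb b ab pz by (auto simp: Q_def intro!: open_Int open_Times)
        have wQ: "Ck_on 2 Q w" and FQ: "Ck_on 2 Q F"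
          by (rule Ck_on_subset[OF _ w] Ck_on_subset[OF _ V2(4)], auto simp: Q_def)+
        have Ff: "F (y, t) = f (chart_inv c y) t" if "(y, t) \<in> Q" "t \<le> b" for y t
          using that F by (auto simp: Q_def)
        have early: "F (y, t) > 0" if "(y, t) \<in> Q" "t < b" "w (y, t) \<le> 0" for y t
        proof -
          have "t \<in> {a..<b}" "(chart_inv c y, t) \<in> W"
            using that b WI[of y t] by (auto simp: Q_def)
          then have "chart_inv c y \<notin> K t"
            using disj[of t] by (auto simp: time_slice_def)
          then show ?thesis
            using K[of t] \<open>t \<in> {a..<b}\<close> Ff[OF that(1)] by auto
        qed
        have cont: "continuous_on Q w" "continuous_on Q F"
          using wQ FQ Ck_on_continuous_on by blast+
        \<comment> \<open>Disjointness holds before time \<open>b\<close> only, but two strict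
          inequalities at time \<open>b\<close> would persist to slightly earlier times.\<close>
        have sep: "F (y, t) \<ge> 0 \<or> w (y, t) \<ge> 0" if yt: "(y, t) \<in> Q" "t \<le> b" for y t
        proof (rule ccontr)
          assume neg: "\<not> (F (y, t) \<ge> 0 \<or> w (y, t) \<ge> 0)"
          define N where "N = (Q \<inter> w -` {..<0}) \<inter> (Q \<inter> F -` {..<0})"
          have "open N"
            unfolding N_def using cont Q(1) by (intro open_Int continuous_open_preimage) auto
          then have "open ((\<lambda>s. (y, s)) -` N)"
            by (intro open_vimage continuous_intros)
          then have "open {s. (y, s) \<in> N}"
            by (simp add: vimage_def)
          moreover have "t \<in> {s. (y, s) \<in> N}"
            using yt neg by (auto simp: N_def)
          ultimately obtain e where e: "e > 0" "cball t e \<subseteq> {s. (y, s) \<in> N}"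
            by (auto simp: open_contains_cball)
          have "t - e \<in> cball t e" using e(1) by (simp add: dist_real_def)
          then have "(y, t - e) \<in> N" using e(2) by blast
          then show False
            using early[of y "t - e"] yt e(1) by (auto simp: N_def)
        qed
        have slice: "open {y. (y, b) \<in> Q \<and> h (y, b) < 0}" if "continuous_on Q h" for h :: "(real ^ 'n) \<times> real \<Rightarrow> real"
        proof -
          have "open (Q \<inter> h -` {..<0})"
            using that Q(1) by (intro continuous_open_preimage) auto
          then have "open ((\<lambda>y. (y, b)) -` (Q \<inter> h -` {..<0}))"
            by (intro open_vimage continuous_intros)
          then show ?thesis
            by (auto simp: vimage_def Int_def)
        qed
        have wd: "(\<lambda>y. w (y, b)) differentiable (at z)" and Fd: "(\<lambda>y. F (y, b)) differentiable (at z)"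
          using Ck_on_slice(2)[OF Q(1) wQ, of b] Ck_on_slice(2)[OF Q(1) FQ, of b] Q(2) by (auto simp: numeral_2_eq_2)
        have Fz: "F (z, b) \<le> 0"
          using pK K[OF bab] Ff[OF Q(2)] pz(1) by simp
        \<comment> \<open>If one of \<open>F\<close> and \<open>w\<close> were negative at the
          contact point, the other would vanish there with a local minimum of its time slice,
          against its nonvanishing gradient.\<close>
        have F0: "F (z, b) = 0"
        proof (rule ccontr)
          assume "F (z, b) \<noteq> 0"
          with Fz have neg: "F (z, b) < 0" by simp
          then have w0: "w (z, b) = 0" using sep[OF Q(2)] pz by auto
          have "covec (\<lambda>y. w (y, b)) z = 0"
            by (rule covec_local_extremum[OF wd slice[OF cont(2)]]) (use neg Q(2) sep w0 in force)+
          then show False using sub[OF pz(2,3) w0] by simp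
        qed
        have nz: "covec (\<lambda>y. F (y, b)) z \<noteq> 0"
        proof -
          have "f p b = 0" using F0 Ff[OF Q(2)] pz(1) by simp
          from barrier_covec_nz[OF bar bab this c pc(1)]
          have "covec (coord_rep c (\<lambda>y. f y b)) (snd c p) \<noteq> 0" .
          also have "covec (coord_rep c (\<lambda>y. f y b)) (snd c p) = covec (\<lambda>y. F (y, b)) (snd c p)"
            by (rule covec_extension[OF manifold c pc(1) V2(1) _ V2(4) _ bab ab]) (use V2 pc F in auto)
          finally show ?thesis by (simp add: pc(2))
        qed
        have w0: "w (z, b) = 0"
        proof (rule ccontr)
          assume "w (z, b) \<noteq> 0"
          with pz have neg: "w (z, b) < 0" by simp
          have "covec (\<lambda>y. F (y, b)) z = 0"
            by (rule covec_local_extremum[OF Fd slice[OF cont(1)]]) (use neg Q(2) sep F0 in force)+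
          then show False using nz by simp
        qed
        have "level_speed (g c) w z b + level_speed (g c) F z b \<ge> 0"
        proof (rule touching_level_speed[OF metric_on_chart[OF manifold c] Q zc wQ w0 _ FQ F0 nz])
          show "covec (\<lambda>y. w (y, b)) z \<noteq> 0" using sub[OF pz(2,3) w0] by simp
          show "0 \<le> w (y, t)" if "(y, t) \<in> Q" "t \<le> b" "F (y, t) < 0" for y t
            using sep[OF that(1,2)] that(3) by linarith
        qed
        then have "level_speed (g c) F z b \<ge> 0"
          using sub[OF pz(2,3) w0] by linarith
        also have "level_speed (g c) F z b = barrier_Phi g c a b f p b"
          unfolding pc(2)[symmetric]
          by (rule barrier_Phi_level_speed[OF manifold sm c pc(1) V2(1) _ V2(4) _ bab ab, symmetric])
            (use V2 pc F nz in auto)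
        finally have Phi: "barrier_Phi g c a b f p b \<ge> 0" .
        have f0: "f p b = 0" using F0 Ff[OF Q(2)] pz(1) by simp
        have "barrier_Phi g d a b f p b \<ge> 0" if "d \<in> A" "p \<in> fst d" for d
          using barrier_Phi_chart(2)[OF manifold sm c pc(1) that bab barrier_covec_nz[OF bar bab f0 c pc(1)]] Phi
          by simp
        then show ?thesis
          using barrier_frontier[OF bar bab f0] by blast
      qed
    qed
  qed
  moreover have "time_slice (\<C> \<union> W) 0 \<subseteq> C"
  proof
    fix x assume "x \<in> time_slice (\<C> \<union> W) 0"
    then have "(x, 0) \<in> \<C> \<or> (x, 0) \<in> W" by (auto simp: time_slice_def)
    moreover have "(x, 0) \<in> \<C>" if "(x, 0) \<in> W"
    proof -
      from that obtain z where "x = chart_inv c z" "z \<in> cball y0 \<rho>" "0 \<in> {s1..s2}" "w (z, 0) \<le> 0"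
        by (auto simp: W_def P_def)
      moreover from this s1 have "s1 = 0" by simp
      ultimately show ?thesis using init[of z] by simp
    qed
    ultimately show "x \<in> C" using flow_start by (auto simp: time_slice_def)
  qed
  ultimately show ?thesis
    by (rule flow_maximal) (use WI[OF z] in simp)
qed

end

end

section \<open>Shrinking balls and enlarged barriers in coordinates\<close>

lemma open_prod_cball:
  fixes y :: "'b::metric_space" and t :: "'c::metric_space"
  assumes "open N" "(y, t) \<in> N"
  obtains r where "r > 0" "cball y r \<times> cball t r \<subseteq> N"
proof -
  obtain A B where AB: "open A" "open B" "(y, t) \<in> A \<times> B" "A \<times> B \<subseteq> N"
    using open_prod_elim[OF assms] by metis
  then have "y \<in> A" "t \<in> B" by auto
  then obtain r1 r2 where r: "r1 > 0" "cball y r1 \<subseteq> A" "r2 > 0" "cball t r2 \<subseteq> B"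
    using AB(1,2) unfolding open_contains_cball by meson
  have "cball y (min r1 r2) \<times> cball t (min r1 r2) \<subseteq> A \<times> B"
    using r by (intro Sigma_mono) (auto simp: subset_iff)
  then show ?thesis
    using that[of "min r1 r2"] r AB by auto
qed

text \<open>Slice derivatives are space-time derivatives in the directions
  \<open>(axis i 1, 0)\<close>, hence jointly continuous in space and time.\<close>

lemma
  fixes F :: "(real ^ 'n::finite) \<times> real \<Rightarrow> real"
  assumes V: "open V" and F: "Ck_on 2 V F"
  shows continuous_on_slice_covec: "continuous_on V (\<lambda>q. covec (\<lambda>z. F (z, snd q)) (fst q))"
    and continuous_on_slice_hess: "continuous_on V (\<lambda>q. hess (\<lambda>z. F (z, snd q)) (fst q))"
    and continuous_on_time_derivative: "continuous_on V (\<lambda>q. frechet_derivative F (at q) (0, 1))"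
proof -
  have diff: "F differentiable (at q)" if "q \<in> V" for q
    using F that by (simp add: numeral_2_eq_2)
  have C1: "Ck_on 1 V (\<lambda>q. frechet_derivative F (at q) v)" for v
    using F unfolding numeral_2_eq_2 One_nat_def Ck_on.simps(2)[of "Suc 0"] by blast
  then show "continuous_on V (\<lambda>q. frechet_derivative F (at q) (0, 1))"
    by (rule Ck_on_continuous_on)
  have cv: "covec (\<lambda>z. F (z, t)) z $ i = frechet_derivative F (at (z, t)) (axis i 1, 0)" if "(z, t) \<in> V" for z t i
    using frechet_derivative_spacetime[OF diff[OF that], of "axis i 1" 0] by (simp add: inner_axis)
  have "continuous_on V (\<lambda>q. \<chi> i. frechet_derivative F (at q) (axis i 1, 0))"
    by (intro continuous_on_vec_lambda Ck_on_continuous_on[OF C1])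
  then show "continuous_on V (\<lambda>q. covec (\<lambda>z. F (z, snd q)) (fst q))"
    by (rule continuous_on_eq) (auto simp: vec_eq_iff cv)
  define D where "D j q = frechet_derivative F (at q) (axis j 1, 0)" for j :: 'n and q
  have Ddiff: "D j differentiable (at q)" if "q \<in> V" for j q
    using C1[of "(axis j 1, 0)"] that by (simp add: D_def[abs_def])
  have hs: "hess (\<lambda>z. F (z, t)) z $ i $ j = frechet_derivative (D j) (at (z, t)) (axis i 1, 0)" if zt: "(z, t) \<in> V" for z t i j
  proof -
    have S: "open {z. (z, t) \<in> V}" "z \<in> {z. (z, t) \<in> V}"
      using Ck_on_slice(1)[OF V F] zt by auto
    have "partial_deriv (\<lambda>z. F (z, t)) j z' = D j (z', t)" if "z' \<in> {z. (z, t) \<in> V}" for z'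
      using cv[of z' t j] that by (simp add: covec_def D_def)
    then have "hess (\<lambda>z. F (z, t)) z $ i $ j = covec (\<lambda>z. D j (z, t)) z $ i"
      using frechet_derivative_cong_local[OF S, of "\<lambda>z. partial_deriv (\<lambda>z. F (z, t)) j z" "\<lambda>z. D j (z, t)"]
      by (simp add: hess_def covec_def partial_deriv_def[of "\<lambda>z. partial_deriv _ _ z"] partial_deriv_def[of "\<lambda>z. D j (z, t)"])
    then show ?thesis
      using frechet_derivative_spacetime[OF Ddiff[OF zt, of j], of "axis i 1" 0] by (simp add: inner_axis)
  qed
  have "continuous_on V (\<lambda>q. frechet_derivative (D j) (at q) v)" for j v
    using C1[of "(axis j 1, 0)"] unfolding D_def[abs_def] One_nat_def Ck_on.simps by blast
  then have "continuous_on V (\<lambda>q. \<chi> i. \<chi> j. frechet_derivative (D j) (at q) (axis i 1, 0))"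
    by (intro continuous_on_vec_lambda)
  then show "continuous_on V (\<lambda>q. hess (\<lambda>z. F (z, snd q)) (fst q))"
    by (rule continuous_on_eq) (auto simp: vec_eq_iff hs)
qed

lemma
  shows covec_zero: "covec (\<lambda>z. 0) y = 0" and hess_zero: "hess (\<lambda>z. 0) y = 0"
  by (simp_all add: covec_def hess_def partial_deriv_def vec_eq_iff)

context
  fixes A :: "('a::{t2_space,second_countable_topology}, 'n::finite) chart set"
    and g :: "('a, 'n) chart \<Rightarrow> real ^ 'n \<Rightarrow> real ^ 'n ^ 'n"
  assumes manifold: "riemannian_manifold A g"
begin

lemma open_chart_preimage:
  assumes c: "c \<in> A" and "open N"
  shows "open {(x, t). x \<in> fst c \<and> (snd c x, t) \<in> N}"
proof -
  have "continuous_on (fst c \<times> UNIV) (\<lambda>q. (snd c (fst q), snd q))"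
    by (intro continuous_intros continuous_on_compose2[OF continuous_on_chart[OF manifold c]]) auto
  from continuous_open_preimage[OF this open_Times[OF open_chart[OF manifold c] open_UNIV] assms(2)]
  show ?thesis
    by (rule back_subst[of "open"]) auto
qed

lemma open_chart_inv_preimage:
  assumes c: "c \<in> A" and "open N"
  shows "open {(z, t). z \<in> coords c \<and> (chart_inv c z, t) \<in> N}"
proof -
  have "continuous_on (coords c \<times> UNIV) (\<lambda>q. (chart_inv c (fst q), snd q))"
    by (intro continuous_intros continuous_on_compose2[OF continuous_on_chart_inv[OF manifold c]]) auto
  from continuous_open_preimage[OF this open_Times[OF open_coords[OF manifold c] open_UNIV] assms(2)]
  show ?thesis
    by (rule back_subst[of "open"]) auto
qed

lemma interior_by_chart:
  assumes c: "c \<in> A" "p \<in> fst c" and N: "open N" "(snd c p, t) \<in> N"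
    and sub: "\<And>z s. (z, s) \<in> N \<Longrightarrow> z \<in> coords c \<Longrightarrow> (chart_inv c z, s) \<in> Z"
  shows "(p, t) \<in> interior Z"
proof (rule interiorI[OF open_chart_preimage[OF c(1) N(1)]])
  show "{(x, t). x \<in> fst c \<and> (snd c x, t) \<in> N} \<subseteq> Z"
    using sub chart_inv_left[OF manifold c(1)] by force
qed (use c N in auto)

context
  fixes C :: "'a set" and \<C> :: "('a \<times> real) set"
  assumes biggest: "biggest_flow A g C \<C>"
begin

text \<open>A coordinate ball of squared radius \<open>r\<^sup>2 - L * (t - t0)\<close> shrinks fast
  enough to be a subsolution if \<open>L\<close> is large. Neither \<open>L\<close> nor the life
  time \<open>\<tau>\<close> involves \<open>t0\<close>; this uniformity allows a start before a
  given time and an end after it.\<close>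

lemma ball_in_flow:
  assumes c: "c \<in> A" and r: "r > 0" "cball y r \<subseteq> coords c"
  obtains \<tau> where "\<tau> > 0"
    "\<And>t0 z t. 0 \<le> t0 \<Longrightarrow> (\<And>z. z \<in> cball y r \<Longrightarrow> (chart_inv c z, t0) \<in> \<C>) \<Longrightarrow>
      z \<in> cball y (r / 2) \<Longrightarrow> t \<in> {t0..t0 + \<tau>} \<Longrightarrow> (chart_inv c z, t) \<in> \<C>"
proof -
  note m = metric_on_chart[OF manifold c]
  \<comment> \<open>While the radius is between \<open>r / 2\<close> and \<open>r\<close>, the
    moving sphere stays in this annulus, where the covector \<open>2 *\<^sub>R (z - y)\<close> does
    not vanish.\<close>
  define S where "S = cball y r - ball y (r / 2)"
  have "compact S" unfolding S_def by (intro compact_diff compact_cball open_ball)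
  \<comment> \<open>Level speed times gradient length will be \<open>- L + h z\<close>, so a bound
    for \<open>h\<close> tells how fast the sphere has to shrink.\<close>
  define h where "h z = sqrt (conorm_sq (g c) z (2 *\<^sub>R (z - y))) * curv (g c) z (2 *\<^sub>R (z - y)) (2 *\<^sub>R mat 1)" for z
  have nz: "2 *\<^sub>R (z - y) \<noteq> 0" if "z \<in> S" for z
    using that r by (auto simp: S_def)
  have "continuous_on S h"
    unfolding h_def
    by (intro continuous_on_mult continuous_on_real_sqrt continuous_on_conorm_sq[OF m] continuous_on_curv[OF m])
      (use nz r in \<open>auto simp: S_def intro!: continuous_intros\<close>)
  then have "bounded (h ` S)"
    by (intro compact_imp_bounded compact_continuous_image \<open>compact S\<close>)
  then obtain L where L: "L > 0" "\<And>z. z \<in> S \<Longrightarrow> \<bar>h z\<bar> \<le> L"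
    unfolding bounded_pos by auto
  \<comment> \<open>The time after which the squared radius has decreased from
    \<open>r\<^sup>2\<close> to \<open>(r / 2)\<^sup>2\<close>.\<close>
  define \<tau> where "\<tau> = 3 * r\<^sup>2 / (4 * L)"
  have "(chart_inv c z, t) \<in> \<C>" if t0: "0 \<le> t0" and init: "\<And>z. z \<in> cball y r \<Longrightarrow> (chart_inv c z, t0) \<in> \<C>"
    and z: "z \<in> cball y (r / 2)" and t: "t \<in> {t0..t0 + \<tau>}" for t0 z t
  proof -
    \<comment> \<open>The zero function stands in for a barrier, to match the form of the
      perturbation lemmas.\<close>
    define w where "w = (\<lambda>(z, t). (\<lambda>_. 0) (z, t) + 1 * ((z - y) \<bullet> (z - y)) + L * t + (- L * t0 - r\<^sup>2))"
    have F: "Ck_on 2 UNIV (\<lambda>_::(real ^ 'n) \<times> real. 0::real)" by (rule Ck_on_const) simp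
    note pert = Ck_on_perturbed[OF open_UNIV F, of 1 y L "- L * t0 - r\<^sup>2", folded w_def]
      covec_perturbed[OF open_UNIV F, of _ _ 1 y L "- L * t0 - r\<^sup>2", folded w_def]
      hess_perturbed[OF open_UNIV F, of _ _ 1 y L "- L * t0 - r\<^sup>2", folded w_def]
      time_derivative_perturbed[OF open_UNIV F, of _ _ 1 y L "- L * t0 - r\<^sup>2", folded w_def]
    have w: "w (z, t) = (dist y z)\<^sup>2 + L * (t - t0) - r\<^sup>2" for z t
      by (simp add: w_def dist_norm norm_minus_commute power2_norm_eq_inner[symmetric] algebra_simps)
    show ?thesis
    proof (rule subsolution_in_flow[OF manifold biggest c r(2) t0 open_UNIV subset_UNIV pert(1), of "t0 + \<tau>"])
      show "(chart_inv c z, t0) \<in> \<C>" if "z \<in> cball y r" for z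
        by (rule init[OF that])
      \<comment> \<open>On the lateral side \<open>w\<close> is \<open>L * (t - t0)\<close>, so only
        the initial time is concerned.\<close>
      show "(chart_inv c z, t) \<in> \<C>" if "dist y z = r" "t \<in> {t0..t0 + \<tau>}" "w (z, t) \<le> 0" for z t
      proof -
        have "L * (t - t0) \<le> 0" using that by (simp add: w)
        then have "t = t0" using that L(1) by (auto simp: mult_le_0_iff)
        then show ?thesis using init[of z] that by simp
      qed
      show "z \<in> cball y r"
        using z r by auto
      show "w (z, t) \<le> 0"
      proof -
        have "(dist y z)\<^sup>2 \<le> (r / 2)\<^sup>2"
          using z by (intro power_mono) auto
        moreover have "L * (t - t0) \<le> L * \<tau>"
          using t L by (intro mult_left_mono) auto
        moreover have "L * \<tau> = 3 * r\<^sup>2 / 4"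
          using L by (simp add: \<tau>_def)
        ultimately show ?thesis
          by (simp add: w power_divide)
      qed
      show "covec (\<lambda>z. w (z, t)) z \<noteq> 0 \<and> level_speed (g c) w z t \<le> 0"
        if "z \<in> cball y r" "t \<in> {t0..t0 + \<tau>}" "w (z, t) = 0" for z t
      proof -
        have "L * (t - t0) \<le> L * \<tau>"
          using that L by (intro mult_left_mono) auto
        moreover have "L * \<tau> = 3 * r\<^sup>2 / 4"
          using L by (simp add: \<tau>_def)
        ultimately have "(r / 2)\<^sup>2 \<le> (dist y z)\<^sup>2"
          using that by (simp add: w power_divide)
        then have "r / 2 \<le> dist y z"
          by (rule power2_le_imp_le) simp
        then have zS: "z \<in> S" using that by (auto simp: S_def)
        have cov: "covec (\<lambda>z. w (z, t)) z = 2 *\<^sub>R (z - y)" "hess (\<lambda>z. w (z, t)) z = 2 *\<^sub>R mat 1"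
          "frechet_derivative w (at (z, t)) (0, 1) = L"
          using pert(2,3,4)[of z t] by (simp_all add: covec_zero hess_zero)
        have Q: "conorm_sq (g c) z (2 *\<^sub>R (z - y)) > 0"
          by (rule conorm_sq_pos[OF m]) (use that r nz[OF zS] in auto)
        have "sqrt (conorm_sq (g c) z (2 *\<^sub>R (z - y))) * level_speed (g c) w z t = - L + h z"
          using Q by (simp add: level_speed_def cov h_def right_diff_distrib)
        also have "\<dots> \<le> 0" using L(2)[OF zS] by simp
        finally show ?thesis
          using Q nz[OF zS] by (simp add: cov mult_le_0_iff)
      qed
    qed (use t in auto)
  qed
  moreover have "\<tau> > 0" using L r by (simp add: \<tau>_def)
  ultimately show ?thesis using that by blast
qed

text \<open>Inclusion in \<open>\<C>\<close> is given before time \<open>b\<close> only. A ball that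
  lies in \<open>\<C>\<close> at time \<open>b - e\<close> persists for the uniform time
  \<open>\<tau>\<close>, hence until \<open>b + e\<close> if
  \<open>e \<le> \<tau> / 2\<close>.\<close>

lemma interior_in_flow:
  assumes bar: "smooth_barrier A g a b K f" and a: "0 \<le> a" and Om: "open Om" "(p, b) \<in> Om"
    and inside: "\<And>x t. (x, t) \<in> Om \<Longrightarrow> t \<in> {a..<b} \<Longrightarrow> f x t \<le> 0 \<Longrightarrow> (x, t) \<in> \<C>"
    and p: "f p b < 0"
  shows "(p, b) \<in> interior \<C>"
proof -
  have ab: "a < b" and sm: "smooth_in_spacetime A a b f"
    using bar by (auto simp: smooth_barrier_def)
  obtain c where c: "c \<in> A" "p \<in> fst c" using chart_exists[OF manifold] by blast
  have y: "snd c p \<in> coords c" and bab: "b \<in> {a..b}" using c ab by auto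
  obtain V F where V: "open V" "(snd c p, b) \<in> V" "V \<subseteq> coords c \<times> UNIV" "\<And>k. Ck_on k V F"
    and F: "\<And>z s. (z, s) \<in> V \<Longrightarrow> s \<in> {a..b} \<Longrightarrow> F (z, s) = f (chart_inv c z) s"
    by (rule spacetime_extension[OF manifold sm c(1) y bab]) (rule that)
  define N where "N = (V \<inter> F -` {..<0}) \<inter> {(z, t). z \<in> coords c \<and> (chart_inv c z, t) \<in> Om}"
  have "open N"
    unfolding N_def
    by (intro open_Int open_chart_inv_preimage c Om continuous_open_preimage Ck_on_continuous_on[OF V(4)] V) auto
  moreover have "(snd c p, b) \<in> N"
    using V F[OF V(2) bab] p c Om chart_inv_left[OF manifold c] by (auto simp: N_def)
  ultimately obtain r where r: "r > 0" "cball (snd c p) r \<times> cball b r \<subseteq> N"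
    by (rule open_prod_cball)
  have "b \<in> cball b r" using r by simp
  then have "(z, b) \<in> N" if "z \<in> cball (snd c p) r" for z
    using r(2) that by blast
  then have "cball (snd c p) r \<subseteq> coords c"
    unfolding N_def by blast
  then obtain \<tau> where \<tau>: "\<tau> > 0" and ball: "\<And>t0 z t. 0 \<le> t0 \<Longrightarrow>
      (\<And>z. z \<in> cball (snd c p) r \<Longrightarrow> (chart_inv c z, t0) \<in> \<C>) \<Longrightarrow>
      z \<in> cball (snd c p) (r / 2) \<Longrightarrow> t \<in> {t0..t0 + \<tau>} \<Longrightarrow> (chart_inv c z, t) \<in> \<C>"
    using ball_in_flow[OF c(1) r(1)] by metis
  define e where "e = min r (min (b - a) (\<tau> / 2))"
  have e: "e > 0" "e \<le> r" "e \<le> b - a" "e \<le> \<tau> / 2"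
    using r(1) ab \<tau> by (auto simp: e_def min_def)
  have init: "(chart_inv c z, b - e) \<in> \<C>" if "z \<in> cball (snd c p) r" for z
  proof -
    have "b - e \<in> cball b r" using e by (simp add: dist_real_def)
    with that r(2) have "(z, b - e) \<in> N" by blast
    moreover have "b - e \<in> {a..<b}" using e by simp
    ultimately show ?thesis
      using inside F[of z "b - e"] by (auto simp: N_def)
  qed
  show ?thesis
  proof (rule interior_by_chart[OF c, of "ball (snd c p) (r / 2) \<times> {b - e<..<b + e}"])
    show "(chart_inv c z, s) \<in> \<C>" if "(z, s) \<in> ball (snd c p) (r / 2) \<times> {b - e<..<b + e}" for z s
      by (rule ball[OF _ init]) (use that e a in auto)
  qed (use r e in \<open>auto intro!: open_Times\<close>)
qed

text \<open>The function \<open>w\<close> is \<open>C\<^sup>2\<close>-close to \<open>f\<close>, negative at \<open>(p, b)\<close>, at least \<open>f\<close> at the initial time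
  \<open>b - e\<close>, and larger than \<open>f\<close> on the lateral boundary of the cylinder.\<close>

lemma slow_boundary_in_flow:
  assumes bar: "smooth_barrier A g a b K f" and a: "0 \<le> a" and Om: "open Om" "(p, b) \<in> Om"
    and inside: "\<And>x t. (x, t) \<in> Om \<Longrightarrow> t \<in> {a..<b} \<Longrightarrow> f x t \<le> 0 \<Longrightarrow> (x, t) \<in> \<C>"
    and p: "f p b = 0" and c: "c \<in> A" "p \<in> fst c" and Phi: "barrier_Phi g c a b f p b < 0"
  shows "(p, b) \<in> interior \<C>"
proof -
  have ab: "a < b" and sm: "smooth_in_spacetime A a b f"
    using bar by (auto simp: smooth_barrier_def)
  define y where "y = snd c p"
  have y: "y \<in> coords c" and bab: "b \<in> {a..b}" using c ab by (auto simp: y_def)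
  note m = metric_on_chart[OF manifold c(1)]
  obtain V F where V: "open V" "(y, b) \<in> V" "V \<subseteq> coords c \<times> UNIV" "\<And>k. Ck_on k V F"
    and F: "\<And>z s. (z, s) \<in> V \<Longrightarrow> s \<in> {a..b} \<Longrightarrow> F (z, s) = f (chart_inv c z) s"
    by (rule spacetime_extension[OF manifold sm c(1) y bab]) (rule that)
  have F2: "Ck_on 2 V F" by (rule V(4))
  have "covec (coord_rep c (\<lambda>z. f z b)) (snd c p) = covec (\<lambda>z. F (z, b)) (snd c p)"
    by (rule covec_extension[OF manifold c V(1) _ V(4) _ bab ab]) (use V F in \<open>auto simp: y_def\<close>)
  then have nz: "covec (\<lambda>z. F (z, b)) y \<noteq> 0"
    using barrier_covec_nz[OF manifold bar bab p c] by (simp add: y_def)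
  have "barrier_Phi g c a b f p b = level_speed (g c) F (snd c p) b"
    by (rule barrier_Phi_level_speed[OF manifold sm c V(1) _ V(4) _ bab ab]) (use V F nz in \<open>auto simp: y_def\<close>)
  then have slow: "level_speed (g c) F y b < 0"
    using Phi by (simp add: y_def)
  \<comment> \<open>\<open>P\<close>, \<open>H\<close> and \<open>D\<close> are the differential,
    Hessian and time derivative of a perturbed function and \<open>L\<close> its level speed, as
    functions of the point and of the two perturbation parameters. Joint continuity gives one
    neighbourhood for points and parameters at once.\<close>
  define P where "P q = covec (\<lambda>z. F (z, snd (fst q))) (fst (fst q)) + (2 * fst (snd q)) *\<^sub>R (fst (fst q) - y)"
    for q :: "((real ^ 'n) \<times> real) \<times> (real \<times> real)"
  define H where "H q = hess (\<lambda>z. F (z, snd (fst q))) (fst (fst q)) + (2 * fst (snd q)) *\<^sub>R mat 1"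
    for q :: "((real ^ 'n) \<times> real) \<times> (real \<times> real)"
  define D where "D q = frechet_derivative F (at (fst q)) (0, 1) + snd (snd q)"
    for q :: "((real ^ 'n) \<times> real) \<times> (real \<times> real)"
  define L where "L q = - D q / sqrt (conorm_sq (g c) (fst (fst q)) (P q)) + curv (g c) (fst (fst q)) (P q) (H q)" for q
  have cP: "continuous_on (V \<times> UNIV) P" and cH: "continuous_on (V \<times> UNIV) H" and cD: "continuous_on (V \<times> UNIV) D"
    unfolding P_def H_def D_def
    by (intro continuous_intros continuous_on_compose2[OF continuous_on_slice_covec[OF V(1) F2]]
        continuous_on_compose2[OF continuous_on_slice_hess[OF V(1) F2]]
        continuous_on_compose2[OF continuous_on_time_derivative[OF V(1) F2]]; auto)+
  define E where "E = (V \<times> UNIV) \<inter> P -` (- {0})"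
  have oE: "open E"
    unfolding E_def using cP V(1) by (intro continuous_open_preimage open_Times) auto
  have "continuous_on E L"
    unfolding L_def
  proof (intro continuous_intros continuous_on_conorm_sq[OF m] continuous_on_curv[OF m])
    show "\<forall>x\<in>E. sqrt (conorm_sq (g c) (fst (fst x)) (P x)) \<noteq> 0"
      using conorm_sq_pos[OF m] V(3) by (force simp: E_def)
  qed (use V(3) in \<open>auto simp: E_def intro!: continuous_on_subset[OF cP] continuous_on_subset[OF cH] continuous_on_subset[OF cD]
      continuous_intros\<close>)
  then have "open (E \<inter> L -` {..<0})"
    by (intro continuous_open_preimage oE) auto
  moreover have "((y, b), (0, 0)) \<in> E \<inter> L -` {..<0}"
    using V(2) nz slow by (simp add: E_def L_def P_def H_def D_def level_speed_def)
  ultimately obtain r1 where r1: "r1 > 0" "cball (y, b) r1 \<times> cball (0, 0) r1 \<subseteq> E \<inter> L -` {..<0}"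
    by (rule open_prod_cball)
  have "open (V \<inter> {(z, t). z \<in> coords c \<and> (chart_inv c z, t) \<in> Om} \<inter> ball (y, b) r1)"
    by (intro open_Int V open_chart_inv_preimage c Om open_ball)
  moreover have "(y, b) \<in> V \<inter> {(z, t). z \<in> coords c \<and> (chart_inv c z, t) \<in> Om} \<inter> ball (y, b) r1"
    using V r1 Om y chart_inv_left[OF manifold c] by (auto simp: y_def)
  ultimately obtain r2 where r2: "r2 > 0"
    "cball y r2 \<times> cball b r2 \<subseteq> V \<inter> {(z, t). z \<in> coords c \<and> (chart_inv c z, t) \<in> Om} \<inter> ball (y, b) r1"
    by (rule open_prod_cball)
  \<comment> \<open>\<open>e \<le> b - a\<close> keeps the initial time \<open>b - e\<close> in the
    interval, \<open>e \<le> r2\<close> keeps the cylinder in the box, and \<open>e \<le> 1\<close>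
    with \<open>e \<le> r1 / 2\<close> yields \<open>e + e\<^sup>2 / 4 \<le> r1\<close> for the
    parameters.\<close>
  define e where "e = min (min 1 (r1 / 2)) (min r2 (b - a))"
  have e: "0 < e" "e \<le> 1" "e \<le> r1 / 2" "e \<le> r2" "e \<le> b - a"
    using r1(1) r2(1) ab by (auto simp: e_def min_def)
  have box: "(z, t) \<in> V" "z \<in> coords c" "(chart_inv c z, t) \<in> Om" "(z, t) \<in> cball (y, b) r1"
    if "z \<in> cball y e" "t \<in> {b - e..b + e}" for z t
  proof -
    have "z \<in> cball y r2" "t \<in> cball b r2"
      using that e by (auto simp: dist_real_def)
    then have "(z, t) \<in> V \<inter> {(z, t). z \<in> coords c \<and> (chart_inv c z, t) \<in> Om} \<inter> ball (y, b) r1"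
      using r2(2) by blast
    then show "(z, t) \<in> V" "z \<in> coords c" "(chart_inv c z, t) \<in> Om" "(z, t) \<in> cball (y, b) r1"
      by auto
  qed
  have ball: "cball y e \<subseteq> coords c"
    using box(2)[of _ b] e by auto
  \<comment> \<open>On the cylinder all corrections are of order \<open>e ^ 3\<close>. At time
    \<open>b - e\<close> the time term cancels the constant, at \<open>(y, b)\<close> only
    \<open>- e ^ 3 / 4\<close> remains, and on the lateral side up to time \<open>b + e\<close> the
    total is at least \<open>e ^ 3 / 2\<close>.\<close>
  define w where "w = (\<lambda>(z, t). F (z, t) + e * ((z - y) \<bullet> (z - y)) + (- (e\<^sup>2 / 4)) * t + (e\<^sup>2 / 4 * b - e ^ 3 / 4))"
  note pert = Ck_on_perturbed[OF V(1) F2, of e y "- (e\<^sup>2 / 4)" "e\<^sup>2 / 4 * b - e ^ 3 / 4", folded w_def]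
    covec_perturbed[OF V(1) F2, of _ _ e y "- (e\<^sup>2 / 4)" "e\<^sup>2 / 4 * b - e ^ 3 / 4", folded w_def]
    hess_perturbed[OF V(1) F2, of _ _ e y "- (e\<^sup>2 / 4)" "e\<^sup>2 / 4 * b - e ^ 3 / 4", folded w_def]
    time_derivative_perturbed[OF V(1) F2, of _ _ e y "- (e\<^sup>2 / 4)" "e\<^sup>2 / 4 * b - e ^ 3 / 4", folded w_def]
  have w: "w (z, t) = F (z, t) + e * (dist y z)\<^sup>2 + e\<^sup>2 / 4 * (b - t) - e ^ 3 / 4" for z t
    by (simp add: w_def dist_norm norm_minus_commute power2_norm_eq_inner[symmetric] right_diff_distrib)
  have sub: "covec (\<lambda>z. w (z, t)) z \<noteq> 0 \<and> level_speed (g c) w z t \<le> 0"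
    if "z \<in> cball y e" "t \<in> {b - e..b + e}" for z t
  proof -
    define q where "q = ((z, t), (e, - (e\<^sup>2 / 4)))"
    have "norm (e, - (e\<^sup>2 / 4)) \<le> \<bar>e\<bar> + \<bar>e\<^sup>2 / 4\<bar>"
      using norm_Pair_le[of e "- (e\<^sup>2 / 4)"] by simp
    also have "\<dots> \<le> r1"
    proof -
      have "e\<^sup>2 \<le> e" using e by (simp add: power2_eq_square mult_left_le)
      then show ?thesis using e by simp
    qed
    finally have "(e, - (e\<^sup>2 / 4)) \<in> cball (0, 0) r1"
      by (simp add: dist_norm norm_minus_commute norm_Pair)
    then have "q \<in> E \<inter> L -` {..<0}"
      using r1(2) box(4)[OF that] unfolding q_def by blast
    then have "P q \<noteq> 0" "L q < 0" by (auto simp: E_def)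
    moreover have "covec (\<lambda>z. w (z, t)) z = P q" "level_speed (g c) w z t = L q"
      using pert(2-4)[OF box(1)[OF that]] by (auto simp: P_def H_def D_def L_def q_def level_speed_def)
    ultimately show ?thesis by simp
  qed
  have early: "(chart_inv c z, t) \<in> \<C>" if "z \<in> cball y e" "t \<in> {b - e..<b}" "F (z, t) \<le> 0" for z t
    using that e box[of z t] F[of z t] by (intro inside) auto
  \<comment> \<open>From time \<open>b\<close> on, \<open>inside\<close> gives no information.
    \<open>S\<close> contains all lateral points that the region can reach then, and
    \<open>T\<close> those of them that are not interior to \<open>\<C>\<close>.\<close>
  define S where "S = {q \<in> sphere y e \<times> {b..b + e}. F q \<le> - (e ^ 3 / 2)}"
  define T where "T = S - {(z, t). z \<in> coords c \<and> (chart_inv c z, t) \<in> interior \<C>}"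
  have "closed S"
    unfolding S_def
    by (intro continuous_on_closed_Collect_le continuous_on_const continuous_on_subset[OF Ck_on_continuous_on[OF F2]]
        closed_Times closed_sphere closed_atLeastAtMost) (use box(1) e in auto)
  moreover have "S = (sphere y e \<times> {b..b + e}) \<inter> S"
    by (auto simp: S_def)
  ultimately have "compact S"
    using compact_Int_closed[of "sphere y e \<times> {b..b + e}" S] compact_Times[OF compact_sphere compact_Icc] by metis
  then have "compact T"
    unfolding T_def by (intro compact_diff open_chart_inv_preimage c open_interior)
  \<comment> \<open>At time \<open>b\<close> points of \<open>S\<close> have \<open>F < 0\<close>,
    so \<open>interior_in_flow\<close> applies and \<open>T\<close> consists of strictly later
    points.\<close>
  have start: "(chart_inv c z, b) \<in> interior \<C>" if "(z, b) \<in> S" for z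
  proof -
    have zb: "z \<in> cball y e" "b \<in> {b - e..b + e}" "F (z, b) < 0"
      using that e by (auto simp: S_def intro: le_less_trans)
    show ?thesis
      by (rule interior_in_flow[OF bar a Om(1) box(3)[OF zb(1,2)] inside])
        (use zb F[OF box(1)[OF zb(1,2)] bab] in auto)
  qed
  have late: "t > b" if "(z, t) \<in> T" for z t
  proof -
    have "(z, t) \<in> S" and n: "\<not> (z \<in> coords c \<and> (chart_inv c z, t) \<in> interior \<C>)"
      using that by (auto simp: T_def)
    moreover have "z \<in> coords c"
      using ball \<open>(z, t) \<in> S\<close> by (auto simp: S_def)
    ultimately have "t \<noteq> b" using start by auto
    then show ?thesis using \<open>(z, t) \<in> S\<close> by (auto simp: S_def)
  qed
  \<comment> \<open>The compact set \<open>T\<close> has a first time, which is later than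
    \<open>b\<close>; stopping halfway to it keeps the lateral side inside
    \<open>\<C>\<close>.\<close>
  obtain e' where e': "0 < e'" "e' \<le> e" "\<And>z t. (z, t) \<in> T \<Longrightarrow> t > b + e'"
  proof (cases "T = {}")
    case True
    then show ?thesis using that[of e] e by simp
  next
    case False
    then obtain q where q: "q \<in> T" "\<And>q'. q' \<in> T \<Longrightarrow> snd q \<le> snd q'"
      using continuous_attains_inf[OF \<open>compact T\<close> False continuous_on_snd[OF continuous_on_id]] by blast
    have "snd q > b" using late[of "fst q" "snd q"] q(1) by simp
    then have d: "0 < min e ((snd q - b) / 2)" "min e ((snd q - b) / 2) \<le> e" "b + min e ((snd q - b) / 2) < snd q"
      using e(1) by (auto simp: min_def field_simps)
    show ?thesis
    proof (rule that[OF d(1,2)])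
      show "b + min e ((snd q - b) / 2) < t" if "(z, t) \<in> T" for z t
        using d(3) q(2)[OF that] by (simp only: snd_conv)
    qed
  qed
  have lateral: "(chart_inv c z, t) \<in> \<C>" if "dist y z = e" "t \<in> {b - e..b + e'}" "w (z, t) \<le> 0" for z t
  proof (cases "t < b")
    case True
    have "e ^ 3 > 0" "e\<^sup>2 / 4 * (b - t) \<ge> 0" using e True by auto
    then have "F (z, t) \<le> 0"
      using that(3) by (simp add: w that(1) power2_eq_square power3_eq_cube)
    then show ?thesis using early that True by auto
  next
    case False
    have "e\<^sup>2 / 4 * (b - t) \<ge> e\<^sup>2 / 4 * (- e)"
      using that e' by (intro mult_left_mono) auto
    then have "e\<^sup>2 / 4 * (b - t) \<ge> - (e ^ 3 / 4)"
      by (simp add: power2_eq_square power3_eq_cube)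
    moreover have "F (z, t) + e ^ 3 + e\<^sup>2 / 4 * (b - t) - e ^ 3 / 4 \<le> 0"
      using that(3) unfolding w that(1) by (simp add: power2_eq_square power3_eq_cube)
    moreover have "v \<le> - (c / 2)" if "x \<ge> - (c / 4)" "v + c + x - c / 4 \<le> 0" for c v x :: real
      using that by linarith
    ultimately have "F (z, t) \<le> - (e ^ 3 / 2)"
      by blast
    then have "(z, t) \<in> S"
      using that False e' by (auto simp: S_def)
    moreover have "(z, t) \<notin> T" using e'(3)[of z t] that by auto
    ultimately show ?thesis
      using interior_subset by (auto simp: T_def)
  qed
  have init: "(chart_inv c z, b - e) \<in> \<C>" if "z \<in> cball y e" "w (z, b - e) \<le> 0" for z
  proof -
    have "e * (dist y z)\<^sup>2 \<ge> 0" using e by simp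
    then have "F (z, b - e) \<le> 0"
      using that(2) by (simp add: w power2_eq_square power3_eq_cube)
    then show ?thesis using early that e by auto
  qed
  have "cball y e \<times> {b - e..b + e'} \<subseteq> V"
    using box(1) e' by auto
  note region = subsolution_in_flow[OF manifold biggest c(1) ball _ V(1) this pert(1) init lateral]
  have in_flow: "(chart_inv c z, t) \<in> \<C>" if "z \<in> cball y e" "t \<in> {b - e..b + e'}" "w (z, t) \<le> 0" for z t
    by (rule region) (use that a e e' sub in auto)
  show ?thesis
  proof (rule interior_by_chart[OF c, of "(V \<inter> w -` {..<0}) \<inter> ball y e \<times> {b - e<..<b + e'}"])
    show "open ((V \<inter> w -` {..<0}) \<inter> ball y e \<times> {b - e<..<b + e'})"
      by (intro open_Int continuous_open_preimage Ck_on_continuous_on[OF pert(1)] V(1) open_Times) auto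
    have "F (y, b) = 0"
      using F[OF V(2) bab] p chart_inv_left[OF manifold c] by (simp add: y_def)
    then show "(snd c p, b) \<in> (V \<inter> w -` {..<0}) \<inter> ball y e \<times> {b - e<..<b + e'}"
      using V(2) e e' by (simp add: y_def[symmetric] w)
    show "(chart_inv c z, s) \<in> \<C>" if "(z, s) \<in> (V \<inter> w -` {..<0}) \<inter> ball y e \<times> {b - e<..<b + e'}" for z s
      using that by (intro in_flow) auto
  qed
qed

end

end

section \<open>The boundary of the biggest flow\<close>

lemma compact_separation:
  fixes R1 R2 :: "'b::t2_space set"
  assumes "compact R1" "compact R2" "R1 \<inter> R2 = {}"
  obtains N where "open N" "R1 \<subseteq> N" "closure N \<inter> R2 = {}"
proof -
  have "Hausdorff_space (euclidean :: 'b topology)"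
    unfolding Hausdorff_space_def disjnt_def using hausdorff by (metis open_openin)
  then obtain U V where "openin euclidean U" "openin euclidean V" "R1 \<subseteq> U" "R2 \<subseteq> V" "disjnt U V"
    by (rule Hausdorff_space_compact_separation[where S = R1 and T = R2])
      (use assms in \<open>auto simp: disjnt_def\<close>)
  then have UV: "open U" "open V" "R1 \<subseteq> U" "R2 \<subseteq> V" "U \<inter> V = {}"
    by (auto simp: disjnt_def)
  have "closure U \<inter> V = {}"
    using UV by (simp add: open_Int_closure_eq_empty Int_commute)
  then show ?thesis
    using that[of U] UV by blast
qed

lemma continuous_on_local:
  fixes f :: "'b::t2_space \<Rightarrow> 'c::topological_space"
  assumes "\<And>x. x \<in> S \<Longrightarrow> \<exists>N h. open N \<and> x \<in> N \<and> continuous_on N h \<and> (\<forall>z\<in>N \<inter> S. f z = h z)"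
  shows "continuous_on S f"
  unfolding continuous_on_def
proof
  fix x assume x: "x \<in> S"
  with assms obtain N h where N: "open N" "x \<in> N" "continuous_on N h" "\<forall>z\<in>N \<inter> S. f z = h z"
    by metis
  then have "isCont h x"
    using continuous_on_eq_continuous_at by blast
  then have "(h \<longlongrightarrow> h x) (at x)"
    by (simp only: isCont_def)
  then have "(h \<longlongrightarrow> h x) (at x within S)"
    by (rule tendsto_within_subset) simp
  moreover have "\<forall>\<^sub>F z in at x within S. h z = f z"
    unfolding eventually_at_topological using N by (intro exI[of _ N]) auto
  moreover have "h x = f x" using N x by simp
  ultimately show "(f \<longlongrightarrow> f x) (at x within S)"
    using Lim_transform_eventually by metis
qed

text \<open>At a boundary point \<open>F\<close> decreases against its differential, uniformly for
  nearby points and times. Translation by a fixed \<open>v\<close> in that direction moves the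
  nearby sublevel set within the sublevel set into one ball where \<open>F\<close> is negative,
  which serves as a hub for connecting points.\<close>

lemma sublevel_locally_connected:
  fixes F :: "(real ^ 'n::finite) \<times> real \<Rightarrow> real"
  assumes V: "open V" "(y, b) \<in> V" and F: "Ck_on 2 V F" "F (y, b) \<le> 0"
    and nz: "F (y, b) = 0 \<Longrightarrow> covec (\<lambda>z. F (z, b)) y \<noteq> 0"
  obtains v d where "d > 0" "ball y d \<times> ball b d \<subseteq> V" "ball (y + v) d \<times> ball b d \<subseteq> V \<inter> F -` {..<0}"
    "\<And>z t s. z \<in> ball y d \<Longrightarrow> t \<in> ball b d \<Longrightarrow> F (z, t) \<le> 0 \<Longrightarrow> 0 \<le> s \<Longrightarrow> s \<le> 1 \<Longrightarrow>
      (z + s *\<^sub>R v, t) \<in> V \<and> F (z + s *\<^sub>R v, t) \<le> 0"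
proof -
  have neg: "open (V \<inter> F -` {..<0})"
    using Ck_on_continuous_on[OF F(1)] V(1) by (intro continuous_open_preimage) auto
  show ?thesis
  proof (cases "F (y, b) = 0")
    case False
    then have "(y, b) \<in> V \<inter> F -` {..<0}" using V F(2) by auto
    with neg obtain d where d: "d > 0" "cball y d \<times> cball b d \<subseteq> V \<inter> F -` {..<0}"
      by (rule open_prod_cball)
    \<comment> \<open>Where \<open>F\<close> is negative the hub is a ball around the point itself,
      so \<open>v = 0\<close> will do.\<close>
    show ?thesis
    proof (rule that[of d 0])
      show "ball y d \<times> ball b d \<subseteq> V"
        using d(2) by (auto simp: subset_iff)
      show "ball (y + 0) d \<times> ball b d \<subseteq> V \<inter> F -` {..<0}"
        using d(2) by (auto simp: subset_iff)
      show "(z + s *\<^sub>R 0, t) \<in> V \<and> F (z + s *\<^sub>R 0, t) \<le> 0"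
        if "z \<in> ball y d" "t \<in> ball b d" "F (z, t) \<le> 0" for z t s
        using d(2) that by (auto simp: subset_iff)
    qed (use d in auto)
  next
    case True
    define n where "n = - covec (\<lambda>z. F (z, b)) y"
    have n: "n \<noteq> 0" using nz[OF True] by (simp add: n_def)
    define N where "N = V \<inter> (\<lambda>q. covec (\<lambda>z. F (z, snd q)) (fst q) \<bullet> n) -` {..<0}"
    have "open N"
      unfolding N_def using V(1)
      by (intro continuous_open_preimage continuous_on_inner continuous_on_slice_covec[OF V(1) F(1)]) auto
    moreover have "(y, b) \<in> N"
      using V(2) nz[OF True] by (simp add: N_def n_def)
    ultimately obtain r where r: "r > 0" "cball y r \<times> cball b r \<subseteq> N"
      by (rule open_prod_cball)
    \<comment> \<open>A segment of length \<open>r / 2\<close> that starts within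
      \<open>r / 2\<close> of \<open>y\<close> stays in the ball where \<open>F\<close> decreases
      along \<open>n\<close>.\<close>
    define v where "v = (r / (2 * norm n)) *\<^sub>R n"
    have v: "norm v = r / 2" using n r by (simp add: v_def)
    have decr: "F (z + s *\<^sub>R v, t) < F (z, t)" if z: "dist y z \<le> r / 2" and t: "t \<in> cball b r" and s: "0 < s" "s \<le> 1" for z t s
    proof -
      have mem: "(z + x *\<^sub>R v, t) \<in> N" if x: "0 \<le> x" "x \<le> s" for x
      proof -
        have "dist y (z + x *\<^sub>R v) \<le> dist y z + norm (x *\<^sub>R v)"
          by (metis dist_norm dist_triangle add_diff_cancel_left' dist_commute)
        also have "\<dots> \<le> r / 2 + 1 * (r / 2)"
          unfolding norm_scaleR v by (rule add_mono[OF _ mult_right_mono]) (use z x s r in auto)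
        finally show ?thesis using r(2) t by auto
      qed
      define \<phi> where "\<phi> x = F (z + x *\<^sub>R v, t)" for x
      have "\<phi> s < \<phi> 0"
      proof (rule DERIV_neg_imp_decreasing[OF s(1)])
        fix x assume x: "0 \<le> x" "x \<le> s"
        have V': "(z + x *\<^sub>R v, t) \<in> V" and neg: "covec (\<lambda>z. F (z, t)) (z + x *\<^sub>R v) \<bullet> n < 0"
          using mem[OF x] by (auto simp: N_def)
        have diff: "(\<lambda>z. F (z, t)) differentiable (at (z + x *\<^sub>R v))"
          using Ck_on_slice(2)[OF V(1) F(1), of t] V' by (simp add: numeral_2_eq_2)
        have "((\<lambda>x. z + x *\<^sub>R v) has_derivative (\<lambda>h. h *\<^sub>R v)) (at x)"
          by (auto intro!: derivative_eq_intros)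
        from has_derivative_compose[OF this diff[unfolded frechet_derivative_works]]
        have "(\<phi> has_real_derivative covec (\<lambda>z. F (z, t)) (z + x *\<^sub>R v) \<bullet> v) (at x)"
          by (simp add: \<phi>_def[abs_def] frechet_derivative_covec[OF diff] has_field_derivative_def mult_commute_abs)
        moreover have "w \<bullet> v < 0" if "w \<bullet> n < 0" for w
          using that n r(1) by (simp add: v_def mult_pos_neg divide_neg_pos)
        from this[OF neg] have "covec (\<lambda>z. F (z, t)) (z + x *\<^sub>R v) \<bullet> v < 0" .
        ultimately show "\<exists>l. (\<phi> has_real_derivative l) (at x) \<and> l < 0" by blast
      qed
      then show ?thesis by (simp add: \<phi>_def)
    qed
    have N_V: "N \<subseteq> V" by (auto simp: N_def)
    have "(y + v, b) \<in> V \<inter> F -` {..<0}"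
    proof -
      have "(y + v, b) \<in> N"
        using r v by (intro subsetD[OF r(2)]) (auto simp: dist_norm)
      then show ?thesis
        using N_V decr[of y b 1] r True by auto
    qed
    with neg obtain d1 where d1: "d1 > 0" "cball (y + v) d1 \<times> cball b d1 \<subseteq> V \<inter> F -` {..<0}"
      by (rule open_prod_cball)
    define d where "d = min d1 (r / 2)"
    have d: "d > 0" "d \<le> d1" "d \<le> r / 2" using d1(1) r(1) by (auto simp: d_def min_def)
    show ?thesis
    proof (rule that[of d v])
      have "ball y d \<times> ball b d \<subseteq> cball y r \<times> cball b r"
        using d r by (intro Sigma_mono) auto
      then show "ball y d \<times> ball b d \<subseteq> V"
        using r(2) N_V by blast
      have "ball (y + v) d \<times> ball b d \<subseteq> cball (y + v) d1 \<times> cball b d1"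
        using d by (intro Sigma_mono) auto
      then show "ball (y + v) d \<times> ball b d \<subseteq> V \<inter> F -` {..<0}"
        using d1(2) by blast
      show "(z + s *\<^sub>R v, t) \<in> V \<and> F (z + s *\<^sub>R v, t) \<le> 0"
        if z: "z \<in> ball y d" and t: "t \<in> ball b d" and "F (z, t) \<le> 0" and s: "0 \<le> s" "s \<le> 1" for z t s
      proof
        have "dist y (z + s *\<^sub>R v) \<le> dist y z + norm (s *\<^sub>R v)"
          by (metis dist_norm dist_triangle add_diff_cancel_left' dist_commute)
        also have "\<dots> \<le> r / 2 + 1 * (r / 2)"
          unfolding norm_scaleR v by (rule add_mono[OF _ mult_right_mono]) (use z d s r in auto)
        finally have "(z + s *\<^sub>R v, t) \<in> cball y r \<times> cball b r" using t d r by auto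
        then show "(z + s *\<^sub>R v, t) \<in> V" using r(2) N_V by blast
        show "F (z + s *\<^sub>R v, t) \<le> 0"
          using decr[of z t s] that d r by (cases "s = 0") auto
      qed
    qed (rule d)
  qed
qed

definition track :: "real \<Rightarrow> real \<Rightarrow> ('a \<Rightarrow> real \<Rightarrow> real) \<Rightarrow> ('a \<times> real) set" where
  "track a b f = {(x, t). t \<in> {a..b} \<and> f x t \<le> 0}"

text \<open>The final time is left out because disjointness of barrier and flow is assumed only
  before it.\<close>

definition open_track :: "real \<Rightarrow> real \<Rightarrow> ('a \<Rightarrow> real \<Rightarrow> real) \<Rightarrow> ('a \<times> real) set" where
  "open_track a b f = {(x, t). t \<in> {a..<b} \<and> f x t \<le> 0}"

context
  fixes A :: "('a::{t2_space,second_countable_topology}, 'n::finite) chart set"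
    and g :: "('a, 'n) chart \<Rightarrow> real ^ 'n \<Rightarrow> real ^ 'n ^ 'n"
  assumes manifold: "riemannian_manifold A g"
begin

text \<open>Local compactness is inherited from the charts; the type class of \<open>'a\<close>
  provides only a Hausdorff, second countable space.\<close>

lemma compact_neighbourhood:
  fixes q :: "'a \<times> real"
  obtains N L where "open N" "q \<in> N" "N \<subseteq> L" "compact L"
proof -
  obtain x t where q: "q = (x, t)" by fastforce
  obtain c where c: "c \<in> A" "x \<in> fst c" using chart_exists[OF manifold] by blast
  then obtain r where r: "r > 0" "cball (snd c x) r \<subseteq> coords c"
    using open_coords[OF manifold c(1)] by (auto simp: open_contains_cball)
  define N where "N = {(x', s). x' \<in> fst c \<and> (snd c x', s) \<in> ball (snd c x) r \<times> ball t 1}"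
  define L where "L = chart_inv c ` cball (snd c x) r \<times> cball t 1"
  show ?thesis
  proof (rule that[of N L])
    show "open N"
      unfolding N_def by (intro open_chart_preimage[OF manifold c(1)] open_Times open_ball)
    show "q \<in> N" using q c r by (simp add: N_def)
    show "N \<subseteq> L"
    proof
      fix p assume "p \<in> N"
      then obtain x' s where "p = (x', s)" "x' \<in> fst c" "snd c x' \<in> ball (snd c x) r" "s \<in> ball t 1"
        by (auto simp: N_def)
      moreover from this have "x' = chart_inv c (snd c x')"
        using chart_inv_left[OF manifold c(1)] by simp
      ultimately show "p \<in> L" by (auto simp: L_def)
    qed
    show "compact L"
      unfolding L_def
      by (intro compact_Times compact_continuous_image compact_cball
          continuous_on_subset[OF continuous_on_chart_inv[OF manifold c(1)]] r)
  qed
qed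

text \<open>Compactness of the closure lets a continuous function attain its minimum on the boundary
  of \<open>N\<close>.\<close>

lemma relatively_compact_separation:
  fixes R1 R2 :: "('a \<times> real) set"
  assumes R: "compact R1" "compact R2" "R1 \<inter> R2 = {}"
  obtains N where "open N" "R1 \<subseteq> N" "compact (closure N)" "closure N \<inter> R2 = {}"
proof -
  obtain N0 where N0: "open N0" "R1 \<subseteq> N0" "closure N0 \<inter> R2 = {}"
    using compact_separation[OF R] .
  have "\<exists>N L. open N \<and> q \<in> N \<and> N \<subseteq> L \<and> compact L" for q :: "'a \<times> real"
    by (rule compact_neighbourhood[of q]) blast
  then obtain W L where WL: "\<And>q. open (W q)" "\<And>q. q \<in> W q" "\<And>q. W q \<subseteq> L q" "\<And>q::'a \<times> real. compact (L q)"
    by metis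
  obtain Q where Q: "Q \<subseteq> R1" "finite Q" "R1 \<subseteq> (\<Union>q\<in>Q. W q)"
    using R(1) by (rule compactE_image[where C = R1 and f = W]) (use WL in auto)
  define N where "N = N0 \<inter> (\<Union>q\<in>Q. W q)"
  have L: "compact (\<Union>q\<in>Q. L q)" using Q(2) WL(4) by auto
  show ?thesis
  proof (rule that[of N])
    show "open N"
      unfolding N_def by (intro open_Int open_UN ballI N0(1) WL(1))
    show "R1 \<subseteq> N" using N0 Q by (auto simp: N_def)
    show "closure N \<inter> R2 = {}"
      using N0 closure_mono[of N N0] by (auto simp: N_def)
    have "closure N \<subseteq> (\<Union>q\<in>Q. L q)"
      using WL(3) by (intro closure_minimal compact_imp_closed[OF L]) (auto simp: N_def)
    then have "closure N = (\<Union>q\<in>Q. L q) \<inter> closure N" by auto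
    then show "compact (closure N)"
      using compact_Int_closed[OF L closed_closure] by metis
  qed
qed

lemma continuous_on_spacetime:
  assumes "smooth_in_spacetime A a b f"
  shows "continuous_on (UNIV \<times> {a..b}) (\<lambda>q. f (fst q) (snd q))"
proof (rule continuous_on_local)
  fix q :: "'a \<times> real" assume "q \<in> UNIV \<times> {a..b}"
  then obtain x t where q: "q = (x, t)" "t \<in> {a..b}" by auto
  obtain c where c: "c \<in> A" "x \<in> fst c" using chart_exists[OF manifold] by blast
  have "snd c x \<in> coords c" using c by auto
  obtain V F where V: "open V" "(snd c x, t) \<in> V" "V \<subseteq> coords c \<times> UNIV" "\<And>k. Ck_on k V F"
    and F: "\<And>z s. (z, s) \<in> V \<Longrightarrow> s \<in> {a..b} \<Longrightarrow> F (z, s) = f (chart_inv c z) s"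
    by (rule spacetime_extension[OF manifold assms c(1) \<open>snd c x \<in> coords c\<close> q(2)]) (rule that)
  define N where "N = {(x, t). x \<in> fst c \<and> (snd c x, t) \<in> V}"
  have "continuous_on N (\<lambda>q. F (snd c (fst q), snd q))"
    by (rule continuous_on_compose2[OF Ck_on_continuous_on[OF V(4)]])
      (auto simp: N_def intro!: continuous_intros continuous_on_compose2[OF continuous_on_chart[OF manifold c(1)]])
  moreover have "open N"
    unfolding N_def by (rule open_chart_preimage[OF manifold c(1) V(1)])
  moreover have "f (fst p) (snd p) = F (snd c (fst p), snd p)" if "p \<in> N \<inter> UNIV \<times> {a..b}" for p
    using that F chart_inv_left[OF manifold c(1)] by (auto simp: N_def)
  ultimately show "\<exists>N h. open N \<and> q \<in> N \<and> continuous_on N h \<and> (\<forall>z\<in>N \<inter> UNIV \<times> {a..b}. f (fst z) (snd z) = h z)"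
    using c V q by (intro exI[of _ N] exI[of _ "\<lambda>q. F (snd c (fst q), snd q)"]) (auto simp: N_def)
qed

lemma compact_track:
  assumes "compact_barrier A g a b K f"
  shows "compact (track a b f)"
proof -
  have sm: "smooth_in_spacetime A a b f" and K: "\<And>t. t \<in> {a..b} \<Longrightarrow> K t = {x. f x t \<le> 0}"
    and comp: "compact (\<Union>t\<in>{a..b}. K t)"
    using assms by (auto simp: compact_barrier_def smooth_barrier_def)
  have "closed {q \<in> UNIV \<times> {a..b}. f (fst q) (snd q) \<le> 0}"
    by (intro continuous_on_closed_Collect_le continuous_on_spacetime[OF sm] continuous_on_const closed_Times) auto
  also have "{q \<in> UNIV \<times> {a..b}. f (fst q) (snd q) \<le> 0} = track a b f"
    by (auto simp: track_def)
  finally have "compact (((\<Union>t\<in>{a..b}. K t) \<times> {a..b}) \<inter> track a b f)"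
    by (intro compact_Int_closed compact_Times comp compact_Icc)
  moreover have "((\<Union>t\<in>{a..b}. K t) \<times> {a..b}) \<inter> track a b f = track a b f"
    using K by (auto simp: track_def)
  ultimately show ?thesis by simp
qed

text \<open>At the final time, the nonvanishing gradient provides nearby points with
  \<open>f < 0\<close>, and the strict inequality survives at slightly earlier times.\<close>

lemma open_track_dense:
  assumes bar: "smooth_barrier A g a b K f" and q: "q \<in> track a b f" and N: "open N" "q \<in> N"
  shows "N \<inter> open_track a b f \<noteq> {}"
proof -
  obtain x t where xt: "q = (x, t)" "t \<in> {a..b}" "f x t \<le> 0" using q by (auto simp: track_def)
  have ab: "a < b" and sm: "smooth_in_spacetime A a b f"
    using bar by (auto simp: smooth_barrier_def)
  show ?thesis
  proof (cases "t < b")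
    case True
    then show ?thesis using xt N by (auto simp: open_track_def)
  next
    case False
    with xt have t: "t = b" by simp
    obtain c where c: "c \<in> A" "x \<in> fst c" using chart_exists[OF manifold] by blast
    define y where "y = snd c x"
    have y: "y \<in> coords c" using c by (auto simp: y_def)
    have bab: "b \<in> {a..b}" using ab by simp
    obtain V F where V: "open V" "(y, b) \<in> V" "V \<subseteq> coords c \<times> UNIV" "\<And>k. Ck_on k V F"
      and F: "\<And>z s. (z, s) \<in> V \<Longrightarrow> s \<in> {a..b} \<Longrightarrow> F (z, s) = f (chart_inv c z) s"
      by (rule spacetime_extension[OF manifold sm c(1) y bab]) (rule that)
    define W where "W = V \<inter> {(z, t). z \<in> coords c \<and> (chart_inv c z, t) \<in> N}"
    have W: "open W" "(y, b) \<in> W"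
      using V N y xt t chart_inv_left[OF manifold c]
      by (auto simp: W_def y_def intro!: open_Int open_chart_inv_preimage[OF manifold c(1)])
    have FW: "Ck_on 2 W F" by (rule Ck_on_subset[OF _ V(4)]) (auto simp: W_def)
    have "\<exists>z. (z, b) \<in> W \<and> F (z, b) < 0"
    proof (rule ccontr)
      assume none: "\<nexists>z. (z, b) \<in> W \<and> F (z, b) < 0"
      have fx: "F (y, b) = f x b"
        using F[OF V(2) bab] chart_inv_left[OF manifold c] by (simp add: y_def)
      then have f0: "f x b = 0" using none W(2) xt t by force
      have "covec (\<lambda>z. F (z, b)) y = 0"
      proof (rule covec_local_extremum[OF _ Ck_on_slice(1)[OF W(1) FW]])
        show "(\<lambda>z. F (z, b)) differentiable (at y)"
          using Ck_on_slice(2)[OF W(1) FW, of b] W(2) by (simp add: numeral_2_eq_2)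
        show "(\<forall>z\<in>{z. (z, b) \<in> W}. F (y, b) \<le> F (z, b)) \<or> (\<forall>z\<in>{z. (z, b) \<in> W}. F (z, b) \<le> F (y, b))"
          using none fx f0 by force
      qed (use W in auto)
      moreover have "covec (coord_rep c (\<lambda>z. f z b)) (snd c x) = covec (\<lambda>z. F (z, b)) (snd c x)"
        by (rule covec_extension[OF manifold c V(1) _ V(4) _ bab ab]) (use V F in \<open>auto simp: y_def\<close>)
      ultimately show False
        using barrier_covec_nz[OF manifold bar bab f0 c] by (simp add: y_def)
    qed
    then obtain z where z: "(z, b) \<in> W \<inter> F -` {..<0}" by auto
    have "open (W \<inter> F -` {..<0})"
      by (intro continuous_open_preimage Ck_on_continuous_on[OF FW] W) auto
    from open_prod_cball[OF this z] obtain r where r: "r > 0" "cball z r \<times> cball b r \<subseteq> W \<inter> F -` {..<0}" .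
    define s where "s = max a (b - r)"
    have s: "s \<in> {a..<b}" "s \<in> cball b r"
      using ab r(1) by (auto simp: s_def dist_real_def max_def)
    then have "(z, s) \<in> W \<inter> F -` {..<0}"
      using r by (intro subsetD[OF r(2)]) auto
    then have "(chart_inv c z, s) \<in> N \<inter> open_track a b f"
      using F[of z s] s(1) by (auto simp: W_def open_track_def)
    then show ?thesis by blast
  qed
qed

text \<open>Each nearby point of the track before time \<open>b\<close> is joined to the common
  point \<open>q0\<close> by a spatial segment at its own time followed by the box \<open>B\<close>,
  where the extension is negative and all times are before \<open>b\<close>.\<close>

lemma open_track_locally_connected:
  assumes bar: "smooth_barrier A g a b K f" and x: "f x b \<le> 0"
  obtains N q0 where "open N" "(x, b) \<in> N"
    "\<And>q. q \<in> N \<inter> open_track a b f \<Longrightarrow> \<exists>S. connected S \<and> q \<in> S \<and> q0 \<in> S \<and> S \<subseteq> open_track a b f"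
proof -
  have ab: "a < b" and sm: "smooth_in_spacetime A a b f"
    using bar by (auto simp: smooth_barrier_def)
  obtain c where c: "c \<in> A" "x \<in> fst c" using chart_exists[OF manifold] by blast
  define y where "y = snd c x"
  have y: "y \<in> coords c" using c by (auto simp: y_def)
  have bab: "b \<in> {a..b}" using ab by simp
  obtain V F where V: "open V" "(y, b) \<in> V" "V \<subseteq> coords c \<times> UNIV" "\<And>k. Ck_on k V F"
    and F: "\<And>z s. (z, s) \<in> V \<Longrightarrow> s \<in> {a..b} \<Longrightarrow> F (z, s) = f (chart_inv c z) s"
    by (rule spacetime_extension[OF manifold sm c(1) y bab]) (rule that)
  have Fy: "F (y, b) = f x b"
    using F[OF V(2) bab] chart_inv_left[OF manifold c] by (simp add: y_def)
  have Fy_le: "F (y, b) \<le> 0" using x by (simp add: Fy)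
  have nz: "covec (\<lambda>z. F (z, b)) y \<noteq> 0" if "F (y, b) = 0"
  proof -
    have "covec (coord_rep c (\<lambda>z. f z b)) (snd c x) = covec (\<lambda>z. F (z, b)) (snd c x)"
      by (rule covec_extension[OF manifold c V(1) _ V(4) _ bab ab]) (use V F in \<open>auto simp: y_def\<close>)
    then show ?thesis
      using barrier_covec_nz[OF manifold bar bab _ c] that by (simp add: y_def[symmetric] Fy)
  qed
  obtain v d1 where d1: "d1 > 0" "ball y d1 \<times> ball b d1 \<subseteq> V" "ball (y + v) d1 \<times> ball b d1 \<subseteq> V \<inter> F -` {..<0}"
    and seg: "\<And>z t s. z \<in> ball y d1 \<Longrightarrow> t \<in> ball b d1 \<Longrightarrow> F (z, t) \<le> 0 \<Longrightarrow> 0 \<le> s \<Longrightarrow> s \<le> 1 \<Longrightarrow>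
      (z + s *\<^sub>R v, t) \<in> V \<and> F (z + s *\<^sub>R v, t) \<le> 0"
    by (rule sublevel_locally_connected[OF V(1,2) V(4) Fy_le], erule nz) (rule that)
  define d where "d = min d1 (b - a)"
  have d: "d > 0" "d \<le> d1" "d \<le> b - a" using d1(1) ab by (auto simp: d_def min_def)
  define \<Psi> where "\<Psi> q = (chart_inv c (fst q), snd q)" for q :: "(real ^ 'n) \<times> real"
  have \<Psi>: "continuous_on V \<Psi>"
    unfolding \<Psi>_def
    by (intro continuous_intros continuous_on_compose2[OF continuous_on_chart_inv[OF manifold c(1)]]) (use V(3) in auto)
  have \<Psi>_track: "\<Psi> (z, t) \<in> open_track a b f" if "(z, t) \<in> V" "F (z, t) \<le> 0" "t \<in> {a..<b}" for z t
    using that F[of z t] by (simp add: \<Psi>_def open_track_def)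
  define B where "B = ball (y + v) d \<times> {b - d<..<b}"
  have Btime: "t \<in> {a..<b}" "t \<in> ball b d1" if "t \<in> {b - d<..<b}" for t
    using that d by (auto simp: dist_real_def)
  have B: "B \<subseteq> V \<inter> F -` {..<0}"
  proof -
    have "B \<subseteq> ball (y + v) d1 \<times> ball b d1"
      using d Btime by (auto simp: B_def)
    then show ?thesis using d1(3) by blast
  qed
  define N where "N = {(x', t). x' \<in> fst c \<and> (snd c x', t) \<in> ball y d \<times> {b - d<..<b + d}}"
  define q0 where "q0 = \<Psi> (y + v, b - d / 2)"
  show ?thesis
  proof (rule that[of N q0])
    show "open N"
      unfolding N_def by (intro open_chart_preimage[OF manifold c(1)] open_Times) auto
    show "(x, b) \<in> N" using c d by (simp add: N_def y_def)
    fix q assume "q \<in> N \<inter> open_track a b f"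
    then obtain x' t where q: "q = (x', t)" "x' \<in> fst c" "snd c x' \<in> ball y d" "t \<in> {b - d<..<b}" "f x' t \<le> 0"
      by (auto simp: N_def open_track_def)
    define z where "z = snd c x'"
    have qz: "q = \<Psi> (z, t)" using q chart_inv_left[OF manifold c(1)] by (simp add: \<Psi>_def z_def)
    have z: "z \<in> ball y d1" "t \<in> ball b d1" "t \<in> {a..<b}"
      using q(3,4) d Btime by (auto simp: z_def)
    have Fz: "F (z, t) \<le> 0"
    proof -
      have "(z, t) \<in> V" using z d1(2) by blast
      then show ?thesis using F[of z t] z(3) q chart_inv_left[OF manifold c(1)] by (simp add: z_def)
    qed
    define S where "S = (\<lambda>s. (z + s *\<^sub>R v, t)) ` {0..1} \<union> B"
    have S: "p \<in> V \<and> F p \<le> 0 \<and> snd p \<in> {a..<b}" if "p \<in> S" for p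
    proof -
      have "p \<in> V \<and> F p \<le> 0 \<and> snd p \<in> {a..<b}" if "p \<in> B"
      proof -
        have "snd p \<in> {b - d<..<b}" using that by (auto simp: B_def)
        then show ?thesis using that B Btime by fastforce
      qed
      moreover have "p \<in> V \<and> F p \<le> 0 \<and> snd p \<in> {a..<b}" if "p \<in> (\<lambda>s. (z + s *\<^sub>R v, t)) ` {0..1}"
        using that seg[OF z(1,2) Fz] z(3) by auto
      ultimately show ?thesis using that by (auto simp: S_def)
    qed
    have "connected S"
      unfolding S_def
    proof (rule connected_Un)
      show "connected ((\<lambda>s. (z + s *\<^sub>R v, t)) ` {0..1})"
        by (intro connected_continuous_image continuous_intros) auto
      show "connected B"
        unfolding B_def by (intro connected_Times) auto
      have "(z + 1 *\<^sub>R v, t) \<in> B"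
        using q(3,4) by (simp add: B_def z_def dist_norm)
      then show "(\<lambda>s. (z + s *\<^sub>R v, t)) ` {0..1} \<inter> B \<noteq> {}"
        by (auto simp: disjoint_iff image_iff intro!: bexI[of _ 1])
    qed
    moreover have "S \<subseteq> V" using S by blast
    ultimately have "connected (\<Psi> ` S)"
      by (intro connected_continuous_image continuous_on_subset[OF \<Psi>])
    moreover have "(z, t) \<in> S"
      unfolding S_def by (intro UnI1 image_eqI[of _ _ 0]) auto
    then have "q \<in> \<Psi> ` S" using qz by blast
    moreover have "q0 \<in> \<Psi> ` S"
      using d(1) by (auto simp: q0_def S_def B_def)
    moreover have "\<Psi> ` S \<subseteq> open_track a b f"
      using S \<Psi>_track by force
    ultimately show "\<exists>S. connected S \<and> q \<in> S \<and> q0 \<in> S \<and> S \<subseteq> open_track a b f"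
      by blast
  qed
qed

end

context
  fixes A :: "('a::{t2_space,second_countable_topology}, 'n::finite) chart set"
    and g :: "('a, 'n) chart \<Rightarrow> real ^ 'n \<Rightarrow> real ^ 'n ^ 'n"
  assumes manifold: "riemannian_manifold A g"
begin

text \<open>Since \<open>f > d\<close> on the boundary of a suitable neighbourhood \<open>N\<close> of \<open>R1\<close>, composing \<open>f\<close> with a
  cutoff that is \<open>1\<close> above \<open>d\<close> lets one continue it by \<open>1\<close> outside \<open>N\<close>.\<close>

lemma barrier_restrict:
  assumes comp: "compact_barrier A g a b K f" and R: "compact R1" "compact R2" "R1 \<inter> R2 = {}"
    and tr: "track a b f = R1 \<union> R2"
  obtains f' where "compact_barrier A g a b (\<lambda>t. {x. f' x t \<le> 0}) f'"
    "\<And>x t. t \<in> {a..b} \<Longrightarrow> f' x t \<le> 0 \<longleftrightarrow> (x, t) \<in> R1"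
    "\<And>q. q \<in> R1 \<Longrightarrow> \<exists>N. open N \<and> q \<in> N \<and> (\<forall>(x, t)\<in>N. t \<in> {a..b} \<longrightarrow> f' x t = f x t)"
proof -
  have bar: "smooth_barrier A g a b K f" and ab: "a < b" and sm: "smooth_in_spacetime A a b f"
    using comp by (auto simp: compact_barrier_def smooth_barrier_def)
  obtain N where N: "open N" "R1 \<subseteq> N" "compact (closure N)" "closure N \<inter> R2 = {}"
    using relatively_compact_separation[OF manifold R] .
  \<comment> \<open>A point of \<open>B\<close> with \<open>f \<le> 0\<close> would be in
    \<open>R1\<close>, hence in \<open>N\<close>, or in \<open>R2\<close>, hence outside the closure
    of \<open>N\<close>; neither is possible.\<close>
  define B where "B = (closure N - N) \<inter> UNIV \<times> {a..b}"
  have "compact B"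
    unfolding B_def by (intro compact_Int_closed compact_diff N closed_Times) auto
  have Bpos: "f (fst q) (snd q) > 0" if "q \<in> B" for q
  proof (rule ccontr)
    assume "\<not> f (fst q) (snd q) > 0"
    then have "q \<in> track a b f" using that by (auto simp: B_def track_def)
    then show False using that tr N by (auto simp: B_def)
  qed
  obtain d where d: "d > 0" "\<And>q. q \<in> B \<Longrightarrow> f (fst q) (snd q) > d"
  proof (cases "B = {}")
    case True
    then show ?thesis using that[of 1] by simp
  next
    case False
    have "continuous_on B (\<lambda>q. f (fst q) (snd q))"
      by (rule continuous_on_subset[OF continuous_on_spacetime[OF manifold sm]]) (auto simp: B_def)
    from continuous_attains_inf[OF \<open>compact B\<close> False this]
    obtain q0 where q0: "q0 \<in> B" "\<And>q. q \<in> B \<Longrightarrow> f (fst q0) (snd q0) \<le> f (fst q) (snd q)"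
      by blast
    show ?thesis
      by (rule that[of "f (fst q0) (snd q0) / 2"]) (use Bpos[OF q0(1)] q0(2) in force)+
  qed
  obtain \<theta> where \<theta>: "\<And>k. Ck_on k UNIV \<theta>" "\<And>s. s \<le> d / 2 \<Longrightarrow> \<theta> s = s"
    "\<And>s. s \<ge> d \<Longrightarrow> \<theta> s = 1" "\<And>s::real. s > 0 \<Longrightarrow> \<theta> s > 0"
    using smooth_cutoff[OF d(1)] by blast
  have \<theta>0: "\<theta> s \<le> 0 \<longleftrightarrow> s \<le> 0" "\<theta> s = 0 \<longleftrightarrow> s = 0" for s
    using \<theta>(2)[of s] \<theta>(4)[of s] d(1) by (cases "s > 0"; force)+
  \<comment> \<open>\<open>\<theta>\<close> preserves the sign, so inside \<open>N\<close> the
    sublevel set is unchanged. Composed with \<open>f\<close> it gives \<open>f\<close> near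
    \<open>R1\<close> and \<open>1\<close> near \<open>B\<close>, so both branches agree across the
    boundary of \<open>N\<close>.\<close>
  define f' where "f' x t = (if (x, t) \<in> N then \<theta> (f x t) else 1)" for x t
  have f'R1: "f' x t \<le> 0 \<longleftrightarrow> (x, t) \<in> R1" if t: "t \<in> {a..b}" for x t
  proof
    assume "f' x t \<le> 0"
    then have "(x, t) \<in> N" "f x t \<le> 0"
      by (auto simp: f'_def \<theta>0 split: if_splits)
    moreover from this have "(x, t) \<in> R1 \<union> R2"
      using t tr by (auto simp: track_def)
    ultimately show "(x, t) \<in> R1"
      using N(4) closure_subset[of N] by blast
  next
    assume "(x, t) \<in> R1"
    then have "(x, t) \<in> N" "(x, t) \<in> track a b f" using N(2) tr by auto
    then show "f' x t \<le> 0" by (simp add: f'_def \<theta>0 track_def)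
  qed
  have smooth': "smooth_in_spacetime A a b f'"
    unfolding smooth_in_spacetime_def smooth_on_def
  proof (intro ballI)
    fix c q assume c: "c \<in> A" and "q \<in> coords c \<times> {a..b}"
    then obtain y t where q: "q = (y, t)" "y \<in> coords c" "t \<in> {a..b}" by auto
    obtain V F where V: "open V" "(y, t) \<in> V" "V \<subseteq> coords c \<times> UNIV" "\<And>k. Ck_on k V F"
      and F: "\<And>z s. (z, s) \<in> V \<Longrightarrow> s \<in> {a..b} \<Longrightarrow> F (z, s) = f (chart_inv c z) s"
      by (rule spacetime_extension[OF manifold sm c q(2,3)]) (rule that)
    define pre where "pre S = {(z, t). z \<in> coords c \<and> (chart_inv c z, t) \<in> S}" for S :: "('a \<times> real) set"
    have pre: "open (pre S)" if "open S" for S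
      unfolding pre_def by (rule open_chart_inv_preimage[OF manifold c that])
    have pos: "open (V \<inter> F -` {d<..})"
      by (intro continuous_open_preimage Ck_on_continuous_on[OF V(4)] V) auto
    consider "(chart_inv c y, t) \<in> N" | "(chart_inv c y, t) \<notin> closure N" | "(chart_inv c y, t) \<in> B"
      using q(3) by (auto simp: B_def)
    then show "\<exists>W h. open W \<and> q \<in> W \<and> (\<forall>k. Ck_on k W h) \<and>
        (\<forall>p\<in>W \<inter> coords c \<times> {a..b}. h p = (case p of (z, s) \<Rightarrow> f' (chart_inv c z) s))"
    proof cases
      case 1
      have "open (V \<inter> pre N)" by (intro open_Int V pre N)
      moreover have "q \<in> V \<inter> pre N" using V q 1 by (simp add: pre_def)
      moreover have "Ck_on k (V \<inter> pre N) (\<lambda>p. \<theta> (F p))" for k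
        by (rule Ck_on_compose[OF calculation(1) open_UNIV _ \<theta>(1)]) (auto intro: Ck_on_subset[OF _ V(4)])
      ultimately show ?thesis
        using F by (intro exI[of _ "V \<inter> pre N"] exI[of _ "\<lambda>p. \<theta> (F p)"]) (auto simp: pre_def f'_def)
    next
      case 2
      have "open (pre (- closure N))" by (intro pre) auto
      moreover have "q \<in> pre (- closure N)" using q 2 by (simp add: pre_def)
      moreover have "(z, s) \<notin> N" if "(z, s) \<notin> closure N" for z s
        using that closure_subset[of N] by blast
      ultimately show ?thesis
        by (intro exI[of _ "pre (- closure N)"] exI[of _ "\<lambda>_. 1"]) (auto simp: pre_def f'_def Ck_on_const)
    next
      case 3
      have "q \<in> V \<inter> F -` {d<..}"
        using d(2)[OF 3] F[OF V(2)] V(2) q by simp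
      then show ?thesis
        using pos F \<theta>(3)
        by (intro exI[of _ "V \<inter> F -` {d<..}"] exI[of _ "\<lambda>_. 1"]) (auto simp: f'_def Ck_on_const)
    qed
  qed
  have local: "\<exists>M. open M \<and> q \<in> M \<and> (\<forall>(x, t)\<in>M. t \<in> {a..b} \<longrightarrow> f' x t = f x t)" if q: "q \<in> R1" for q
  proof -
    have "openin (top_of_set (UNIV \<times> {a..b})) ((UNIV \<times> {a..b}) \<inter> (\<lambda>q. f (fst q) (snd q)) -` {..<d / 2})"
      by (rule continuous_openin_preimage_gen[OF continuous_on_spacetime[OF manifold sm]]) simp
    then obtain M where M: "open M" "(UNIV \<times> {a..b}) \<inter> (\<lambda>q. f (fst q) (snd q)) -` {..<d / 2} = (UNIV \<times> {a..b}) \<inter> M"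
      by (auto simp: openin_open)
    have "q \<in> track a b f" using q tr by simp
    then have "q \<in> M" using M(2) d(1) by (force simp: track_def)
    moreover have "f' x t = f x t" if "(x, t) \<in> M \<inter> N" "t \<in> {a..b}" for x t
    proof -
      have "(x, t) \<in> (UNIV \<times> {a..b}) \<inter> (\<lambda>q. f (fst q) (snd q)) -` {..<d / 2}"
        using that unfolding M(2) by simp
      then show ?thesis using that \<theta>(2)[of "f x t"] by (simp add: f'_def)
    qed
    ultimately show ?thesis
      using M(1) N q by (intro exI[of _ "M \<inter> N"]) auto
  qed
  have bar': "smooth_barrier A g a b (\<lambda>t. {x. f' x t \<le> 0}) f'"
    unfolding smooth_barrier_def
  proof (intro conjI ballI allI impI)
    fix t x c assume t: "t \<in> {a..b}" and x: "f' x t = 0" and c: "c \<in> A" "x \<in> fst c"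
    have q: "(x, t) \<in> R1" using f'R1[OF t, of x] x by simp
    have f0: "f x t = 0"
      using x by (simp add: f'_def \<theta>0 split: if_splits)
    obtain M where M: "open M" "(x, t) \<in> M" "\<forall>(x, t)\<in>M. t \<in> {a..b} \<longrightarrow> f' x t = f x t"
      using local[OF q] by blast
    define S where "S = {z. (z, t) \<in> {(z, t). z \<in> coords c \<and> (chart_inv c z, t) \<in> M}}"
    have "open S"
      unfolding S_def
      by (rule Ck_on_slice(1)[OF open_chart_inv_preimage[OF manifold c(1) M(1)], of 0 "\<lambda>_. 0"]) (simp add: continuous_on_const)
    moreover have "snd c x \<in> S"
      using c M chart_inv_left[OF manifold c] by (simp add: S_def)
    moreover have "coord_rep c (\<lambda>z. f' z t) z = coord_rep c (\<lambda>z. f z t) z" if "z \<in> S" for z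
      using that M(3) t by (auto simp: S_def coord_rep_def)
    ultimately have "covec (coord_rep c (\<lambda>z. f' z t)) (snd c x) = covec (coord_rep c (\<lambda>z. f z t)) (snd c x)"
      by (rule covec_cong)
    then show "spatial_grad g c f' x t \<noteq> 0"
      using barrier_covec_nz[OF manifold bar t f0 c] spatial_grad_eq_0_iff[OF manifold c] by metis
  qed (use ab smooth' in auto)
  have "(\<Union>t\<in>{a..b}. {x. f' x t \<le> 0}) = fst ` R1"
  proof (intro equalityI subsetI)
    fix x assume "x \<in> fst ` R1"
    then obtain t where "(x, t) \<in> R1" by auto
    moreover from this have "t \<in> {a..b}" using tr by (auto simp: track_def)
    ultimately show "x \<in> (\<Union>t\<in>{a..b}. {x. f' x t \<le> 0})" using f'R1 by auto
  qed (use f'R1 in force)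
  then have "compact (\<Union>t\<in>{a..b}. {x. f' x t \<le> 0})"
    using compact_continuous_image[OF continuous_on_fst[OF continuous_on_id] R(1)] by simp
  with bar' have "compact_barrier A g a b (\<lambda>t. {x. f' x t \<le> 0}) f'"
    by (simp add: compact_barrier_def)
  then show ?thesis
    using that[of f'] f'R1 local by blast
qed

context
  fixes C :: "'a set" and \<C> :: "('a \<times> real) set"
  assumes biggest: "biggest_flow A g C \<C>"
begin

lemma flow_subset: "\<C> \<subseteq> UNIV \<times> {0..}"
  using flow[OF manifold biggest] by (simp add: weak_set_flow_def)

text \<open>Represents the relative interior by a set that is open in all of space-time, so that
  ordinary open sets can be used at time \<open>0\<close> as well.\<close>

lemma relative_interior_open:
  obtains T where "open T" "T \<inter> UNIV \<times> {0..} \<subseteq> \<C>" "spacetime_boundary \<C> = \<C> - T"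
proof -
  have "openin (top_of_set (UNIV \<times> {0..})) (top_of_set (UNIV \<times> {0..}) interior_of \<C>)"
    by (rule openin_interior_of)
  then obtain T where T: "open T" "top_of_set (UNIV \<times> {0..}) interior_of \<C> = (UNIV \<times> {0..}) \<inter> T"
    unfolding openin_open by blast
  have "T \<inter> UNIV \<times> {0..} \<subseteq> \<C>"
    using T(2) interior_of_subset[of "top_of_set (UNIV \<times> {0..})" \<C>] by auto
  moreover have "spacetime_boundary \<C> = \<C> - T"
    using flow_subset by (auto simp: spacetime_boundary_def T(2))
  ultimately show ?thesis using that T(1) by blast
qed

lemma not_in_boundary:
  assumes "open N" "q \<in> N" "N \<inter> UNIV \<times> {0..} \<subseteq> \<C>"
  shows "q \<notin> spacetime_boundary \<C>"
proof
  assume q: "q \<in> spacetime_boundary \<C>"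
  have "openin (top_of_set (UNIV \<times> {0..})) (N \<inter> UNIV \<times> {0..})"
    using assms(1) by (auto simp: openin_open)
  then have "N \<inter> UNIV \<times> {0..} \<subseteq> top_of_set (UNIV \<times> {0..}) interior_of \<C>"
    using assms(3) by (intro interior_of_maximal)
  moreover have "q \<in> N \<inter> UNIV \<times> {0..}"
    using q assms(2) flow_subset by (auto simp: spacetime_boundary_def)
  ultimately show False using q by (auto simp: spacetime_boundary_def)
qed

text \<open>A ball around an interior point of \<open>C\<close> persists for a short time by
  \<open>ball_in_flow\<close> with \<open>t0 = 0\<close>, so the point is in the relative interior.
  Conversely, the time \<open>0\<close> slice of a relatively open set is open in the
  manifold.\<close>

lemma boundary_start: "closed C \<Longrightarrow> time_slice (spacetime_boundary \<C>) 0 = frontier C"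
proof (intro equalityI subsetI)
  fix x assume C: "closed C" and x: "x \<in> time_slice (spacetime_boundary \<C>) 0"
  then have xC: "x \<in> C"
    using flow_start[OF manifold biggest] by (auto simp: time_slice_def spacetime_boundary_def)
  have "x \<notin> interior C"
  proof
    assume xi: "x \<in> interior C"
    obtain c where c: "c \<in> A" "x \<in> fst c" using chart_exists[OF manifold] by blast
    have "open (coords c \<inter> chart_inv c -` interior C)"
      by (intro continuous_open_preimage continuous_on_chart_inv[OF manifold c(1)] open_coords[OF manifold c(1)]) simp
    moreover have "snd c x \<in> coords c \<inter> chart_inv c -` interior C"
      using c xi chart_inv_left[OF manifold c] by simp
    ultimately obtain r where r: "r > 0" "cball (snd c x) r \<subseteq> coords c \<inter> chart_inv c -` interior C"
      unfolding open_contains_cball by meson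
    have "(chart_inv c z, 0) \<in> \<C>" if "z \<in> cball (snd c x) r" for z
      using that r(2) interior_subset[of C] flow_start[OF manifold biggest] by (auto simp: time_slice_def)
    moreover obtain \<tau> where "\<tau> > 0" "\<And>t0 z t. 0 \<le> t0 \<Longrightarrow> (\<And>z. z \<in> cball (snd c x) r \<Longrightarrow> (chart_inv c z, t0) \<in> \<C>) \<Longrightarrow>
        z \<in> cball (snd c x) (r / 2) \<Longrightarrow> t \<in> {t0..t0 + \<tau>} \<Longrightarrow> (chart_inv c z, t) \<in> \<C>"
      using ball_in_flow[OF manifold biggest c(1) r(1), of "snd c x"] r(2) by blast
    ultimately have \<tau>: "\<tau> > 0" "\<And>z t. z \<in> cball (snd c x) (r / 2) \<Longrightarrow> t \<in> {0..\<tau>} \<Longrightarrow> (chart_inv c z, t) \<in> \<C>"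
      by fastforce+
    have "(x, 0) \<notin> spacetime_boundary \<C>"
    proof (rule not_in_boundary)
      \<comment> \<open>The times \<open>{..<\<tau>}\<close> extend below \<open>0\<close>, which
        makes the set open; only its part at nonnegative times has to lie in
        \<open>\<C>\<close>.\<close>
      show "open {(x', t). x' \<in> fst c \<and> (snd c x', t) \<in> ball (snd c x) (r / 2) \<times> {..<\<tau>}}"
        by (intro open_chart_preimage[OF manifold c(1)] open_Times) auto
      show "{(x', t). x' \<in> fst c \<and> (snd c x', t) \<in> ball (snd c x) (r / 2) \<times> {..<\<tau>}} \<inter> UNIV \<times> {0..} \<subseteq> \<C>"
      proof (clarify, simp)
        fix x' t assume "x' \<in> fst c" "dist (snd c x) (snd c x') * 2 < r" "t < \<tau>" "0 \<le> t"
        then show "(x', t) \<in> \<C>"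
          using \<tau>(2)[of "snd c x'" t] chart_inv_left[OF manifold c(1)] by simp
      qed
    qed (use c r \<tau> in auto)
    then show False using x by (simp add: time_slice_def)
  qed
  then show "x \<in> frontier C"
    using xC C by (simp add: frontier_def)
next
  fix x assume C: "closed C" and x: "x \<in> frontier C"
  obtain T where T: "open T" "T \<inter> UNIV \<times> {0..} \<subseteq> \<C>" "spacetime_boundary \<C> = \<C> - T"
    using relative_interior_open .
  have "(x, 0) \<in> \<C>"
    using x C flow_start[OF manifold biggest] by (auto simp: frontier_def time_slice_def)
  moreover have "(x, 0) \<notin> T"
  proof
    assume "(x, 0) \<in> T"
    have "open ((\<lambda>x. (x, 0::real)) -` T)"
      using T(1) by (intro open_vimage continuous_intros)
    moreover have "(\<lambda>x. (x, 0)) -` T \<subseteq> C"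
      using T(2) flow_start[OF manifold biggest] by (auto simp: time_slice_def)
    ultimately have "x \<in> interior C"
      using \<open>(x, 0) \<in> T\<close> by (intro interiorI[of "(\<lambda>x. (x, 0)) -` T"]) auto
    then show False using x by (simp add: frontier_def)
  qed
  ultimately show "x \<in> time_slice (spacetime_boundary \<C>) 0"
    by (simp add: time_slice_def T(3))
qed

text \<open>Before time \<open>b\<close> the track lies in the interior of \<open>\<C>\<close> or outside \<open>\<C>\<close>; local connectedness up
  to time \<open>b\<close> shows that the two parts cannot meet at the final time either.\<close>

lemma track_splits:
  assumes comp: "compact_barrier A g a b K f" and a: "0 \<le> a"
    and disj: "\<And>t. t \<in> {a..<b} \<Longrightarrow> K t \<inter> time_slice (spacetime_boundary \<C>) t = {}"
  obtains R1 R2 where "compact R1" "compact R2" "R1 \<inter> R2 = {}" "track a b f = R1 \<union> R2"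
    "\<And>q. q \<in> R1 \<inter> open_track a b f \<Longrightarrow> q \<notin> \<C>"
    "\<And>q. q \<in> R2 \<Longrightarrow> \<exists>N. open N \<and> q \<in> N \<and> N \<inter> open_track a b f \<subseteq> \<C>"
proof -
  have bar: "smooth_barrier A g a b K f" and ab: "a < b" and K: "\<And>t. t \<in> {a..b} \<Longrightarrow> K t = {x. f x t \<le> 0}"
    using comp by (auto simp: compact_barrier_def smooth_barrier_def)
  obtain T where T: "open T" "T \<inter> UNIV \<times> {0..} \<subseteq> \<C>" "spacetime_boundary \<C> = \<C> - T"
    using relative_interior_open .
  \<comment> \<open>On the track before time \<open>b\<close> the closed set \<open>\<C>\<close> and
    the open set \<open>T\<close> coincide, so membership in \<open>\<C>\<close> is constant on
    connected parts.\<close>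
  have T_iff: "q \<in> \<C> \<longleftrightarrow> q \<in> T" if "q \<in> open_track a b f" for q
  proof -
    obtain x t where "q = (x, t)" by fastforce
    with that have q: "q = (x, t)" "t \<in> {a..<b}" "f x t \<le> 0"
      by (auto simp: open_track_def)
    then have "q \<notin> spacetime_boundary \<C>"
      using disj[OF q(2)] K[of t] by (auto simp: time_slice_def)
    then show ?thesis using T q a by auto
  qed
  \<comment> \<open>Both sets look only at the track before time \<open>b\<close>, and may contain
    points of time \<open>b\<close>. Membership of \<open>(p, b)\<close> in \<open>\<C>\<close>
    would not decide the side, as the outer part may touch \<open>\<C>\<close> at that time.\<close>
  define out where "out = \<Union>{N. open N \<and> N \<inter> open_track a b f \<inter> \<C> = {}}"
  define inn where "inn = \<Union>{N. open N \<and> N \<inter> open_track a b f \<subseteq> \<C>}"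
  have op: "open out" "open inn" by (auto simp: out_def inn_def)
  have cover: "q \<in> out \<union> inn" if q: "q \<in> track a b f" for q
  proof -
    obtain x t where xt: "q = (x, t)" "t \<in> {a..b}" "f x t \<le> 0"
      using q by (auto simp: track_def)
    show ?thesis
    proof (cases "t < b")
      case True
      then have "q \<in> open_track a b f" using xt by (simp add: open_track_def)
      have "- \<C> \<subseteq> out" "T \<subseteq> inn"
        unfolding out_def inn_def using flow_closed[OF manifold biggest] T T_iff by (auto intro!: Sup_upper)
      then show ?thesis using T_iff[OF \<open>q \<in> open_track a b f\<close>] by blast
    next
      case False
      then have q: "q = (x, b)" "f x b \<le> 0" using xt by auto
      obtain N q0 where N: "open N" "(x, b) \<in> N"
        and conn: "\<And>q. q \<in> N \<inter> open_track a b f \<Longrightarrow> \<exists>S. connected S \<and> q \<in> S \<and> q0 \<in> S \<and> S \<subseteq> open_track a b f"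
        by (rule open_track_locally_connected[OF manifold bar q(2)]) (rule that)
      have same: "q \<in> \<C> \<longleftrightarrow> q0 \<in> \<C>" if "q \<in> N \<inter> open_track a b f" for q
      proof -
        from conn[OF that] obtain S where S: "connected S" "q \<in> S" "q0 \<in> S" "S \<subseteq> open_track a b f"
          by blast
        have "T \<inter> - \<C> \<inter> S = {}" "S \<subseteq> T \<union> - \<C>"
          using S(4) T_iff by blast+
        with connectedD[OF S(1) T(1) open_Compl[OF flow_closed[OF manifold biggest]]]
        have "T \<inter> S = {} \<or> - \<C> \<inter> S = {}" by blast
        then show ?thesis using S T_iff by blast
      qed
      show ?thesis
      proof (cases "q0 \<in> \<C>")
        case True
        then have "N \<subseteq> inn" unfolding inn_def using N same by blast
        then show ?thesis using N q by blast
      next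
        case False
        then have "N \<subseteq> out" unfolding out_def using N same by blast
        then show ?thesis using N q by blast
      qed
    qed
  qed
  have excl: "q \<notin> out \<inter> inn" if q: "q \<in> track a b f" for q
  proof
    assume "q \<in> out \<inter> inn"
    then obtain N1 N2 where N: "open N1" "q \<in> N1" "N1 \<inter> open_track a b f \<inter> \<C> = {}"
      "open N2" "q \<in> N2" "N2 \<inter> open_track a b f \<subseteq> \<C>"
      by (auto simp: out_def inn_def)
    have "(N1 \<inter> N2) \<inter> open_track a b f \<noteq> {}"
      by (rule open_track_dense[OF manifold bar q]) (use N in auto)
    then show False using N by blast
  qed
  show ?thesis
  \<comment> \<open>Removing open sets from the compact track gives compact pieces; by
    \<open>cover\<close> and \<open>excl\<close> they are complementary.\<close>
  proof (rule that[of "track a b f - inn" "track a b f - out"])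
    show "compact (track a b f - inn)" "compact (track a b f - out)"
      using compact_track[OF manifold comp] op by (auto intro: compact_diff)
    show "(track a b f - inn) \<inter> (track a b f - out) = {}" "track a b f = (track a b f - inn) \<union> (track a b f - out)"
      using cover excl by blast+
    show "q \<notin> \<C>" if "q \<in> (track a b f - inn) \<inter> open_track a b f" for q
    proof -
      have "q \<in> out" using that cover by blast
      then show ?thesis using that by (auto simp: out_def)
    qed
    show "\<exists>N. open N \<and> q \<in> N \<and> N \<inter> open_track a b f \<subseteq> \<C>" if "q \<in> track a b f - out" for q
    proof -
      have "q \<in> inn" using that cover by blast
      then show ?thesis by (auto simp: inn_def)
    qed
  qed
qed

text \<open>Near the point one smooth extension serves both functions, and its level speed equals
  both values of \<open>\<Phi>\<close>.\<close>

lemma barrier_Phi_cong: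
  assumes sm: "smooth_in_spacetime A a b f" "smooth_in_spacetime A a b f'" and c: "c \<in> A" "x \<in> fst c"
    and t: "t \<in> {a..b}" "a < b" and nz: "covec (coord_rep c (\<lambda>z. f z t)) (snd c x) \<noteq> 0"
    and N: "open N" "(x, t) \<in> N" "\<forall>(x, t)\<in>N. t \<in> {a..b} \<longrightarrow> f' x t = f x t"
  shows "barrier_Phi g c a b f' x t = barrier_Phi g c a b f x t"
proof -
  have y: "snd c x \<in> coords c" using c by auto
  obtain V F where V: "open V" "(snd c x, t) \<in> V" "V \<subseteq> coords c \<times> UNIV" "\<And>k. Ck_on k V F"
    and F: "\<And>z s. (z, s) \<in> V \<Longrightarrow> s \<in> {a..b} \<Longrightarrow> F (z, s) = f (chart_inv c z) s"
    by (rule spacetime_extension[OF manifold sm(1) c(1) y t(1)]) (rule that)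
  define W where "W = V \<inter> {(z, t). z \<in> coords c \<and> (chart_inv c z, t) \<in> N}"
  have W: "open W" "(snd c x, t) \<in> W" "\<And>k. Ck_on k W F"
    using V N y chart_inv_left[OF manifold c]
    by (auto simp: W_def intro!: open_Int open_chart_inv_preimage[OF manifold c(1)] Ck_on_subset[OF _ V(4)])
  have FW: "F (z, s) = f (chart_inv c z) s" "F (z, s) = f' (chart_inv c z) s" if "(z, s) \<in> W" "s \<in> {a..b}" for z s
    using that F N(3) by (auto simp: W_def)
  have "covec (coord_rep c (\<lambda>z. f z t)) (snd c x) = covec (\<lambda>z. F (z, t)) (snd c x)"
    by (rule covec_extension[OF manifold c W(1,2,3) _ t]) (rule FW(1))
  then have nz': "covec (\<lambda>z. F (z, t)) (snd c x) \<noteq> 0" using nz by simp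
  have "barrier_Phi g c a b f x t = level_speed (g c) F (snd c x) t"
    by (rule barrier_Phi_level_speed[OF manifold sm(1) c W(1,2,3) _ t nz']) (rule FW(1))
  moreover have "barrier_Phi g c a b f' x t = level_speed (g c) F (snd c x) t"
    by (rule barrier_Phi_level_speed[OF manifold sm(2) c W(1,2,3) _ t nz']) (rule FW(2))
  ultimately show ?thesis by simp
qed

lemma boundary_weak_set_flow: "weak_set_flow A g (spacetime_boundary \<C>)"
proof -
  obtain T where T: "open T" "T \<inter> UNIV \<times> {0..} \<subseteq> \<C>" "spacetime_boundary \<C> = \<C> - T"
    using relative_interior_open .
  have "p \<in> frontier (K b) \<and> (\<forall>c\<in>A. p \<in> fst c \<longrightarrow> barrier_Phi g c a b f p b \<ge> 0)"
    if a: "0 \<le> a" and comp: "compact_barrier A g a b K f"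
      and disj: "\<And>t. t \<in> {a..<b} \<Longrightarrow> K t \<inter> time_slice (spacetime_boundary \<C>) t = {}"
      and pK: "p \<in> K b" and pM: "(p, b) \<in> spacetime_boundary \<C>" for a b K f p
  proof -
    have bar: "smooth_barrier A g a b K f" and ab: "a < b" and sm: "smooth_in_spacetime A a b f"
      and K: "\<And>t. t \<in> {a..b} \<Longrightarrow> K t = {x. f x t \<le> 0}"
      using comp by (auto simp: compact_barrier_def smooth_barrier_def)
    have bab: "b \<in> {a..b}" using ab by simp
    have pC: "(p, b) \<in> \<C>" using pM by (simp add: spacetime_boundary_def)
    have ni: "(p, b) \<notin> interior \<C>"
      using not_in_boundary[of "interior \<C>" "(p, b)"] pM interior_subset[of \<C>] by auto
    have fp: "f p b \<le> 0" using pK K[OF bab] by simp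
    obtain R1 R2 where R: "compact R1" "compact R2" "R1 \<inter> R2 = {}" "track a b f = R1 \<union> R2"
      and R1: "\<And>q. q \<in> R1 \<inter> open_track a b f \<Longrightarrow> q \<notin> \<C>"
      and R2: "\<And>q. q \<in> R2 \<Longrightarrow> \<exists>N. open N \<and> q \<in> N \<and> N \<inter> open_track a b f \<subseteq> \<C>"
      by (rule track_splits[OF comp a disj]) (assumption, rule that)
    have "(p, b) \<in> R1 \<union> R2" using fp bab R(4) by (auto simp: track_def)
    then show ?thesis
    proof
      assume "(p, b) \<in> R2"
      then obtain N where N: "open N" "(p, b) \<in> N" "N \<inter> open_track a b f \<subseteq> \<C>" using R2 by blast
      have inside: "(x, t) \<in> \<C>" if "(x, t) \<in> N" "t \<in> {a..<b}" "f x t \<le> 0" for x t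
        using that N(3) by (auto simp: open_track_def)
      have "f p b = 0"
      proof (rule ccontr)
        assume "f p b \<noteq> 0"
        then have "f p b < 0" using fp by simp
        have "(p, b) \<in> interior \<C>"
          by (rule interior_in_flow[OF manifold biggest bar a N(1,2) _ \<open>f p b < 0\<close>]) (rule inside)
        then show False using ni by simp
      qed
      moreover have "barrier_Phi g c a b f p b \<ge> 0" if c: "c \<in> A" "p \<in> fst c" for c
      proof (rule ccontr)
        assume "\<not> barrier_Phi g c a b f p b \<ge> 0"
        then have "barrier_Phi g c a b f p b < 0" by simp
        have "(p, b) \<in> interior \<C>"
          by (rule slow_boundary_in_flow[OF manifold biggest bar a N(1,2) _ \<open>f p b = 0\<close> c \<open>_ < 0\<close>]) (rule inside)
        then show False using ni by simp
      qed
      ultimately show ?thesis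
        using barrier_frontier[OF manifold bar bab] by blast
    next
      assume pR1: "(p, b) \<in> R1"
      obtain f' where comp': "compact_barrier A g a b (\<lambda>t. {x. f' x t \<le> 0}) f'"
        and f': "\<And>x t. t \<in> {a..b} \<Longrightarrow> f' x t \<le> 0 \<longleftrightarrow> (x, t) \<in> R1"
        and loc: "\<And>q. q \<in> R1 \<Longrightarrow> \<exists>N. open N \<and> q \<in> N \<and> (\<forall>(x, t)\<in>N. t \<in> {a..b} \<longrightarrow> f' x t = f x t)"
        by (rule barrier_restrict[OF comp R]) (rule that)
      have disj': "{x. f' x t \<le> 0} \<inter> time_slice \<C> t = {}" if t: "t \<in> {a..<b}" for t
      proof -
        have "(x, t) \<notin> \<C>" if "f' x t \<le> 0" for x
        proof -
          have "(x, t) \<in> R1" using f'[of t x] that t by simp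
          moreover from this have "(x, t) \<in> open_track a b f"
            using R(4) t by (auto simp: track_def open_track_def)
          ultimately show ?thesis using R1 by blast
        qed
        then show ?thesis by (auto simp: time_slice_def)
      qed
      have p': "p \<in> {x. f' x b \<le> 0}" using f'[OF bab] pR1 by simp
      \<comment> \<open>The piece \<open>R1\<close> is a barrier of its own that avoids
        \<open>\<C>\<close> before time \<open>b\<close>. What follows carries the conclusions for
        \<open>f'\<close> back to \<open>f\<close>, which agrees with it near
        \<open>(p, b)\<close>.\<close>
      have touch: "p \<in> frontier {x. f' x b \<le> 0}"
        "c \<in> A \<Longrightarrow> p \<in> fst c \<Longrightarrow> barrier_Phi g c a b f' p b \<ge> 0" for c
        by (rule weak_set_flowD[OF flow[OF manifold biggest] a comp' _ p' pC]; simp add: disj')+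
      obtain N where N: "open N" "(p, b) \<in> N" "\<forall>(x, t)\<in>N. t \<in> {a..b} \<longrightarrow> f' x t = f x t"
        using loc[OF pR1] by blast
      \<comment> \<open>Were \<open>f p b < 0\<close>, then \<open>f' = f\<close> would be negative
        near \<open>p\<close> at time \<open>b\<close>, and \<open>p\<close> would be interior to
        the restricted barrier.\<close>
      have f0: "f p b = 0"
      proof (rule ccontr)
        assume "f p b \<noteq> 0"
        then have neg: "f p b < 0" using fp by simp
        have "continuous_on UNIV (\<lambda>x. f x b)"
        proof -
          have "continuous_on UNIV (\<lambda>x::'a. (x, b))" by (intro continuous_intros)
          moreover have "(\<lambda>x::'a. (x, b)) ` UNIV \<subseteq> UNIV \<times> {a..b}" using bab by auto
          ultimately show ?thesis
            using continuous_on_compose2[OF continuous_on_spacetime[OF manifold sm]] by fastforce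
        qed
        then have "open ((\<lambda>x. f x b) -` {..<0})"
          by (intro open_vimage) auto
        moreover have "open ((\<lambda>x. (x, b)) -` N)"
          using N(1) by (intro open_vimage continuous_intros)
        ultimately have "open ((\<lambda>x. f x b) -` {..<0} \<inter> (\<lambda>x. (x, b)) -` N)"
          by (rule open_Int)
        moreover have "(\<lambda>x. f x b) -` {..<0} \<inter> (\<lambda>x. (x, b)) -` N \<subseteq> {x. f' x b \<le> 0}"
          using N(3) bab by auto
        ultimately have "p \<in> interior {x. f' x b \<le> 0}"
          using neg N(2) by (intro interiorI) auto
        then show False using touch(1) by (simp add: frontier_def)
      qed
      have "barrier_Phi g c a b f p b \<ge> 0" if c: "c \<in> A" "p \<in> fst c" for c
      proof -
        have "smooth_in_spacetime A a b f'"
          using comp' by (simp add: compact_barrier_def smooth_barrier_def)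
        from barrier_Phi_cong[OF sm this c bab ab barrier_covec_nz[OF manifold bar bab f0 c] N]
        show ?thesis using touch(2)[OF c] by simp
      qed
      then show ?thesis
        using barrier_frontier[OF manifold bar bab f0] by blast
    qed
  qed
  moreover have "spacetime_boundary \<C> \<subseteq> UNIV \<times> {0..}" "closed (spacetime_boundary \<C>)"
    using flow_subset flow_closed[OF manifold biggest] T(1) unfolding T(3) by (auto intro: closed_Diff)
  ultimately show ?thesis
    unfolding weak_set_flow_def by (auto simp: time_slice_def)
qed

end

end

theorem theorem26:
  fixes A :: "('a::{t2_space,second_countable_topology}, 'n::finite) chart set"
    and g :: "('a, 'n) chart \<Rightarrow> real ^ 'n \<Rightarrow> real ^ 'n ^ 'n"
    and C :: "'a set" and \<C> :: "('a \<times> real) set"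
  assumes "riemannian_manifold A g"
    and "closed C"
    and "biggest_flow A g C \<C>"
  shows "weak_set_flow A g (spacetime_boundary \<C>)
    \<and> time_slice (spacetime_boundary \<C>) 0 = frontier C"
  using boundary_weak_set_flow[OF assms(1,3)] boundary_start[OF assms(1,3,2)] by blast

end
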